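(* Consider the class of LQCI instances in which the hard specification $\mathcal{H}$ is given by a DFA, the label function $L$ is given by a DFA whose states are annotated with integers and which assigns to a word the integer of the state on which its run ends, the cost function $\mathcal{K}$ is given by a weighted DFA (each state annotated with an integer cost, and the cost of a word being the sum, with multiplicity, of the costs of the states visited along the DFA's run on the word), the length bounds $m,n$ are encoded in unary, and all other numerical parameters (including the state costs) are encoded in binary. This class has a pseudopolynomial improvisation scheme.
   Context: Fix a finite alphabet $\Sigma$. An LQCI instance is a tuple $\mathcal{C}=(\mathcal{H},\mathcal{K},L,m,n,c,\lambda,\rho,\hat{\alpha},\hat{\beta})$ where $m\le n$ are natural numbers; $\mathcal{H}$ is a hard specification (a set of words over $\Sigma$); $\mathcal{K}:\Sigma^*\to\mathbb{Q}$ is a cost function; $L:\Sigma^*\to\Omega$ is a label function into a finite set $\Omega=\{\ell_1,\dots,\ell_{|\Omega|}\}$; $c\in\mathbb{Q}^+$; $0\le\lambda\le\rho\le1$ rationals; and for each $i$, rationals $0\le\hat{\alpha}_i\le\hat{\beta}_i\le1$. Let $I=\{w\in\Sigma^*: m\le|w|\le n,\ w\text{ satisfies }\mathcal{H}\}$ and $I_i=\{w\in I: L(w)=\ell_i\}$. A distribution $D$ over $\Sigma^*$ is improvising if: $\Pr[w\in I\mid w\leftarrow D]=1$; $E[\mathcal{K}(w)\mid w\leftarrow D]\le c$; for all $i$, $\lambda\le\Pr[w\in I_i\mid w\leftarrow D]\le\rho$; and for all $i$ and $y\in I_i$, $\hat{\alpha}_i\le\Pr[w=y\mid w\in I_i,w\leftarrow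 D]\le\hat{\beta}_i$. The instance is feasible if an improvising distribution exists. An improviser is a probabilistic algorithm taking no input, with finite expected running time, whose output distribution is improvising. The LQCI problem: given an instance, determine whether it is feasible and, if so, produce an improviser. An improvisation scheme for a class is a probabilistic algorithm with finite expected runtime solving the LQCI problem on that class. It is pseudopolynomial if its running time and the expected running time of the improvisers it outputs are polynomial in the size of the instance and the magnitudes of its integer state costs (equivalently, polynomial in the instance size when these integers are encoded in unary). *)

theory Defs
  imports
    "HOL-Probability.Probability"
    "HOL-Library.Log_Nat"
    "HOL-Computational_Algebra.Polynomial"
begin

section \<open>Labelled quantitative control improvisation\<close>

text \<open>The alphabet is \<open>{..<k}\<close>, for an arbitrary but fixed \<open>k\<close>.\<close>

type_synonym word = "nat list"

definition words :: "nat \<Rightarrow> word set" where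
  "words k = lists {..<k}"

text \<open>The components of an instance that are plain parameters. The list \<open>labels\<close> enumerates
  \<open>\<Omega>\<close>; \<open>label_lo\<close>, \<open>label_hi\<close> are
  \<open>\<lambda>\<close>, \<open>\<rho>\<close>, and \<open>cond_lo ! i\<close>, \<open>cond_hi ! i\<close> are the bounds \<open>\<alpha>\<close>, \<open>\<beta>\<close> of the \<open>i\<close>-th label.\<close>

record 'l lqci_params =
  min_len :: nat
  max_len :: nat
  labels :: "'l list"
  cost_bound :: rat
  label_lo :: rat
  label_hi :: rat
  cond_lo :: "rat list"
  cond_hi :: "rat list"

record 'l lqci =
  hard_spec :: "word set"
  cost_fun :: "word \<Rightarrow> rat"
  label_fun :: "word \<Rightarrow> 'l"
  params :: "'l lqci_params"

definition valid_params :: "'l lqci_params \<Rightarrow> bool" where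
  "valid_params p \<longleftrightarrow>
     min_len p \<le> max_len p \<and> distinct (labels p) \<and> 0 < cost_bound p \<and>
     0 \<le> label_lo p \<and> label_lo p \<le> label_hi p \<and> label_hi p \<le> 1 \<and>
     length (cond_lo p) = length (labels p) \<and> length (cond_hi p) = length (labels p) \<and>
     (\<forall>i < length (labels p). 0 \<le> cond_lo p ! i \<and> cond_lo p ! i \<le> cond_hi p ! i \<and> cond_hi p ! i \<le> 1)"

definition valid_lqci :: "nat \<Rightarrow> 'l lqci \<Rightarrow> bool" where
  "valid_lqci k C \<longleftrightarrow>
     hard_spec C \<subseteq> words k \<and> valid_params (params C) \<and>
     (\<forall>w \<in> words k. label_fun C w \<in> set (labels (params C)))"

definition improvisations :: "nat \<Rightarrow> 'l lqci \<Rightarrow> word set" where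
  "improvisations k C =
     {w \<in> words k. min_len (params C) \<le> length w \<and> length w \<le> max_len (params C) \<and>
        w \<in> hard_spec C}"

definition label_class :: "nat \<Rightarrow> 'l lqci \<Rightarrow> nat \<Rightarrow> word set" where
  "label_class k C i = {w \<in> improvisations k C. label_fun C w = labels (params C) ! i}"

text \<open>The conditional probabilities given \<open>label_class k C i\<close> are only constrained if they are
  defined, i.e. if the class has positive probability.\<close>

definition improvising :: "nat \<Rightarrow> 'l lqci \<Rightarrow> word pmf \<Rightarrow> bool" where
  "improvising k C D \<longleftrightarrow>
     measure_pmf.prob D (improvisations k C) = 1 \<and>
     measure_pmf.expectation D (\<lambda>w. real_of_rat (cost_fun C w))
       \<le> real_of_rat (cost_bound (params C)) \<and>
     (\<forall>i < length (labels (params C)).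
        real_of_rat (label_lo (params C)) \<le> measure_pmf.prob D (label_class k C i) \<and>
        measure_pmf.prob D (label_class k C i) \<le> real_of_rat (label_hi (params C))) \<and>
     (\<forall>i < length (labels (params C)). measure_pmf.prob D (label_class k C i) > 0 \<longrightarrow>
        (\<forall>y \<in> label_class k C i.
           real_of_rat (cond_lo (params C) ! i) \<le> \<P>(w in D. w = y \<bar> w \<in> label_class k C i) \<and>
           \<P>(w in D. w = y \<bar> w \<in> label_class k C i) \<le> real_of_rat (cond_hi (params C) ! i)))"

definition feasible :: "nat \<Rightarrow> 'l lqci \<Rightarrow> bool" where
  "feasible k C \<longleftrightarrow> (\<exists>D. improvising k C D)"


section \<open>Probabilistic algorithms and their running time\<close>

text \<open>Programs compute on nested lists of integers; the size of a value is its number of nodes plus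
  the binary length of the integers in it. The only source of randomness is a fair coin. The
  evaluation of every subexpression is charged one unit plus the size of its result, so the number
  of steps is logarithmic-cost and charges for all copying: it is polynomially related to the
  running time on (probabilistic) Turing machines.\<close>

datatype val = IntV int | ListV "val list"

fun vsize :: "val \<Rightarrow> nat" where
  "vsize (IntV i) = 1 + floorlog 2 (nat \<bar>i\<bar>)"
| "vsize (ListV vs) = 1 + sum_list (map vsize vs)"

primrec the_int :: "val \<Rightarrow> int" where
  "the_int (IntV i) = i"
| "the_int (ListV vs) = 0"

primrec the_list :: "val \<Rightarrow> val list" where
  "the_list (IntV i) = []"
| "the_list (ListV vs) = vs"

definition of_truth :: "bool \<Rightarrow> val" where
  "of_truth b = IntV (of_bool b)"

definition truthy :: "val \<Rightarrow> bool" where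
  "truthy v \<longleftrightarrow> v \<noteq> IntV 0"

datatype unop = OpHd | OpTl | OpLen | OpIsInt

datatype binop = OpAdd | OpSub | OpMul | OpDiv | OpMod | OpLess | OpEq | OpCons | OpNth | OpAppend

primrec apply_unop :: "unop \<Rightarrow> val \<Rightarrow> val" where
  "apply_unop OpHd v = (case the_list v of [] \<Rightarrow> ListV [] | x # xs \<Rightarrow> x)"
| "apply_unop OpTl v = ListV (tl (the_list v))"
| "apply_unop OpLen v = IntV (int (length (the_list v)))"
| "apply_unop OpIsInt v = of_truth (\<exists>i. v = IntV i)"

primrec apply_binop :: "binop \<Rightarrow> val \<Rightarrow> val \<Rightarrow> val" where
  "apply_binop OpAdd v w = IntV (the_int v + the_int w)"
| "apply_binop OpSub v w = IntV (the_int v - the_int w)"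
| "apply_binop OpMul v w = IntV (the_int v * the_int w)"
| "apply_binop OpDiv v w = IntV (the_int v div the_int w)"
| "apply_binop OpMod v w = IntV (the_int v mod the_int w)"
| "apply_binop OpLess v w = of_truth (the_int v < the_int w)"
| "apply_binop OpEq v w = of_truth (v = w)"
| "apply_binop OpCons v w = ListV (v # the_list w)"
| "apply_binop OpNth v w =
     (if 0 \<le> the_int w \<and> nat (the_int w) < length (the_list v)
      then the_list v ! nat (the_int w) else ListV [])"
| "apply_binop OpAppend v w = ListV (the_list v @ the_list w)"

text \<open>Variables are de Bruijn indices. \<open>Bind a b\<close> evaluates \<open>b\<close> with the result of \<open>a\<close> bound
  to index 0. \<open>While a c b\<close> starts with the result of \<open>a\<close> as current value and, as long as the
  condition \<open>c\<close> yields a non-zero value, replaces the current value by the result of \<open>b\<close>; both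
  \<open>c\<close> and \<open>b\<close> access the current value at index 0.\<close>

datatype prog =
    Var nat
  | Const val
  | Flip
  | Unop unop prog
  | Binop binop prog prog
  | Ite prog prog prog
  | Bind prog prog
  | While prog prog prog

text \<open>Results are paired with the running time; lost probability mass is nontermination.\<close>

definition charge :: "nat \<Rightarrow> val \<Rightarrow> (val \<times> nat) spmf" where
  "charge t v = return_spmf (v, t + 1 + vsize v)"

partial_function (spmf) loop ::
  "(val \<Rightarrow> (val \<times> nat) spmf) \<Rightarrow> (val \<Rightarrow> (val \<times> nat) spmf) \<Rightarrow> val \<Rightarrow> nat \<Rightarrow> (val \<times> nat) spmf"
where
  "loop c b v t =
     bind_spmf (c v) (\<lambda>(g, t1).
       if truthy g
       then bind_spmf (b v) (\<lambda>(v', t2). loop c b v' (t + t1 + t2 + 1))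
       else charge (t + t1) v)"

primrec eval :: "prog \<Rightarrow> val list \<Rightarrow> (val \<times> nat) spmf" where
  "eval (Var i) env = charge 0 (if i < length env then env ! i else ListV [])"
| "eval (Const v) env = charge 0 v"
| "eval Flip env = bind_spmf coin_spmf (\<lambda>b. charge 0 (of_truth b))"
| "eval (Unop f p) env = bind_spmf (eval p env) (\<lambda>(v, t). charge t (apply_unop f v))"
| "eval (Binop f p q) env =
     bind_spmf (eval p env) (\<lambda>(v, t1).
     bind_spmf (eval q env) (\<lambda>(w, t2). charge (t1 + t2) (apply_binop f v w)))"
| "eval (Ite c p q) env =
     bind_spmf (eval c env) (\<lambda>(g, t1).
     bind_spmf (if truthy g then eval p env else eval q env) (\<lambda>(v, t2). charge (t1 + t2) v))"
| "eval (Bind p q) env =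
     bind_spmf (eval p env) (\<lambda>(v, t1).
     bind_spmf (eval q (v # env)) (\<lambda>(w, t2). charge (t1 + t2) w))"
| "eval (While a c b) env =
     bind_spmf (eval a env) (\<lambda>(v, t).
     loop (\<lambda>x. eval c (x # env)) (\<lambda>x. eval b (x # env)) v t)"

definition outcome :: "prog \<Rightarrow> val list \<Rightarrow> val spmf" where
  "outcome p env = map_spmf fst (eval p env)"

definition expected_time :: "prog \<Rightarrow> val list \<Rightarrow> ennreal" where
  "expected_time p env =
     (if lossless_spmf (eval p env)
      then \<integral>\<^sup>+ x. of_nat (snd x) \<partial>measure_spmf (eval p env) else \<infinity>)"


section \<open>Programs as values\<close>

primrec code_unop :: "unop \<Rightarrow> val" where
  "code_unop OpHd = IntV 0"
| "code_unop OpTl = IntV 1"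
| "code_unop OpLen = IntV 2"
| "code_unop OpIsInt = IntV 3"

primrec code_binop :: "binop \<Rightarrow> val" where
  "code_binop OpAdd = IntV 0"
| "code_binop OpSub = IntV 1"
| "code_binop OpMul = IntV 2"
| "code_binop OpDiv = IntV 3"
| "code_binop OpMod = IntV 4"
| "code_binop OpLess = IntV 5"
| "code_binop OpEq = IntV 6"
| "code_binop OpCons = IntV 7"
| "code_binop OpNth = IntV 8"
| "code_binop OpAppend = IntV 9"

primrec code :: "prog \<Rightarrow> val" where
  "code (Var i) = ListV [IntV 0, IntV (int i)]"
| "code (Const v) = ListV [IntV 1, v]"
| "code Flip = ListV [IntV 2]"
| "code (Unop f p) = ListV [IntV 3, code_unop f, code p]"
| "code (Binop f p q) = ListV [IntV 4, code_binop f, code p, code q]"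
| "code (Ite c p q) = ListV [IntV 5, code c, code p, code q]"
| "code (Bind p q) = ListV [IntV 6, code p, code q]"
| "code (While a c b) = ListV [IntV 7, code a, code c, code b]"

lemma code_unop_inject: "code_unop f = code_unop g \<longleftrightarrow> f = g"
  by (cases f; cases g) auto

lemma code_binop_inject: "code_binop f = code_binop g \<longleftrightarrow> f = g"
  by (cases f; cases g) auto

lemma code_inject: "code p = code q \<longleftrightarrow> p = q"
proof (induction p arbitrary: q)
  case (Unop f p) then show ?case by (cases q) (auto simp: code_unop_inject)
next
  case (Binop f p1 p2) then show ?case by (cases q) (auto simp: code_binop_inject)
qed (case_tac q; auto)+


section \<open>Improvisers and improvisation schemes\<close>

definition word_val :: "word \<Rightarrow> val" where
  "word_val w = ListV (map (\<lambda>a. IntV (int a)) w)"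

definition improviser :: "nat \<Rightarrow> 'l lqci \<Rightarrow> prog \<Rightarrow> bool" where
  "improviser k C P \<longleftrightarrow>
     expected_time P [] < \<infinity> \<and>
     (\<exists>D. improvising k C D \<and> outcome P [] = spmf_of_pmf (map_pmf word_val D))"

text \<open>A scheme reports infeasibility by \<open>ListV []\<close> and returns an improviser \<open>P\<close> as
  \<open>ListV [code P]\<close>.\<close>

definition lqci_solution :: "nat \<Rightarrow> 'l lqci \<Rightarrow> val \<Rightarrow> bool" where
  "lqci_solution k C v \<longleftrightarrow>
     (if feasible k C then \<exists>P. v = ListV [code P] \<and> improviser k C P else v = ListV [])"

text \<open>A class of instances is given by a set \<open>R\<close> of representations, the instance \<open>sem r\<close> denoted
  by a representation \<open>r\<close>, and the encoding \<open>enc r\<close> passed to a scheme.\<close>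

definition improvisation_scheme ::
  "nat \<Rightarrow> 'r set \<Rightarrow> ('r \<Rightarrow> 'l lqci) \<Rightarrow> ('r \<Rightarrow> val) \<Rightarrow> prog \<Rightarrow> bool" where
  "improvisation_scheme k R sem enc S \<longleftrightarrow>
     (\<forall>r \<in> R. expected_time S [enc r] < \<infinity> \<and>
        (\<forall>v \<in> set_spmf (outcome S [enc r]). lqci_solution k (sem r) v))"

text \<open>Here \<open>mag r\<close> is the total magnitude of the numbers that count as if encoded in unary. The
  running time of the scheme itself is bounded on every run, not only in expectation.\<close>

definition pseudopolynomial ::
  "'r set \<Rightarrow> ('r \<Rightarrow> val) \<Rightarrow> ('r \<Rightarrow> nat) \<Rightarrow> prog \<Rightarrow> bool" where
  "pseudopolynomial R enc mag S \<longleftrightarrow>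
     (\<exists>b :: nat poly. \<forall>r \<in> R. \<forall>(v, t) \<in> set_spmf (eval S [enc r]).
        t \<le> poly b (vsize (enc r) + mag r) \<and>
        (\<forall>P. v = ListV [code P] \<longrightarrow>
           expected_time P [] \<le> of_nat (poly b (vsize (enc r) + mag r))))"


section \<open>Instances given by automata\<close>

text \<open>A DFA with states \<open>{..<length (trans M)}\<close>, the \<open>q\<close>-th of which has the annotation
  \<open>ann M ! q\<close>: acceptance, a label, or a cost.\<close>

record 'b dfa =
  init :: nat
  trans :: "nat list list"
  ann :: "'b list"

definition valid_dfa :: "nat \<Rightarrow> 'b dfa \<Rightarrow> bool" where
  "valid_dfa k M \<longleftrightarrow>
     init M < length (trans M) \<and> length (ann M) = length (trans M) \<and>
     (\<forall>row \<in> set (trans M). length row = k \<and> (\<forall>q \<in> set row. q < length (trans M)))"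

fun run_from :: "'b dfa \<Rightarrow> nat \<Rightarrow> word \<Rightarrow> nat list" where
  "run_from M q [] = [q]"
| "run_from M q (a # w) = q # run_from M (trans M ! q ! a) w"

definition run :: "'b dfa \<Rightarrow> word \<Rightarrow> nat list" where
  "run M w = run_from M (init M) w"

definition final_ann :: "'b dfa \<Rightarrow> word \<Rightarrow> 'b" where
  "final_ann M w = ann M ! last (run M w)"

definition dfa_language :: "nat \<Rightarrow> bool dfa \<Rightarrow> word set" where
  "dfa_language k M = {w \<in> words k. final_ann M w}"

definition accumulated_cost :: "int dfa \<Rightarrow> word \<Rightarrow> int" where
  "accumulated_cost M w = (\<Sum>q \<leftarrow> run M w. ann M ! q)"

record dfa_lqci =
  hard_dfa :: "bool dfa"
  cost_dfa :: "int dfa"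
  label_dfa :: "int dfa"
  dfa_params :: "int lqci_params"

definition lqci_of :: "nat \<Rightarrow> dfa_lqci \<Rightarrow> int lqci" where
  "lqci_of k r =
     \<lparr>hard_spec = dfa_language k (hard_dfa r),
      cost_fun = (\<lambda>w. of_int (accumulated_cost (cost_dfa r) w)),
      label_fun = final_ann (label_dfa r),
      params = dfa_params r\<rparr>"

definition dfa_instances :: "nat \<Rightarrow> dfa_lqci set" where
  "dfa_instances k =
     {r. valid_dfa k (hard_dfa r) \<and> valid_dfa k (cost_dfa r) \<and> valid_dfa k (label_dfa r) \<and>
         valid_lqci k (lqci_of k r)}"

definition nat_val :: "nat \<Rightarrow> val" where
  "nat_val n = IntV (int n)"

definition unary_val :: "nat \<Rightarrow> val" where
  "unary_val n = ListV (replicate n (IntV 0))"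

definition rat_val :: "rat \<Rightarrow> val" where
  "rat_val x = ListV [IntV (fst (quotient_of x)), IntV (snd (quotient_of x))]"

definition dfa_val :: "('b \<Rightarrow> val) \<Rightarrow> 'b dfa \<Rightarrow> val" where
  "dfa_val f M =
     ListV [nat_val (init M),
            ListV (map (\<lambda>row. ListV (map nat_val row)) (trans M)),
            ListV (map f (ann M))]"

definition params_val :: "int lqci_params \<Rightarrow> val" where
  "params_val p =
     ListV [unary_val (min_len p), unary_val (max_len p), ListV (map IntV (labels p)),
            rat_val (cost_bound p), rat_val (label_lo p), rat_val (label_hi p),
            ListV (map rat_val (cond_lo p)), ListV (map rat_val (cond_hi p))]"

definition dfa_lqci_val :: "dfa_lqci \<Rightarrow> val" where
  "dfa_lqci_val r =
     ListV [dfa_val of_truth (hard_dfa r), dfa_val IntV (cost_dfa r), dfa_val IntV (label_dfa r),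
            params_val (dfa_params r)]"

definition cost_magnitude :: "dfa_lqci \<Rightarrow> nat" where
  "cost_magnitude r = (\<Sum>z \<leftarrow> ann (cost_dfa r). nat \<bar>z\<bar>)"

end

theory Submission
  imports Defs
begin

text \<open>Averaging an improvising distribution over the words with the same label and cost keeps it
  improvising, so feasibility is a linear program in the probabilities of these classes, whose sizes
  are counted by dynamic programming over the product of the automata and the accumulated cost,
  of which only pseudopolynomially many values occur. The program decouples: for each label, the
  cheapest conditional distribution spends the probability that is not forced by the lower bounds on
  the cheapest words, and with the resulting expected costs the same greedy rule distributes the
  probability among the labels. After scaling by a common denominator all quantities are integers, so
  that the optimal distribution is given by integer weights. A word is sampled by drawing a number
  below the total weight, by rejection sampling with coin flips, and unranking it in the
  enumeration of all words with multiplicities equal to their weights.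

  That all this runs in polynomial time is established without writing programs: computability
  with a polynomial bound is closed under the constructs of the language, and the sizes of
  intermediate values only have to be bounded for loops.\<close>

section \<open>Polynomial-time computability\<close>

text \<open>Bounds on conditional probabilities become linear in the distribution after
  multiplication by the probability of the label. Divided by it again, they leave for every label an
  allocation problem that does not depend on how likely the label is; this is why the program
  decouples. A label without any admissible conditional distribution is forced to probability 0. The
  remaining obstacle to integer weights is that the weight of a class must be shared equally among
  its words, while class sizes differ. All weights are therefore multiplied by the product of the
  sizes of the nonempty classes: there are pseudopolynomially many classes, and each size has
  polynomially many bits, as lengths are given in unary. Rejection is needed because boundedly many
  fair coins only produce probabilities with a power of 2 as denominator. Hence the improviser is
  fast only in expectation, whereas the scheme, which merely decides solvability and outputs code,
  flips no coins.\<close>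

definition pbounded :: "'a set \<Rightarrow> ('a \<Rightarrow> nat) \<Rightarrow> ('a \<Rightarrow> nat) \<Rightarrow> bool" where
  "pbounded X N t \<longleftrightarrow> (\<exists>d. \<forall>x\<in>X. t x \<le> (N x + 2) ^ d)"

lemma pbounded_mono:
  assumes "pbounded X N t" "\<And>x. x \<in> Y \<Longrightarrow> x \<in> X" "\<And>x. x \<in> Y \<Longrightarrow> s x \<le> t x"
  shows "pbounded Y N s"
  using assms unfolding pbounded_def by (meson le_trans)

text \<open>A base of at least 2 lets the exponent alone absorb constants, and likewise the factor 2
  in a sum of two powers, so one number describes every bound.\<close>

lemma pbounded_const: "pbounded X N (\<lambda>_. c)"
proof -
  have "c \<le> (N x + 2) ^ c" for x
  proof -
    have "c \<le> 2 ^ c" by (rule less_imp_le[OF less_exp])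
    also have "\<dots> \<le> (N x + 2) ^ c" by (rule power_mono) auto
    finally show ?thesis .
  qed
  then show ?thesis unfolding pbounded_def by blast
qed

lemma pbounded_self: "pbounded X N N"
  unfolding pbounded_def by (rule exI[of _ 1]) auto

lemma pbounded_mult:
  assumes "pbounded X N s" "pbounded X N t"
  shows "pbounded X N (\<lambda>x. s x * t x)"
proof -
  obtain d e where "\<forall>x\<in>X. s x \<le> (N x + 2) ^ d" "\<forall>x\<in>X. t x \<le> (N x + 2) ^ e"
    using assms unfolding pbounded_def by blast
  then have "\<forall>x\<in>X. s x * t x \<le> (N x + 2) ^ (d + e)"
    by (simp add: power_add mult_le_mono)
  then show ?thesis unfolding pbounded_def by blast
qed

lemma pbounded_add:
  assumes "pbounded X N s" "pbounded X N t"
  shows "pbounded X N (\<lambda>x. s x + t x)"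
proof (rule pbounded_mono[OF pbounded_mult])
  show "pbounded X N (\<lambda>x. s x + 1)" "pbounded X N (\<lambda>x. t x + 1)"
  proof -
    have "pbounded X N (\<lambda>x. s x + 1)" if s: "pbounded X N s" for s
    proof -
      obtain d where d: "\<forall>x\<in>X. s x \<le> (N x + 2) ^ d"
        using s unfolding pbounded_def by blast
      have "s x + 1 \<le> (N x + 2) ^ (d + 1)" if "x \<in> X" for x
      proof -
        have "s x + 1 \<le> (N x + 2) ^ d + (N x + 2) ^ d"
          using d that by (intro add_mono) auto
        also have "\<dots> \<le> (N x + 2) ^ (d + 1)" by (simp add: algebra_simps)
        finally show ?thesis .
      qed
      then show ?thesis unfolding pbounded_def by blast
    qed
    then show "pbounded X N (\<lambda>x. s x + 1)" "pbounded X N (\<lambda>x. t x + 1)" using assms by auto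
  qed
qed (auto simp: algebra_simps)

text \<open>Polynomials compose. This trades a bound in an intermediate size \<open>M\<close> for
  one in the size of the input, as needed whenever a computed value joins the context.\<close>

lemma pbounded_trans:
  assumes "pbounded X N M" "pbounded X M t"
  shows "pbounded X N t"
proof -
  have "pbounded X N (\<lambda>x. M x + 2)"
    by (intro pbounded_add pbounded_const assms)
  then obtain d where d: "\<forall>x\<in>X. M x + 2 \<le> (N x + 2) ^ d"
    unfolding pbounded_def by blast
  obtain e where e: "\<forall>x\<in>X. t x \<le> (M x + 2) ^ e" using assms unfolding pbounded_def by blast
  have "t x \<le> (N x + 2) ^ (d * e)" if "x \<in> X" for x
  proof -
    have "t x \<le> (M x + 2) ^ e" using e that by auto
    also have "\<dots> \<le> ((N x + 2) ^ d) ^ e" using d that by (intro power_mono) auto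
    finally show ?thesis by (simp add: power_mult)
  qed
  then show ?thesis unfolding pbounded_def by blast
qed

lemma pbounded_power:
  assumes "pbounded X N t"
  shows "pbounded X N (\<lambda>x. t x ^ d)"
  by (induction d) (auto intro: pbounded_mult assms pbounded_const)

section \<open>Deterministic programs with polynomial running time\<close>

definition csize :: "('a \<Rightarrow> nat) \<Rightarrow> ('a \<Rightarrow> val) list \<Rightarrow> 'a \<Rightarrow> nat" where
  "csize \<mu> \<Gamma> x = \<mu> x + (\<Sum>g\<leftarrow>\<Gamma>. vsize (g x))"

lemma csize_Nil [simp]: "csize \<mu> [] x = \<mu> x"
  by (simp add: csize_def)

lemma csize_Cons [simp]: "csize \<mu> (g # \<Gamma>) x = vsize (g x) + csize \<mu> \<Gamma> x"
  by (simp add: csize_def)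

lemma csize_append [simp]: "csize \<mu> (\<Gamma> @ \<Delta>) x = csize \<mu> \<Gamma> x + (\<Sum>g\<leftarrow>\<Delta>. vsize (g x))"
  by (simp add: csize_def)

lemma vsize_le_csize: "g \<in> set \<Gamma> \<Longrightarrow> vsize (g x) \<le> csize \<mu> \<Gamma> x"
  using member_le_sum_list[of "vsize (g x)" "map (\<lambda>g. vsize (g x)) \<Gamma>"]
  unfolding csize_def by (auto intro: trans_le_add2)

text \<open>\<open>ptime X \<mu> \<Gamma> f\<close>: a single deterministic program computes \<open>f x\<close> from the values \<open>g x\<close>,
  \<open>g\<close> ranging over the context \<open>\<Gamma>\<close>, for all indices \<open>x\<close> in \<open>X\<close>. The time is polynomial in the
  size of these values and in \<open>\<mu> x\<close>, which stands for the quantities that count as if given in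
  unary. Indices allow for preconditions and keep the encodings of typed data out of the way.\<close>

definition ptime ::
  "'a set \<Rightarrow> ('a \<Rightarrow> nat) \<Rightarrow> ('a \<Rightarrow> val) list \<Rightarrow> ('a \<Rightarrow> val) \<Rightarrow> bool" where
  "ptime X \<mu> \<Gamma> f \<longleftrightarrow> (\<exists>p d. \<forall>x\<in>X. \<forall>rest. \<exists>t. t \<le> (csize \<mu> \<Gamma> x + 2) ^ d \<and> vsize (f x) \<le> t \<and>
     eval p (map (\<lambda>g. g x) \<Gamma> @ rest) = return_spmf (f x, t))"

lemma ptimeI:
  assumes "pbounded X (csize \<mu> \<Gamma>) T"
    and "\<And>x rest. x \<in> X \<Longrightarrow> \<exists>t. t \<le> T x \<and> vsize (f x) \<le> t \<and>
           eval p (map (\<lambda>g. g x) \<Gamma> @ rest) = return_spmf (f x, t)"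
  shows "ptime X \<mu> \<Gamma> f"
  using assms unfolding ptime_def pbounded_def by (meson le_trans)

lemma ptimeE:
  assumes "ptime X \<mu> \<Gamma> f"
  obtains p T where "pbounded X (csize \<mu> \<Gamma>) T"
    and "\<forall>x\<in>X. \<forall>rest. \<exists>t. t \<le> T x \<and> vsize (f x) \<le> t \<and>
           eval p (map (\<lambda>g. g x) \<Gamma> @ rest) = return_spmf (f x, t)"
proof -
  obtain p d where *: "\<forall>x\<in>X. \<forall>rest. \<exists>t. t \<le> (csize \<mu> \<Gamma> x + 2) ^ d \<and> vsize (f x) \<le> t \<and>
     eval p (map (\<lambda>g. g x) \<Gamma> @ rest) = return_spmf (f x, t)"
    using assms unfolding ptime_def by blast
  show ?thesis
  proof (rule that)
    show "pbounded X (csize \<mu> \<Gamma>) (\<lambda>x. (csize \<mu> \<Gamma> x + 2) ^ d)"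
      unfolding pbounded_def by blast
  qed (rule *)
qed

text \<open>Evaluation is charged for the size of its result, and \<open>ptime\<close> records this,
  so sizes of computed values need no separate argument.\<close>

lemma ptime_pbounded: "ptime X \<mu> \<Gamma> f \<Longrightarrow> pbounded X (csize \<mu> \<Gamma>) (\<lambda>x. vsize (f x))"
  unfolding ptime_def pbounded_def by (meson le_trans)

lemma ptime_cong:
  assumes "ptime X \<mu> \<Gamma> f" "\<And>x. x \<in> X \<Longrightarrow> f x = g x"
  shows "ptime X \<mu> \<Gamma> g"
  using assms unfolding ptime_def by simp

lemma ptime_mono: "ptime X \<mu> \<Gamma> f \<Longrightarrow> (\<And>x. x \<in> Y \<Longrightarrow> x \<in> X) \<Longrightarrow> ptime Y \<mu> \<Gamma> f"
  unfolding ptime_def by meson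

lemma ptime_const: "ptime X \<mu> \<Gamma> (\<lambda>_. v)"
  by (rule ptimeI[where p = "Const v", OF pbounded_const[of _ _ "1 + vsize v"]])
     (auto simp: charge_def)

lemma ptime_var:
  assumes "f \<in> set \<Gamma>"
  shows "ptime X \<mu> \<Gamma> f"
proof -
  obtain i where i: "i < length \<Gamma>" "\<Gamma> ! i = f" using assms by (auto simp: in_set_conv_nth)
  have "pbounded X (csize \<mu> \<Gamma>) (\<lambda>x. 1 + csize \<mu> \<Gamma> x)"
    by (intro pbounded_add pbounded_const pbounded_self)
  then show ?thesis
  proof (rule ptimeI[where p = "Var i"])
    fix x rest
    have "vsize (f x) \<le> csize \<mu> \<Gamma> x" using assms by (rule vsize_le_csize)
    moreover have "eval (Var i) (map (\<lambda>g. g x) \<Gamma> @ rest) = return_spmf (f x, Suc (vsize (f x)))"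
      using i by (simp add: charge_def nth_append)
    ultimately show "\<exists>t\<le>1 + csize \<mu> \<Gamma> x. vsize (f x) \<le> t \<and>
        eval (Var i) (map (\<lambda>g. g x) \<Gamma> @ rest) = return_spmf (f x, t)"
      by (intro exI[of _ "Suc (vsize (f x))"]) auto
  qed
qed

text \<open>The computed value has polynomial size, so what is polynomial in the enlarged context is
  polynomial in the old one. \<open>Bind\<close> puts the value at de Bruijn index 0, which is why
  contexts grow at the front.\<close>

lemma ptime_cut:
  assumes "ptime X \<mu> \<Gamma> f" "ptime X \<mu> (f # \<Gamma>) g"
  shows "ptime X \<mu> \<Gamma> g"
proof -
  obtain p T where T: "pbounded X (csize \<mu> \<Gamma>) T"
    and p [rule_format]: "\<forall>x\<in>X. \<forall>rest. \<exists>t. t \<le> T x \<and> vsize (f x) \<le> t \<and>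
           eval p (map (\<lambda>g. g x) \<Gamma> @ rest) = return_spmf (f x, t)"
    by (rule ptimeE[OF assms(1)]) (rule that; assumption)
  obtain q U where U: "pbounded X (csize \<mu> (f # \<Gamma>)) U"
    and q [rule_format]: "\<forall>x\<in>X. \<forall>rest. \<exists>t. t \<le> U x \<and> vsize (g x) \<le> t \<and>
           eval q (map (\<lambda>g. g x) (f # \<Gamma>) @ rest) = return_spmf (g x, t)"
    by (rule ptimeE[OF assms(2)]) (rule that; assumption)
  have "pbounded X (csize \<mu> \<Gamma>) (csize \<mu> (f # \<Gamma>))"
    unfolding csize_Cons by (intro pbounded_add pbounded_self ptime_pbounded assms)
  then have U': "pbounded X (csize \<mu> \<Gamma>) U" using U by (rule pbounded_trans)
  have "pbounded X (csize \<mu> \<Gamma>) (\<lambda>x. T x + 2 * U x + 1)"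
    by (intro pbounded_add pbounded_mult pbounded_const T U')
  then show ?thesis
  proof (rule ptimeI[where p = "Bind p q"])
    fix x rest assume "x \<in> X"
    obtain t1 t2 where "t1 \<le> T x" "vsize (f x) \<le> t1" "t2 \<le> U x" "vsize (g x) \<le> t2"
      "eval p (map (\<lambda>g. g x) \<Gamma> @ rest) = return_spmf (f x, t1)"
      "eval q (map (\<lambda>g. g x) (f # \<Gamma>) @ rest) = return_spmf (g x, t2)"
      using p[OF \<open>x \<in> X\<close>, of rest] q[OF \<open>x \<in> X\<close>, of rest] by blast
    then show "\<exists>t\<le>T x + 2 * U x + 1. vsize (g x) \<le> t \<and>
       eval (Bind p q) (map (\<lambda>g. g x) \<Gamma> @ rest) = return_spmf (g x, t)"
      by (auto simp: charge_def)
  qed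
qed

text \<open>De Bruijn indices count from the front, so entries behind \<open>\<Gamma>\<close> do not
  affect the program; they belong to the arbitrary \<open>rest\<close> over which
  \<open>ptime\<close> quantifies.\<close>

lemma ptime_append:
  assumes "ptime X \<mu> \<Gamma> f"
  shows "ptime X \<mu> (\<Gamma> @ \<Delta>) f"
proof -
  obtain p d where * [rule_format]: "\<forall>x\<in>X. \<forall>rest. \<exists>t. t \<le> (csize \<mu> \<Gamma> x + 2) ^ d \<and> vsize (f x) \<le> t \<and>
     eval p (map (\<lambda>g. g x) \<Gamma> @ rest) = return_spmf (f x, t)"
    using assms unfolding ptime_def by blast
  show ?thesis unfolding ptime_def
  proof (rule exI[of _ p], rule exI[of _ d], intro ballI allI)
    fix x rest assume "x \<in> X"
    from *[OF this, of "map (\<lambda>g. g x) \<Delta> @ rest"] obtain t where t: "t \<le> (csize \<mu> \<Gamma> x + 2) ^ d"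
      "vsize (f x) \<le> t" "eval p (map (\<lambda>g. g x) (\<Gamma> @ \<Delta>) @ rest) = return_spmf (f x, t)"
      by auto
    have "(csize \<mu> \<Gamma> x + 2) ^ d \<le> (csize \<mu> (\<Gamma> @ \<Delta>) x + 2) ^ d" by (intro power_mono) auto
    with t show "\<exists>t. t \<le> (csize \<mu> (\<Gamma> @ \<Delta>) x + 2) ^ d \<and> vsize (f x) \<le> t \<and>
      eval p (map (\<lambda>g. g x) (\<Gamma> @ \<Delta>) @ rest) = return_spmf (f x, t)" by (meson le_trans)
  qed
qed

text \<open>Contexts matter only as sets: each entry of \<open>\<Delta>\<close> is fetched as a
  variable of \<open>\<Gamma>\<close> and then removed by a cut.\<close>

lemma ptime_weaken:
  assumes "ptime X \<mu> \<Delta> f" "set \<Delta> \<subseteq> set \<Gamma>"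
  shows "ptime X \<mu> \<Gamma> f"
proof -
  have "set \<Delta> \<subseteq> set \<Gamma> \<Longrightarrow> ptime X \<mu> (\<Delta> @ \<Gamma>) f \<Longrightarrow> ptime X \<mu> \<Gamma> f"
  proof (induction \<Delta>)
    case (Cons g \<Delta>)
    have "ptime X \<mu> (\<Delta> @ \<Gamma>) g" by (rule ptime_var) (use Cons.prems in auto)
    then have "ptime X \<mu> (\<Delta> @ \<Gamma>) f" using Cons.prems(2) by (auto intro: ptime_cut)
    then show ?case using Cons by auto
  qed auto
  then show ?thesis using assms ptime_append by blast
qed

lemma ptime_subst:
  assumes "ptime X \<mu> \<Delta> f" "\<And>g. g \<in> set \<Delta> \<Longrightarrow> ptime X \<mu> \<Gamma> g"
  shows "ptime X \<mu> \<Gamma> f"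
proof -
  have "(\<And>g. g \<in> set \<Delta> \<Longrightarrow> ptime X \<mu> \<Gamma> g) \<Longrightarrow> ptime X \<mu> (\<Delta> @ \<Gamma>) f \<Longrightarrow> ptime X \<mu> \<Gamma> f"
  proof (induction \<Delta>)
    case (Cons g \<Delta>)
    have "ptime X \<mu> (\<Delta> @ \<Gamma>) g" by (rule ptime_weaken[OF Cons.prems(1)]) auto
    then have "ptime X \<mu> (\<Delta> @ \<Gamma>) f" using Cons.prems(2) by (auto intro: ptime_cut)
    then show ?case using Cons by auto
  qed auto
  then show ?thesis using assms ptime_append by blast
qed

text \<open>Loop states and list elements enter as a second component of the index; values known
  outside the loop ignore it.\<close>

abbreviation lift :: "('a \<Rightarrow> val) list \<Rightarrow> ('a \<times> 'b \<Rightarrow> val) list" where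
  "lift \<Gamma> \<equiv> map (\<lambda>g y. g (fst y)) \<Gamma>"

lemma csize_lift [simp]: "csize (\<lambda>y. \<mu> (fst y)) (lift \<Gamma>) y = csize \<mu> \<Gamma> (fst y)"
  by (simp add: csize_def o_def)

text \<open>The program stays the same; only the family of inputs on which it runs is parametrized
  differently.\<close>

lemma ptime_reindex:
  assumes "ptime X \<mu> \<Gamma> f" "\<And>y. y \<in> Y \<Longrightarrow> h y \<in> X" "\<And>y. y \<in> Y \<Longrightarrow> \<mu> (h y) \<le> \<mu>' y"
  shows "ptime Y \<mu>' (map (\<lambda>g y. g (h y)) \<Gamma>) (\<lambda>y. f (h y))"
proof -
  obtain p d where * [rule_format]: "\<forall>x\<in>X. \<forall>rest. \<exists>t. t \<le> (csize \<mu> \<Gamma> x + 2) ^ d \<and> vsize (f x) \<le> t \<and>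
     eval p (map (\<lambda>g. g x) \<Gamma> @ rest) = return_spmf (f x, t)"
    using assms unfolding ptime_def by blast
  show ?thesis unfolding ptime_def
  proof (rule exI[of _ p], rule exI[of _ d], intro ballI allI)
    fix y rest assume y: "y \<in> Y"
    from *[OF assms(2)[OF y], of rest] obtain t where t: "t \<le> (csize \<mu> \<Gamma> (h y) + 2) ^ d"
      "vsize (f (h y)) \<le> t" "eval p (map (\<lambda>g. g (h y)) \<Gamma> @ rest) = return_spmf (f (h y), t)"
      by auto
    have "(csize \<mu> \<Gamma> (h y) + 2) ^ d \<le> (csize \<mu>' (map (\<lambda>g y. g (h y)) \<Gamma>) y + 2) ^ d"
      using assms(3)[OF y] by (intro power_mono) (auto simp: csize_def o_def)
    with t show "\<exists>t. t \<le> (csize \<mu>' (map (\<lambda>g y. g (h y)) \<Gamma>) y + 2) ^ d \<and> vsize (f (h y)) \<le> t \<and>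
      eval p (map (\<lambda>g. g y) (map (\<lambda>g y. g (h y)) \<Gamma>) @ rest) = return_spmf (f (h y), t)"
      unfolding map_map o_def by (meson le_trans)
  qed
qed

lemma ptime_lift:
  assumes "ptime X \<mu> \<Gamma> f" "\<And>y. y \<in> Y \<Longrightarrow> fst y \<in> X"
  shows "ptime Y (\<lambda>y. \<mu> (fst y)) (v # lift \<Gamma>) (\<lambda>y. f (fst y))"
  by (rule ptime_weaken[OF ptime_reindex[OF assms(1), where h = fst]]) (use assms(2) in auto)

text \<open>The time of a primitive operation is essentially the size of its result, so a bound on
  that size is the only obligation.\<close>

lemma ptime_unop:
  assumes "ptime X \<mu> \<Gamma> f" "pbounded X (csize \<mu> \<Gamma>) (\<lambda>x. vsize (apply_unop u (f x)))"
  shows "ptime X \<mu> \<Gamma> (\<lambda>x. apply_unop u (f x))"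
proof -
  obtain p T where T: "pbounded X (csize \<mu> \<Gamma>) T"
    and p [rule_format]: "\<forall>x\<in>X. \<forall>rest. \<exists>t. t \<le> T x \<and> vsize (f x) \<le> t \<and>
           eval p (map (\<lambda>g. g x) \<Gamma> @ rest) = return_spmf (f x, t)"
    by (rule ptimeE[OF assms(1)]) (rule that; assumption)
  have "pbounded X (csize \<mu> \<Gamma>) (\<lambda>x. T x + 1 + vsize (apply_unop u (f x)))"
    by (intro pbounded_add pbounded_const T assms)
  then show ?thesis
  proof (rule ptimeI[where p = "Unop u p"])
    fix x rest assume "x \<in> X"
    from p[OF this, of rest]
    show "\<exists>t. t \<le> T x + 1 + vsize (apply_unop u (f x)) \<and> vsize (apply_unop u (f x)) \<le> t \<and>
       eval (Unop u p) (map (\<lambda>g. g x) \<Gamma> @ rest) = return_spmf (apply_unop u (f x), t)"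
      by (auto simp: charge_def)
  qed
qed

lemma ptime_binop:
  assumes "ptime X \<mu> \<Gamma> f" "ptime X \<mu> \<Gamma> g"
    "pbounded X (csize \<mu> \<Gamma>) (\<lambda>x. vsize (apply_binop u (f x) (g x)))"
  shows "ptime X \<mu> \<Gamma> (\<lambda>x. apply_binop u (f x) (g x))"
proof -
  obtain p T where T: "pbounded X (csize \<mu> \<Gamma>) T"
    and p [rule_format]: "\<forall>x\<in>X. \<forall>rest. \<exists>t. t \<le> T x \<and> vsize (f x) \<le> t \<and>
           eval p (map (\<lambda>g. g x) \<Gamma> @ rest) = return_spmf (f x, t)"
    by (rule ptimeE[OF assms(1)]) (rule that; assumption)
  obtain q U where U: "pbounded X (csize \<mu> \<Gamma>) U"
    and q [rule_format]: "\<forall>x\<in>X. \<forall>rest. \<exists>t. t \<le> U x \<and> vsize (g x) \<le> t \<and>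
           eval q (map (\<lambda>g. g x) \<Gamma> @ rest) = return_spmf (g x, t)"
    by (rule ptimeE[OF assms(2)]) (rule that; assumption)
  have "pbounded X (csize \<mu> \<Gamma>) (\<lambda>x. T x + U x + 1 + vsize (apply_binop u (f x) (g x)))"
    by (intro pbounded_add pbounded_const T U assms)
  then show ?thesis
  proof (rule ptimeI[where p = "Binop u p q"])
    fix x rest assume x: "x \<in> X"
    from p[OF x, of rest] q[OF x, of rest]
    show "\<exists>t. t \<le> T x + U x + 1 + vsize (apply_binop u (f x) (g x)) \<and>
       vsize (apply_binop u (f x) (g x)) \<le> t \<and>
       eval (Binop u p q) (map (\<lambda>g. g x) \<Gamma> @ rest) = return_spmf (apply_binop u (f x) (g x), t)"
      by (auto simp: charge_def)
  qed
qed

lemma truthy_of_truth [simp]: "truthy (of_truth b) \<longleftrightarrow> b"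
  by (simp add: truthy_def of_truth_def)

lemma vsize_pos: "1 \<le> vsize v"
  by (cases v) auto

text \<open>A branch runs only where its condition allows, so it has to be correct only there. In
  this way tests supply preconditions, such as a difference being nonnegative.\<close>

lemma ptime_if:
  assumes "ptime X \<mu> \<Gamma> (\<lambda>x. of_truth (c x))" "ptime {x\<in>X. c x} \<mu> \<Gamma> f" "ptime {x\<in>X. \<not> c x} \<mu> \<Gamma> g"
  shows "ptime X \<mu> \<Gamma> (\<lambda>x. if c x then f x else g x)"
proof -
  obtain p T where T: "pbounded X (csize \<mu> \<Gamma>) T"
    and p [rule_format]: "\<forall>x\<in>X. \<forall>rest. \<exists>t. t \<le> T x \<and> vsize (of_truth (c x)) \<le> t \<and>
           eval p (map (\<lambda>g. g x) \<Gamma> @ rest) = return_spmf (of_truth (c x), t)"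
    by (rule ptimeE[OF assms(1)]) (rule that; assumption)
  obtain q d where q: "\<forall>x\<in>{x\<in>X. c x}. \<forall>rest. \<exists>t. t \<le> (csize \<mu> \<Gamma> x + 2) ^ d \<and> vsize (f x) \<le> t \<and>
     eval q (map (\<lambda>g. g x) \<Gamma> @ rest) = return_spmf (f x, t)"
    using assms(2) unfolding ptime_def by blast
  obtain q' e where q': "\<forall>x\<in>{x\<in>X. \<not> c x}. \<forall>rest. \<exists>t. t \<le> (csize \<mu> \<Gamma> x + 2) ^ e \<and> vsize (g x) \<le> t \<and>
     eval q' (map (\<lambda>g. g x) \<Gamma> @ rest) = return_spmf (g x, t)"
    using assms(3) unfolding ptime_def by blast
  let ?U = "\<lambda>x. (csize \<mu> \<Gamma> x + 2) ^ d" and ?V = "\<lambda>x. (csize \<mu> \<Gamma> x + 2) ^ e"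
  let ?W = "\<lambda>x. T x + 2 * ?U x + 2 * ?V x + 1"
  have "pbounded X (csize \<mu> \<Gamma>) ?W"
    by (intro pbounded_add pbounded_mult pbounded_const pbounded_power pbounded_self T)
  then show ?thesis
  proof (rule ptimeI[where p = "Ite p q q'"])
    fix x rest assume x: "x \<in> X"
    obtain t1 where t1: "t1 \<le> T x"
      "eval p (map (\<lambda>g. g x) \<Gamma> @ rest) = return_spmf (of_truth (c x), t1)"
      using p[OF x, of rest] by blast
    show "\<exists>t. t \<le> ?W x \<and> vsize (if c x then f x else g x) \<le> t \<and>
       eval (Ite p q q') (map (\<lambda>g. g x) \<Gamma> @ rest) = return_spmf (if c x then f x else g x, t)"
    proof (cases "c x")
      case True
      then obtain t2 where "t2 \<le> ?U x" "vsize (f x) \<le> t2"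
        "eval q (map (\<lambda>g. g x) \<Gamma> @ rest) = return_spmf (f x, t2)"
        using q x by blast
      with t1 True show ?thesis by (auto simp: charge_def)
    next
      case False
      then obtain t2 where "t2 \<le> ?V x" "vsize (g x) \<le> t2"
        "eval q' (map (\<lambda>g. g x) \<Gamma> @ rest) = return_spmf (g x, t2)"
        using q' x by blast
      with t1 False show ?thesis by (auto simp: charge_def)
    qed
  qed
qed

text \<open>A round costs at most \<open>2 * B + 1\<close>, for the test, the body and the step
  itself, and \<open>V\<close> limits the number of rounds; one additional round pays for the
  failing test and the returned value.\<close>

lemma loop_deterministic:
  assumes c: "\<And>s. Inv s \<Longrightarrow> \<exists>t \<le> B. c (e s) = return_spmf (of_truth (P s), t)"
    and b: "\<And>s. Inv s \<Longrightarrow> P s \<Longrightarrow> \<exists>t \<le> B. b (e s) = return_spmf (e (nx s), t)"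
    and inv: "\<And>s. Inv s \<Longrightarrow> P s \<Longrightarrow> Inv (nx s) \<and> V (nx s) < (V s :: nat)"
    and e: "\<And>s. Inv s \<Longrightarrow> vsize (e s) \<le> B"
    and s: "Inv s"
  shows "\<exists>s' t'. Inv s' \<and> \<not> P s' \<and> t' \<le> t + (V s + 1) * (2 * B + 1) \<and> vsize (e s') \<le> t' \<and>
    loop c b (e s) t = return_spmf (e s', t')"
  using s
proof (induction "V s" arbitrary: s t rule: less_induct)
  case less
  obtain t1 where t1: "t1 \<le> B" "c (e s) = return_spmf (of_truth (P s), t1)"
    using c[OF less.prems] by blast
  show ?case
  proof (cases "P s")
    case True
    obtain t2 where t2: "t2 \<le> B" "b (e s) = return_spmf (e (nx s), t2)"
      using b[OF less.prems True] by blast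
    have nx: "Inv (nx s)" "V (nx s) < V s" using inv[OF less.prems True] by auto
    obtain s' t' where s': "Inv s'" "\<not> P s'" "vsize (e s') \<le> t'"
      and t': "t' \<le> t + t1 + t2 + 1 + (V (nx s) + 1) * (2 * B + 1)"
      and l: "loop c b (e (nx s)) (t + t1 + t2 + 1) = return_spmf (e s', t')"
      using less.hyps[OF nx(2) nx(1), of "t + t1 + t2 + 1"] by blast
    have "t + t1 + t2 + 1 + (V (nx s) + 1) * (2 * B + 1) \<le> t + (V (nx s) + 2) * (2 * B + 1)"
      using t1 t2 by (simp add: algebra_simps)
    also have "\<dots> \<le> t + (V s + 1) * (2 * B + 1)"
      using mult_le_mono1[of "V (nx s) + 2" "V s + 1" "2 * B + 1"] nx(2) by linarith
    finally have "t' \<le> t + (V s + 1) * (2 * B + 1)" using t' by linarith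
    moreover have "loop c b (e s) t = return_spmf (e s', t')"
      using l by (subst loop.simps) (simp add: t1 t2 True)
    ultimately show ?thesis using s' by blast
  next
    case False
    have "loop c b (e s) t = return_spmf (e s, t + t1 + 1 + vsize (e s))"
      by (subst loop.simps) (simp add: t1 False charge_def)
    moreover have "t + t1 + 1 + vsize (e s) \<le> t + (V s + 1) * (2 * B + 1)"
      using t1 e[OF less.prems] by (simp add: algebra_simps)
    ultimately show ?thesis using less.prems False by (metis le_add2)
  qed
qed

text \<open>Sizes must be bounded beforehand: a body of polynomial time may square the size of the
  state, and its iteration may be exponential. \<open>B\<close> bounds all states that satisfy the
  invariant by a function of the input alone.\<close>

lemma ptime_while:
  fixes e :: "'s \<Rightarrow> val" and V :: "'a \<Rightarrow> 's \<Rightarrow> nat"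
  assumes init: "ptime X \<mu> \<Gamma> (\<lambda>x. e (start x))"
    and cond: "ptime {y. fst y \<in> X \<and> Inv (fst y) (snd y)} (\<lambda>y. \<mu> (fst y))
       ((\<lambda>y. e (snd y)) # lift \<Gamma>) (\<lambda>y. of_truth (P (fst y) (snd y)))"
    and body: "ptime {y. fst y \<in> X \<and> Inv (fst y) (snd y) \<and> P (fst y) (snd y)} (\<lambda>y. \<mu> (fst y))
       ((\<lambda>y. e (snd y)) # lift \<Gamma>) (\<lambda>y. e (nx (fst y) (snd y)))"
    and inv0: "\<And>x. x \<in> X \<Longrightarrow> Inv x (start x)"
    and inv: "\<And>x s. x \<in> X \<Longrightarrow> Inv x s \<Longrightarrow> P x s \<Longrightarrow> Inv x (nx x s)"
    and V: "\<And>x s. x \<in> X \<Longrightarrow> Inv x s \<Longrightarrow> P x s \<Longrightarrow> V x (nx x s) < V x s"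
    and V0: "pbounded X (csize \<mu> \<Gamma>) (\<lambda>x. V x (start x))"
    and B: "pbounded X (csize \<mu> \<Gamma>) B" "\<And>x s. x \<in> X \<Longrightarrow> Inv x s \<Longrightarrow> vsize (e s) \<le> B x"
    and final: "\<And>x s. x \<in> X \<Longrightarrow> Inv x s \<Longrightarrow> \<not> P x s \<Longrightarrow> e s = f x"
  shows "ptime X \<mu> \<Gamma> f"
proof -
  obtain pa T where T: "pbounded X (csize \<mu> \<Gamma>) T"
    and pa [rule_format]: "\<forall>x\<in>X. \<forall>rest. \<exists>t. t \<le> T x \<and> vsize (e (start x)) \<le> t \<and>
           eval pa (map (\<lambda>g. g x) \<Gamma> @ rest) = return_spmf (e (start x), t)"
    by (rule ptimeE[OF init]) (rule that; assumption)
  obtain pc d1 where "\<forall>y\<in>{y. fst y \<in> X \<and> Inv (fst y) (snd y)}. \<forall>rest. \<exists>t.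
      t \<le> (vsize (e (snd y)) + csize \<mu> \<Gamma> (fst y) + 2) ^ d1 \<and>
      eval pc (e (snd y) # map (\<lambda>g. g (fst y)) \<Gamma> @ rest) = return_spmf (of_truth (P (fst y) (snd y)), t)"
    using cond unfolding ptime_def by (auto simp: o_def) blast
  then have pc: "\<exists>t. t \<le> (vsize (e s) + csize \<mu> \<Gamma> x + 2) ^ d1 \<and>
      eval pc (e s # map (\<lambda>g. g x) \<Gamma> @ rest) = return_spmf (of_truth (P x s), t)"
    if "x \<in> X" "Inv x s" for x s rest using that by force
  obtain pb d2 where "\<forall>y\<in>{y. fst y \<in> X \<and> Inv (fst y) (snd y) \<and> P (fst y) (snd y)}. \<forall>rest. \<exists>t.
      t \<le> (vsize (e (snd y)) + csize \<mu> \<Gamma> (fst y) + 2) ^ d2 \<and>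
      eval pb (e (snd y) # map (\<lambda>g. g (fst y)) \<Gamma> @ rest) = return_spmf (e (nx (fst y) (snd y)), t)"
    using body unfolding ptime_def by (auto simp: o_def) blast
  then have pb: "\<exists>t. t \<le> (vsize (e s) + csize \<mu> \<Gamma> x + 2) ^ d2 \<and>
      eval pb (e s # map (\<lambda>g. g x) \<Gamma> @ rest) = return_spmf (e (nx x s), t)"
    if "x \<in> X" "Inv x s" "P x s" for x s rest using that by force
  \<comment> \<open>With \<open>B x\<close> in place of the size of the state, the times of test and
    body obey one bound for all rounds.\<close>
  define C where "C = (\<lambda>x. B x + (B x + csize \<mu> \<Gamma> x + 2) ^ d1 + (B x + csize \<mu> \<Gamma> x + 2) ^ d2)"
  have C: "pbounded X (csize \<mu> \<Gamma>) C" unfolding C_def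
    by (intro pbounded_add pbounded_power pbounded_const pbounded_self B)
  have "pbounded X (csize \<mu> \<Gamma>) (\<lambda>x. T x + (V x (start x) + 1) * (2 * C x + 1))"
    by (intro pbounded_add pbounded_mult pbounded_const C V0 T)
  then show ?thesis
  proof (rule ptimeI[where p = "While pa pc pb"])
    fix x rest assume x: "x \<in> X"
    let ?env = "map (\<lambda>g. g x) \<Gamma> @ rest"
    obtain t0 where t0: "t0 \<le> T x" "eval pa ?env = return_spmf (e (start x), t0)"
      using pa[OF x] by blast
    have "\<exists>s' t'. Inv x s' \<and> \<not> P x s' \<and> t' \<le> t0 + (V x (start x) + 1) * (2 * C x + 1) \<and>
        vsize (e s') \<le> t' \<and>
        loop (\<lambda>v. eval pc (v # ?env)) (\<lambda>v. eval pb (v # ?env)) (e (start x)) t0 = return_spmf (e s', t')"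
    proof (rule loop_deterministic[where nx = "nx x"])
      fix s assume s: "Inv x s"
      have 1: "(vsize (e s) + csize \<mu> \<Gamma> x + 2) ^ d \<le> (B x + csize \<mu> \<Gamma> x + 2) ^ d" for d
        using B(2)[OF x s] by (intro power_mono) auto
      obtain t where "t \<le> (vsize (e s) + csize \<mu> \<Gamma> x + 2) ^ d1"
          "eval pc (e s # ?env) = return_spmf (of_truth (P x s), t)"
        using pc[OF x s] by blast
      moreover have "(vsize (e s) + csize \<mu> \<Gamma> x + 2) ^ d1 \<le> C x" using 1[of d1] unfolding C_def by linarith
      ultimately show "\<exists>t\<le>C x. eval pc (e s # ?env) = return_spmf (of_truth (P x s), t)"
        using le_trans by blast
      show "vsize (e s) \<le> C x" using B(2)[OF x s] unfolding C_def by simp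
      assume P: "P x s"
      obtain t where "t \<le> (vsize (e s) + csize \<mu> \<Gamma> x + 2) ^ d2"
          "eval pb (e s # ?env) = return_spmf (e (nx x s), t)"
        using pb[OF x s P] by blast
      moreover have "(vsize (e s) + csize \<mu> \<Gamma> x + 2) ^ d2 \<le> C x" using 1[of d2] unfolding C_def by linarith
      ultimately show "\<exists>t\<le>C x. eval pb (e s # ?env) = return_spmf (e (nx x s), t)"
        using le_trans by blast
      show "Inv x (nx x s) \<and> V x (nx x s) < V x s" using inv[OF x s P] V[OF x s P] by blast
    qed (rule inv0[OF x])
    then show "\<exists>t. t \<le> T x + (V x (start x) + 1) * (2 * C x + 1) \<and> vsize (f x) \<le> t \<and>
        eval (While pa pc pb) ?env = return_spmf (f x, t)"
      using t0 final[OF x] by fastforce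
  qed
qed

subsection \<open>Arithmetic\<close>

text \<open>Estimates of bit lengths are reduced by this equivalence to comparisons with powers of
  2.\<close>

lemma vsize_IntV_le_iff: "vsize (IntV i) \<le> 1 + w \<longleftrightarrow> nat \<bar>i\<bar> < 2 ^ w"
  by (simp add: floorlog_le_iff)

lemma abs_less_vsize: "nat \<bar>i\<bar> < 2 ^ (vsize (IntV i) - 1)"
  using vsize_IntV_le_iff[of i "vsize (IntV i) - 1"] by simp

lemma vsize_IntV_mono: "\<bar>i\<bar> \<le> \<bar>j\<bar> \<Longrightarrow> vsize (IntV i) \<le> vsize (IntV j)"
  by (auto intro: floorlog_mono nat_mono)

lemma vsize_IntV_le: "vsize (IntV i) \<le> 1 + nat \<bar>i\<bar>"
  by (subst vsize_IntV_le_iff) (rule less_exp)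

lemma vsize_IntV_add: "vsize (IntV (i + j)) \<le> vsize (IntV i) + vsize (IntV j)"
proof -
  define x y where "x = vsize (IntV i) - 1" and "y = vsize (IntV j) - 1"
  have x: "vsize (IntV i) = 1 + x" "nat \<bar>i\<bar> < 2 ^ x" and y: "vsize (IntV j) = 1 + y" "nat \<bar>j\<bar> < 2 ^ y"
    using abs_less_vsize[of i] abs_less_vsize[of j] unfolding x_def y_def by auto
  have "nat \<bar>i + j\<bar> < 2 ^ x + 2 ^ y"
    using x(2) y(2) by linarith
  also have "\<dots> \<le> 2 ^ (1 + x + y)"
  proof -
    have "(2::nat) ^ x \<le> 2 ^ (x + y)" "(2::nat) ^ y \<le> 2 ^ (x + y)" by simp_all
    moreover have "(2::nat) ^ (1 + x + y) = 2 ^ (x + y) + 2 ^ (x + y)" by simp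
    ultimately show ?thesis by linarith
  qed
  finally have "vsize (IntV (i + j)) \<le> 1 + (1 + x + y)" by (subst vsize_IntV_le_iff)
  then show ?thesis using x y by simp
qed

lemma vsize_IntV_mult: "vsize (IntV (i * j)) \<le> vsize (IntV i) + vsize (IntV j)"
proof -
  define x y where "x = vsize (IntV i) - 1" and "y = vsize (IntV j) - 1"
  have x: "vsize (IntV i) = 1 + x" "nat \<bar>i\<bar> < 2 ^ x" and y: "vsize (IntV j) = 1 + y" "nat \<bar>j\<bar> < 2 ^ y"
    using abs_less_vsize[of i] abs_less_vsize[of j] unfolding x_def y_def by auto
  have "nat \<bar>i * j\<bar> = nat \<bar>i\<bar> * nat \<bar>j\<bar>" by (simp add: abs_mult nat_mult_distrib)
  also have "\<dots> < 2 ^ x * 2 ^ y" using x(2) y(2) by (intro mult_strict_mono) auto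
  finally have "vsize (IntV (i * j)) \<le> 1 + (x + y)"
    by (subst vsize_IntV_le_iff) (simp add: power_add)
  then show ?thesis using x y by simp
qed

lemma vsize_IntV_sum_list: "vsize (IntV (sum_list zs)) \<le> vsize (ListV (map IntV zs))"
proof (induction zs)
  case Nil
  show ?case by (simp add: floorlog_def)
next
  case (Cons z zs)
  have "vsize (IntV (sum_list (z # zs))) \<le> vsize (IntV z) + vsize (IntV (sum_list zs))"
    using vsize_IntV_add by simp
  with Cons show ?case by simp
qed

text \<open>The extra 1 is due to the empty product: the integer 1 has size 2, the empty list size
  1.\<close>

lemma vsize_IntV_prod_list: "vsize (IntV (prod_list zs)) \<le> 1 + vsize (ListV (map IntV zs))"
proof (induction zs)
  case Nil
  show ?case by (simp add: floorlog_le_iff)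
next
  case (Cons z zs)
  have "vsize (IntV (prod_list (z # zs))) \<le> vsize (IntV z) + vsize (IntV (prod_list zs))"
    using vsize_IntV_mult by simp
  with Cons show ?case by simp
qed

lemma ptime_add:
  assumes "ptime X \<mu> \<Gamma> (\<lambda>x. IntV (f x))" "ptime X \<mu> \<Gamma> (\<lambda>x. IntV (g x))"
  shows "ptime X \<mu> \<Gamma> (\<lambda>x. IntV (f x + g x))"
proof -
  have "pbounded X (csize \<mu> \<Gamma>) (\<lambda>x. vsize (IntV (f x + g x)))"
    by (rule pbounded_mono[OF pbounded_add[OF assms[THEN ptime_pbounded]]]) (assumption | rule vsize_IntV_add)+
  then show ?thesis using ptime_binop[OF assms, of OpAdd] by (simp del: vsize.simps)
qed

lemma ptime_sub:
  assumes "ptime X \<mu> \<Gamma> (\<lambda>x. IntV (f x))" "ptime X \<mu> \<Gamma> (\<lambda>x. IntV (g x))"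
  shows "ptime X \<mu> \<Gamma> (\<lambda>x. IntV (f x - g x))"
proof -
  have *: "vsize (IntV (i - j)) \<le> vsize (IntV i) + vsize (IntV j)" for i j
    using vsize_IntV_add[of i "-j"] by simp
  have "pbounded X (csize \<mu> \<Gamma>) (\<lambda>x. vsize (IntV (f x - g x)))"
    by (rule pbounded_mono[OF pbounded_add[OF assms[THEN ptime_pbounded]]]) (assumption | rule *)+
  then show ?thesis using ptime_binop[OF assms, of OpSub] by (simp del: vsize.simps)
qed

lemma ptime_mult:
  assumes "ptime X \<mu> \<Gamma> (\<lambda>x. IntV (f x))" "ptime X \<mu> \<Gamma> (\<lambda>x. IntV (g x))"
  shows "ptime X \<mu> \<Gamma> (\<lambda>x. IntV (f x * g x))"
proof -
  have "pbounded X (csize \<mu> \<Gamma>) (\<lambda>x. vsize (IntV (f x * g x)))"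
    by (rule pbounded_mono[OF pbounded_add[OF assms[THEN ptime_pbounded]]]) (assumption | rule vsize_IntV_mult)+
  then show ?thesis using ptime_binop[OF assms, of OpMul] by (simp del: vsize.simps)
qed

lemma pbounded_of_truth: "pbounded X N (\<lambda>x. vsize (of_truth (P x)))"
  by (rule pbounded_mono[OF pbounded_const[of X N 2]]) (auto simp: of_truth_def floorlog_le_iff)

lemma ptime_less:
  assumes "ptime X \<mu> \<Gamma> (\<lambda>x. IntV (f x))" "ptime X \<mu> \<Gamma> (\<lambda>x. IntV (g x))"
  shows "ptime X \<mu> \<Gamma> (\<lambda>x. of_truth (f x < g x))"
  using ptime_binop[OF assms, of OpLess] by (simp add: pbounded_of_truth)

lemma ptime_eq:
  assumes "ptime X \<mu> \<Gamma> f" "ptime X \<mu> \<Gamma> g"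
  shows "ptime X \<mu> \<Gamma> (\<lambda>x. of_truth (f x = g x))"
  using ptime_binop[OF assms, of OpEq] by (simp add: pbounded_of_truth)

lemma ptime_eq_int:
  assumes "ptime X \<mu> \<Gamma> (\<lambda>x. IntV (f x))" "ptime X \<mu> \<Gamma> (\<lambda>x. IntV (g x))"
  shows "ptime X \<mu> \<Gamma> (\<lambda>x. of_truth (f x = g x))"
  using ptime_eq[OF assms] by simp

lemma ptime_not:
  assumes "ptime X \<mu> \<Gamma> (\<lambda>x. of_truth (P x))"
  shows "ptime X \<mu> \<Gamma> (\<lambda>x. of_truth (\<not> P x))"
  by (rule ptime_cong[OF ptime_if[OF assms ptime_const[of _ _ _ "of_truth False"]
        ptime_const[of _ _ _ "of_truth True"]]]) auto

lemma ptime_conj: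
  assumes "ptime X \<mu> \<Gamma> (\<lambda>x. of_truth (P x))" "ptime {x\<in>X. P x} \<mu> \<Gamma> (\<lambda>x. of_truth (Q x))"
  shows "ptime X \<mu> \<Gamma> (\<lambda>x. of_truth (P x \<and> Q x))"
  by (rule ptime_cong[OF ptime_if[OF assms(1,2) ptime_const[of _ _ _ "of_truth False"]]]) auto

lemma ptime_le:
  assumes "ptime X \<mu> \<Gamma> (\<lambda>x. IntV (f x))" "ptime X \<mu> \<Gamma> (\<lambda>x. IntV (g x))"
  shows "ptime X \<mu> \<Gamma> (\<lambda>x. of_truth (f x \<le> g x))"
  by (rule ptime_cong[OF ptime_not[OF ptime_less[OF assms(2,1)]]]) (simp add: not_less)

lemma ptime_nat_add:
  assumes "ptime X \<mu> \<Gamma> (\<lambda>x. IntV (int (f x)))" "ptime X \<mu> \<Gamma> (\<lambda>x. IntV (int (g x)))"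
  shows "ptime X \<mu> \<Gamma> (\<lambda>x. IntV (int (f x + g x)))"
  using ptime_add[OF assms] by simp

lemma ptime_nat_mult:
  assumes "ptime X \<mu> \<Gamma> (\<lambda>x. IntV (int (f x)))" "ptime X \<mu> \<Gamma> (\<lambda>x. IntV (int (g x)))"
  shows "ptime X \<mu> \<Gamma> (\<lambda>x. IntV (int (f x * g x)))"
  using ptime_mult[OF assms] by simp

lemma ptime_nat_div:
  assumes "ptime X \<mu> \<Gamma> (\<lambda>x. IntV (int (f x)))" "ptime X \<mu> \<Gamma> (\<lambda>x. IntV (int (g x)))"
  shows "ptime X \<mu> \<Gamma> (\<lambda>x. IntV (int (f x div g x)))"
proof -
  have "pbounded X (csize \<mu> \<Gamma>) (\<lambda>x. vsize (IntV (int (f x div g x))))"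
    by (rule pbounded_mono[OF ptime_pbounded[OF assms(1)]]) (auto intro!: vsize_IntV_mono simp del: vsize.simps)
  then show ?thesis using ptime_binop[OF assms, of OpDiv] by (simp del: vsize.simps add: zdiv_int)
qed

lemma ptime_nat_less:
  assumes "ptime X \<mu> \<Gamma> (\<lambda>x. IntV (int (f x)))" "ptime X \<mu> \<Gamma> (\<lambda>x. IntV (int (g x)))"
  shows "ptime X \<mu> \<Gamma> (\<lambda>x. of_truth (f x < g x))"
  using ptime_less[OF assms] by simp

lemma ptime_nat_le:
  assumes "ptime X \<mu> \<Gamma> (\<lambda>x. IntV (int (f x)))" "ptime X \<mu> \<Gamma> (\<lambda>x. IntV (int (g x)))"
  shows "ptime X \<mu> \<Gamma> (\<lambda>x. of_truth (f x \<le> g x))"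
  using ptime_le[OF assms] by simp

text \<open>Subtraction in the language is that of integers, so truncation at 0 takes a
  test.\<close>

lemma ptime_nat_diff:
  assumes "ptime X \<mu> \<Gamma> (\<lambda>x. IntV (int (f x)))" "ptime X \<mu> \<Gamma> (\<lambda>x. IntV (int (g x)))"
  shows "ptime X \<mu> \<Gamma> (\<lambda>x. IntV (int (f x - g x)))"
  by (rule ptime_cong[OF ptime_if[OF ptime_nat_less[OF assms] ptime_const[of _ _ _ "IntV 0"]
        ptime_mono[OF ptime_sub[OF assms]]]]) auto

lemma ptime_nat_min:
  assumes "ptime X \<mu> \<Gamma> (\<lambda>x. IntV (int (f x)))" "ptime X \<mu> \<Gamma> (\<lambda>x. IntV (int (g x)))"
  shows "ptime X \<mu> \<Gamma> (\<lambda>x. IntV (int (min (f x) (g x))))"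
  by (rule ptime_cong[OF ptime_if[OF ptime_nat_less[OF assms] ptime_mono[OF assms(1)]
        ptime_mono[OF assms(2)]]]) auto

lemma ptime_nat_max:
  assumes "ptime X \<mu> \<Gamma> (\<lambda>x. IntV (int (f x)))" "ptime X \<mu> \<Gamma> (\<lambda>x. IntV (int (g x)))"
  shows "ptime X \<mu> \<Gamma> (\<lambda>x. IntV (int (max (f x) (g x))))"
  by (rule ptime_cong[OF ptime_if[OF ptime_nat_less[OF assms] ptime_mono[OF assms(2)]
        ptime_mono[OF assms(1)]]]) auto

lemma ptime_nat_if:
  assumes "ptime X \<mu> \<Gamma> (\<lambda>x. of_truth (c x))" "ptime {x\<in>X. c x} \<mu> \<Gamma> (\<lambda>x. IntV (int (f x)))"
    "ptime {x\<in>X. \<not> c x} \<mu> \<Gamma> (\<lambda>x. IntV (int (g x)))"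
  shows "ptime X \<mu> \<Gamma> (\<lambda>x. IntV (int (if c x then f x else g x)))"
  by (rule ptime_cong[OF ptime_if[OF assms]]) auto

subsection \<open>Lists\<close>

lemma length_le_vsize: "length vs < vsize (ListV vs)"
proof (induction vs)
  case (Cons v vs)
  then show ?case using vsize_pos[of v] by simp
qed auto

lemma vsize_mem: "v \<in> set vs \<Longrightarrow> vsize v < vsize (ListV vs)"
  using member_le_sum_list[of "vsize v" "map vsize vs"] by simp

lemma vsize_ListV_le: "(\<And>v. v \<in> set vs \<Longrightarrow> vsize v \<le> b) \<Longrightarrow> vsize (ListV vs) \<le> 1 + length vs * b"
  by (induction vs) (auto simp: add_le_mono)

lemma ptime_Nil: "ptime X \<mu> \<Gamma> (\<lambda>_. ListV [])"
  by (rule ptime_const)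

lemma ptime_Cons:
  assumes "ptime X \<mu> \<Gamma> f" "ptime X \<mu> \<Gamma> (\<lambda>x. ListV (g x))"
  shows "ptime X \<mu> \<Gamma> (\<lambda>x. ListV (f x # g x))"
proof -
  have "pbounded X (csize \<mu> \<Gamma>) (\<lambda>x. vsize (ListV (f x # g x)))"
    by (rule pbounded_mono[OF pbounded_add[OF assms[THEN ptime_pbounded]]]) auto
  then show ?thesis using ptime_binop[OF assms, of OpCons] by (simp del: vsize.simps)
qed

lemma ptime_list_append:
  assumes "ptime X \<mu> \<Gamma> (\<lambda>x. ListV (f x))" "ptime X \<mu> \<Gamma> (\<lambda>x. ListV (g x))"
  shows "ptime X \<mu> \<Gamma> (\<lambda>x. ListV (f x @ g x))"
proof -
  have "pbounded X (csize \<mu> \<Gamma>) (\<lambda>x. vsize (ListV (f x @ g x)))"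
    by (rule pbounded_mono[OF pbounded_add[OF assms[THEN ptime_pbounded]]]) auto
  then show ?thesis using ptime_binop[OF assms, of OpAppend] by (simp del: vsize.simps)
qed

lemma ptime_length:
  assumes "ptime X \<mu> \<Gamma> (\<lambda>x. ListV (f x))"
  shows "ptime X \<mu> \<Gamma> (\<lambda>x. IntV (int (length (f x))))"
proof -
  have *: "vsize (IntV (int (length vs))) \<le> vsize (ListV vs)" for vs
    using vsize_IntV_le[of "int (length vs)"] length_le_vsize[of vs] by linarith
  have "pbounded X (csize \<mu> \<Gamma>) (\<lambda>x. vsize (IntV (int (length (f x)))))"
    by (rule pbounded_mono[OF assms[THEN ptime_pbounded]]) (assumption | rule *)+
  then show ?thesis using ptime_unop[OF assms, of OpLen] by (simp del: vsize.simps)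
qed

lemma ptime_tl:
  assumes "ptime X \<mu> \<Gamma> (\<lambda>x. ListV (f x))"
  shows "ptime X \<mu> \<Gamma> (\<lambda>x. ListV (tl (f x)))"
proof -
  have *: "vsize (ListV (tl vs)) \<le> vsize (ListV vs)" for vs
    by (cases vs) auto
  have "pbounded X (csize \<mu> \<Gamma>) (\<lambda>x. vsize (ListV (tl (f x))))"
    by (rule pbounded_mono[OF assms[THEN ptime_pbounded]]) (assumption | rule *)+
  then show ?thesis using ptime_unop[OF assms, of OpTl] by (simp del: vsize.simps)
qed

lemma ptime_nth:
  assumes "ptime X \<mu> \<Gamma> (\<lambda>x. ListV (f x))" "ptime X \<mu> \<Gamma> (\<lambda>x. IntV (int (i x)))"
    and i: "\<And>x. x \<in> X \<Longrightarrow> i x < length (f x)"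
  shows "ptime X \<mu> \<Gamma> (\<lambda>x. f x ! i x)"
proof -
  have "vsize (apply_binop OpNth (ListV (f x)) (IntV (int (i x)))) \<le> vsize (ListV (f x))"
    if "x \<in> X" for x
    using vsize_mem[of "f x ! i x" "f x"] i[OF that] by (simp del: vsize.simps)
  then have "pbounded X (csize \<mu> \<Gamma>) (\<lambda>x. vsize (apply_binop OpNth (ListV (f x)) (IntV (int (i x)))))"
    by (intro pbounded_mono[OF assms(1)[THEN ptime_pbounded]])
  then have "ptime X \<mu> \<Gamma> (\<lambda>x. apply_binop OpNth (ListV (f x)) (IntV (int (i x))))"
    using ptime_binop[OF assms(1,2), of OpNth] by blast
  then show ?thesis by (rule ptime_cong) (use i in auto)
qed

lemma ptime_nth_map:
  assumes "ptime X \<mu> \<Gamma> (\<lambda>x. ListV (map e (f x)))" "ptime X \<mu> \<Gamma> (\<lambda>x. IntV (int (i x)))"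
    and i: "\<And>x. x \<in> X \<Longrightarrow> i x < length (f x)"
  shows "ptime X \<mu> \<Gamma> (\<lambda>x. e (f x ! i x))"
  by (rule ptime_cong[OF ptime_nth[OF assms(1,2)]]) (use i in auto)

lemma ptime_hd:
  assumes "ptime X \<mu> \<Gamma> (\<lambda>x. ListV (map e (f x)))" "\<And>x. x \<in> X \<Longrightarrow> f x \<noteq> []"
  shows "ptime X \<mu> \<Gamma> (\<lambda>x. e (hd (f x)))"
  by (rule ptime_cong[OF ptime_nth_map[OF assms(1), where i = "\<lambda>_. 0"]])
     (use assms(2) in \<open>auto intro: ptime_const[of _ _ _ "IntV 0", simplified] simp: hd_conv_nth\<close>)

lemma ptime_component:
  assumes "ptime X \<mu> \<Gamma> (\<lambda>x. ListV (f x))" "\<And>x. x \<in> X \<Longrightarrow> i < length (f x)"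
    "\<And>x. x \<in> X \<Longrightarrow> f x ! i = g x"
  shows "ptime X \<mu> \<Gamma> g"
  by (rule ptime_cong[OF ptime_nth[OF assms(1), where i = "\<lambda>_. i"]])
     (use assms(2,3) in \<open>auto intro: ptime_const[of _ _ _ "IntV (int i)"]\<close>)

section \<open>Pairs, folds and the list functions derived from them\<close>

definition pair_val :: "('a \<Rightarrow> val) \<Rightarrow> ('b \<Rightarrow> val) \<Rightarrow> 'a \<times> 'b \<Rightarrow> val" where
  "pair_val e e' z = ListV [e (fst z), e' (snd z)]"

lemma ptime_fst:
  assumes "ptime X \<mu> \<Gamma> (\<lambda>x. pair_val e e' (f x))"
  shows "ptime X \<mu> \<Gamma> (\<lambda>x. e (fst (f x)))"
  using assms unfolding pair_val_def by (rule ptime_component[where i = 0]) auto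

lemma ptime_snd:
  assumes "ptime X \<mu> \<Gamma> (\<lambda>x. pair_val e e' (f x))"
  shows "ptime X \<mu> \<Gamma> (\<lambda>x. e' (snd (f x)))"
  using assms unfolding pair_val_def by (rule ptime_component[where i = 1]) auto

lemma ptime_pair:
  assumes "ptime X \<mu> \<Gamma> (\<lambda>x. e (f x))" "ptime X \<mu> \<Gamma> (\<lambda>x. e' (g x))"
  shows "ptime X \<mu> \<Gamma> (\<lambda>x. pair_val e e' (f x, g x))"
  unfolding pair_val_def fst_conv snd_conv by (intro ptime_Cons ptime_Nil assms)

lemma ptime_lift2:
  assumes "ptime X \<mu> \<Gamma> f" "\<And>y. y \<in> Y \<Longrightarrow> fst y \<in> X"
  shows "ptime Y (\<lambda>y. \<mu> (fst y)) (u # v # lift \<Gamma>) (\<lambda>y. f (fst y))"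
  by (rule ptime_weaken[OF ptime_reindex[OF assms(1), where h = fst]]) (use assms(2) in auto)

lemma ptime_head: "ptime X \<mu> (f # \<Gamma>) f"
  by (rule ptime_var) simp

lemma ptime_second: "ptime X \<mu> (g # f # \<Gamma>) f"
  by (rule ptime_var) simp

text \<open>The loop state consists of the remaining list and the accumulator. Only accumulators
  obtained by folding a prefix matter, for the size bound as well as for the body, so preconditions
  of \<open>F\<close> may depend on the history.\<close>

lemma ptime_fold:
  fixes l :: "'a \<Rightarrow> 'e list" and a0 :: "'a \<Rightarrow> 's"
  assumes l: "ptime X \<mu> \<Gamma> (\<lambda>x. ListV (map e (l x)))"
    and a0: "ptime X \<mu> \<Gamma> (\<lambda>x. e' (a0 x))"
    and body: "ptime {y. fst y \<in> X \<and> (\<exists>pre suf. l (fst y) = pre @ fst (snd y) # suf \<and>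
          snd (snd y) = fold (F (fst y)) pre (a0 (fst y)))} (\<lambda>y. \<mu> (fst y))
       ((\<lambda>y. e (fst (snd y))) # (\<lambda>y. e' (snd (snd y))) # lift \<Gamma>)
       (\<lambda>y. e' (F (fst y) (fst (snd y)) (snd (snd y))))"
    and B: "pbounded X (csize \<mu> \<Gamma>) B"
      "\<And>x pre suf. x \<in> X \<Longrightarrow> l x = pre @ suf \<Longrightarrow> vsize (e' (fold (F x) pre (a0 x))) \<le> B x"
  shows "ptime X \<mu> \<Gamma> (\<lambda>x. e' (fold (F x) (l x) (a0 x)))"
proof -
  define es :: "'e list \<times> 's \<Rightarrow> val" where "es = pair_val (\<lambda>l. ListV (map e l)) e'"
  define Inv where "Inv = (\<lambda>x s. \<exists>pre. l x = pre @ fst s \<and> snd s = fold (F x) pre (a0 x))"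
  define nx where "nx = (\<lambda>x s. (tl (fst s), F x (hd (fst s)) (snd s)))"
  define Y where "Y = {y. fst y \<in> X \<and> Inv (fst y) (snd y) \<and> fst (snd y) \<noteq> []}"
  let ?G = "(\<lambda>y. es (snd y)) # lift \<Gamma>"
  let ?m = "\<lambda>y. \<mu> (fst y)"
  have s1: "ptime Z ?m ?G (\<lambda>y. ListV (map e (fst (snd y))))" for Z
    by (rule ptime_fst[where e' = e']) (simp add: es_def ptime_head)
  have s2: "ptime Z ?m ?G (\<lambda>y. e' (snd (snd y)))" for Z
    by (rule ptime_snd[where e = "\<lambda>l. ListV (map e l)"]) (simp add: es_def ptime_head)
  have "ptime X \<mu> \<Gamma> (\<lambda>x. es (l x, a0 x))"
    unfolding es_def by (intro ptime_pair l a0)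
  then have "ptime X \<mu> \<Gamma> (\<lambda>x. es ([], fold (F x) (l x) (a0 x)))"
  proof (rule ptime_while[where Inv = Inv and P = "\<lambda>x s. fst s \<noteq> []" and V = "\<lambda>x s. length (fst s)"
        and nx = nx and start = "\<lambda>x. (l x, a0 x)"])
    have "ptime {y. fst y \<in> X \<and> Inv (fst y) (snd y)} ?m ?G
        (\<lambda>y. of_truth (ListV (map e (fst (snd y))) \<noteq> ListV []))"
      by (intro ptime_not ptime_eq s1 ptime_const)
    then show "ptime {y. fst y \<in> X \<and> Inv (fst y) (snd y)} ?m ?G (\<lambda>y. of_truth (fst (snd y) \<noteq> []))"
      by simp
    \<comment> \<open>The body expects an element next to the accumulator; in the loop this is the
      head of the remaining list.\<close>
    let ?h = "\<lambda>y. (fst y, hd (fst (snd y)), snd (snd y))"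
    have "ptime Y ?m (map (\<lambda>g y. g (?h y))
        ((\<lambda>y. e (fst (snd y))) # (\<lambda>y. e' (snd (snd y))) # lift \<Gamma>))
        (\<lambda>y. e' (F (fst (?h y)) (fst (snd (?h y))) (snd (snd (?h y)))))"
    proof (rule ptime_reindex[OF body])
      fix y assume "y \<in> Y"
      then obtain pre where "l (fst y) = pre @ fst (snd y)" "fst (snd y) \<noteq> []" "fst y \<in> X"
        "snd (snd y) = fold (F (fst y)) pre (a0 (fst y))" unfolding Y_def Inv_def by blast
      then show "?h y \<in> {y. fst y \<in> X \<and> (\<exists>pre suf. l (fst y) = pre @ fst (snd y) # suf \<and>
          snd (snd y) = fold (F (fst y)) pre (a0 (fst y)))}"
        unfolding mem_Collect_eq fst_conv snd_conv
        by (metis list.collapse)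
    qed simp
    then have "ptime Y ?m ?G (\<lambda>y. e' (F (fst y) (hd (fst (snd y))) (snd (snd y))))"
      unfolding fst_conv snd_conv
    proof (rule ptime_subst)
      fix g assume g: "g \<in> set (map (\<lambda>g y. g (?h y))
        ((\<lambda>y. e (fst (snd y))) # (\<lambda>y. e' (snd (snd y))) # lift \<Gamma>))"
      have "ptime Y ?m ?G (\<lambda>y. e (hd (fst (snd y))))"
        by (rule ptime_hd[OF s1]) (auto simp: Y_def)
      then show "ptime Y ?m ?G g" using s2 g by (auto intro: ptime_var)
    qed
    moreover have "ptime Y ?m ?G (\<lambda>y. ListV (map e (tl (fst (snd y)))))"
      using ptime_tl[OF s1] by (simp add: map_tl)
    ultimately have "ptime Y ?m ?G (\<lambda>y. pair_val (\<lambda>l. ListV (map e l)) e' (nx (fst y) (snd y)))"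
      unfolding nx_def by (rule ptime_pair[rotated])
    then show "ptime {y. fst y \<in> X \<and> Inv (fst y) (snd y) \<and> fst (snd y) \<noteq> []} ?m ?G
       (\<lambda>y. es (nx (fst y) (snd y)))"
      by (simp add: es_def Y_def)
    have "pbounded X (csize \<mu> \<Gamma>) (\<lambda>x. vsize (ListV (map e (l x))))"
      using l by (rule ptime_pbounded)
    then show "pbounded X (csize \<mu> \<Gamma>) (\<lambda>x. length (fst (l x, a0 x)))"
    proof (rule pbounded_mono)
      show "length (fst (l x, a0 x)) \<le> vsize (ListV (map e (l x)))" for x
        using length_le_vsize[of "map e (l x)"] by simp
    qed
    show "pbounded X (csize \<mu> \<Gamma>) (\<lambda>x. 1 + vsize (ListV (map e (l x))) + B x)"
      by (intro pbounded_add pbounded_const ptime_pbounded l B)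
    show "vsize (es s) \<le> 1 + vsize (ListV (map e (l x))) + B x" if "x \<in> X" "Inv x s" for x s
    proof -
      obtain pre where *: "l x = pre @ fst s" "snd s = fold (F x) pre (a0 x)"
        using \<open>Inv x s\<close> unfolding Inv_def by blast
      have "vsize (e' (snd s)) \<le> B x" using B(2)[OF \<open>x \<in> X\<close> *(1)] *(2) by simp
      then show ?thesis using *(1) by (auto simp: es_def pair_val_def)
    qed
    show "Inv x (nx x s)" if "x \<in> X" "Inv x s" "fst s \<noteq> []" for x s
    proof -
      obtain pre where *: "l x = pre @ fst s" "snd s = fold (F x) pre (a0 x)"
        using \<open>Inv x s\<close> unfolding Inv_def by blast
      then show ?thesis unfolding Inv_def nx_def
        by (intro exI[of _ "pre @ [hd (fst s)]"]) (use that(3) in auto)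
    qed
  qed (auto simp: Inv_def nx_def es_def pair_val_def)
  from ptime_snd[OF this[unfolded es_def]]
  have "ptime X \<mu> \<Gamma> (\<lambda>x. e' (snd ([] :: 'e list, fold (F x) (l x) (a0 x))))"
    .
  then show ?thesis by simp
qed

lemma fold_snoc: "fold (\<lambda>z acc. acc @ [f z]) l a = a @ map f l"
  by (induction l arbitrary: a) auto

lemma ptime_map:
  assumes l: "ptime X \<mu> \<Gamma> (\<lambda>x. ListV (map e (l x)))"
    and F: "ptime {y. fst y \<in> X \<and> snd y \<in> set (l (fst y))} (\<lambda>y. \<mu> (fst y))
       ((\<lambda>y. e (snd y)) # lift \<Gamma>) (\<lambda>y. F (fst y) (snd y))"
  shows "ptime X \<mu> \<Gamma> (\<lambda>x. ListV (map (F x) (l x)))"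
proof -
  define U where "U = (\<lambda>x. vsize (ListV (map e (l x))))"
  have U: "pbounded X (csize \<mu> \<Gamma>) U" unfolding U_def using l by (rule ptime_pbounded)
  obtain d where "\<forall>y\<in>{y. fst y \<in> X \<and> snd y \<in> set (l (fst y))}.
      vsize (F (fst y) (snd y)) \<le> (vsize (e (snd y)) + csize \<mu> \<Gamma> (fst y) + 2) ^ d"
    using ptime_pbounded[OF F] unfolding pbounded_def by auto
  then have d: "vsize (F x z) \<le> (vsize (e z) + csize \<mu> \<Gamma> x + 2) ^ d" if "x \<in> X" "z \<in> set (l x)" for x z
    using that by force
  \<comment> \<open>The result has as many entries as \<open>l x\<close>, each polynomial in one
    element and the context. Hence a map, unlike a general fold, needs no assumption on
    sizes.\<close>
  define B where "B = (\<lambda>x. 1 + U x * (U x + csize \<mu> \<Gamma> x + 2) ^ d)"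
  have "ptime X \<mu> \<Gamma> (\<lambda>x. ListV (fold (\<lambda>z acc. acc @ [F x z]) (l x) []))"
  proof (rule ptime_fold[OF l, where e' = ListV])
    let ?D = "{y. fst y \<in> X \<and> (\<exists>pre suf. l (fst y) = pre @ fst (snd y) # suf \<and>
          snd (snd y) = fold (\<lambda>z acc. acc @ [F (fst y) z]) pre [])}"
    let ?G = "(\<lambda>y. e (fst (snd y))) # (\<lambda>y. ListV (snd (snd y))) # lift \<Gamma>"
    have "ptime ?D (\<lambda>y. \<mu> (fst y)) ?G (\<lambda>y. F (fst y) (fst (snd y)))"
      by (rule ptime_weaken[OF ptime_reindex[OF F, where h = "\<lambda>y. (fst y, fst (snd y))", simplified]])
        auto
    then show "ptime ?D (\<lambda>y. \<mu> (fst y)) ?G (\<lambda>y. ListV (snd (snd y) @ [F (fst y) (fst (snd y))]))"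
      by (intro ptime_list_append ptime_Cons ptime_Nil ptime_second)
    show "pbounded X (csize \<mu> \<Gamma>) B" unfolding B_def
      by (intro pbounded_add pbounded_mult pbounded_power pbounded_const pbounded_self U)
    fix x pre suf assume x: "x \<in> X" "l x = pre @ suf"
    have "vsize (F x z) \<le> (U x + csize \<mu> \<Gamma> x + 2) ^ d" if "z \<in> set pre" for z
    proof -
      have "vsize (F x z) \<le> (vsize (e z) + csize \<mu> \<Gamma> x + 2) ^ d" using d[of x z] x that by auto
      also have "\<dots> \<le> (U x + csize \<mu> \<Gamma> x + 2) ^ d"
        using vsize_mem[of "e z" "map e (l x)"] x that
        by (intro power_mono) (auto simp: U_def simp del: vsize.simps)
      finally show ?thesis .
    qed
    then have "vsize (ListV (map (F x) pre)) \<le> 1 + length pre * (U x + csize \<mu> \<Gamma> x + 2) ^ d"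
      using vsize_ListV_le[of "map (F x) pre" "(U x + csize \<mu> \<Gamma> x + 2) ^ d"] by auto
    also have "\<dots> \<le> B x"
      using length_le_vsize[of "map e (l x)"] x unfolding B_def U_def by (intro add_mono mult_mono) auto
    finally show "vsize (ListV (fold (\<lambda>z acc. acc @ [F x z]) pre [])) \<le> B x"
      by (simp add: fold_snoc del: vsize.simps)
  qed (rule ptime_Nil)
  then show ?thesis by (simp add: fold_snoc)
qed

lemma fold_add_left: "fold (\<lambda>z s. s + z) l a = a + (sum_list l :: int)"
  by (induction l arbitrary: a) auto

lemma fold_mult_left: "fold (\<lambda>z s. s * z) l a = a * (prod_list l :: int)"
  by (induction l arbitrary: a) auto

lemma ptime_sum_list:
  assumes l: "ptime X \<mu> \<Gamma> (\<lambda>x. ListV (map IntV (l x)))"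
  shows "ptime X \<mu> \<Gamma> (\<lambda>x. IntV (sum_list (l x)))"
proof -
  have "ptime X \<mu> \<Gamma> (\<lambda>x. IntV (fold (\<lambda>z s. s + z) (l x) 0))"
  proof (rule ptime_fold[OF l, where e' = IntV])
    show "pbounded X (csize \<mu> \<Gamma>) (\<lambda>x. vsize (ListV (map IntV (l x))))"
      using l by (rule ptime_pbounded)
    fix x pre suf assume "x \<in> X" "l x = pre @ suf"
    then show "vsize (IntV (fold (\<lambda>z s. s + z) pre 0)) \<le> vsize (ListV (map IntV (l x)))"
      using vsize_IntV_sum_list[of pre] by (simp add: fold_add_left)
  qed (intro ptime_const ptime_add ptime_head ptime_second)+
  then show ?thesis by (simp add: fold_add_left)
qed

lemma ptime_prod_list:
  assumes l: "ptime X \<mu> \<Gamma> (\<lambda>x. ListV (map IntV (l x)))"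
  shows "ptime X \<mu> \<Gamma> (\<lambda>x. IntV (prod_list (l x)))"
proof -
  have "ptime X \<mu> \<Gamma> (\<lambda>x. IntV (fold (\<lambda>z s. s * z) (l x) 1))"
  proof (rule ptime_fold[OF l, where e' = IntV])
    show "pbounded X (csize \<mu> \<Gamma>) (\<lambda>x. 1 + vsize (ListV (map IntV (l x))))"
      by (intro pbounded_add pbounded_const ptime_pbounded l)
    fix x pre suf assume "x \<in> X" "l x = pre @ suf"
    then show "vsize (IntV (fold (\<lambda>z s. s * z) pre 1)) \<le> 1 + vsize (ListV (map IntV (l x)))"
      using vsize_IntV_prod_list[of pre] by (simp add: fold_mult_left)
  qed (intro ptime_const ptime_mult ptime_head ptime_second)+
  then show ?thesis by (simp add: fold_mult_left)
qed

lemma fold_append_left: "fold (\<lambda>z acc. acc @ z) ls a = a @ concat ls"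
  by (induction ls arbitrary: a) auto

lemma ptime_concat:
  assumes l: "ptime X \<mu> \<Gamma> (\<lambda>x. ListV (map (\<lambda>vs. ListV (map e vs)) (l x)))"
  shows "ptime X \<mu> \<Gamma> (\<lambda>x. ListV (map e (concat (l x))))"
proof -
  have *: "vsize (ListV (map e (concat ls))) \<le> vsize (ListV (map (\<lambda>vs. ListV (map e vs)) ls))" for ls
    by (induction ls) auto
  have "ptime X \<mu> \<Gamma> (\<lambda>x. ListV (map e (fold (\<lambda>z acc. acc @ z) (l x) [])))"
  proof (rule ptime_fold[OF l, where e' = "\<lambda>vs. ListV (map e vs)"])
    show "pbounded X (csize \<mu> \<Gamma>) (\<lambda>x. vsize (ListV (map (\<lambda>vs. ListV (map e vs)) (l x))))"
      using l by (rule ptime_pbounded)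
    fix x pre suf assume "x \<in> X" "l x = pre @ suf"
    then show "vsize (ListV (map e (fold (\<lambda>z acc. acc @ z) pre [])))
        \<le> vsize (ListV (map (\<lambda>vs. ListV (map e vs)) (l x)))"
      using *[of pre] by (simp add: fold_append_left)
  qed (auto intro!: ptime_Nil ptime_list_append ptime_head ptime_second)
  then show ?thesis by (simp add: fold_append_left)
qed

lemma ptime_product:
  assumes f: "ptime X \<mu> \<Gamma> (\<lambda>x. ListV (map e (f x)))" and g: "ptime X \<mu> \<Gamma> (\<lambda>x. ListV (map e' (g x)))"
  shows "ptime X \<mu> \<Gamma> (\<lambda>x. ListV (map (pair_val e e') (List.product (f x) (g x))))"
  unfolding product_concat_map
proof (rule ptime_concat)
  have "ptime X \<mu> \<Gamma> (\<lambda>x. ListV (map (\<lambda>a. ListV (map (\<lambda>b. pair_val e e' (a, b)) (g x))) (f x)))"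
  proof (rule ptime_map[OF f], rule ptime_map)
    show "ptime {y. fst y \<in> X \<and> snd y \<in> set (f (fst y))} (\<lambda>y. \<mu> (fst y))
       ((\<lambda>y. e (snd y)) # lift \<Gamma>) (\<lambda>y. ListV (map e' (g (fst y))))"
      by (rule ptime_lift[OF g]) simp
  qed (intro ptime_pair ptime_var; auto)
  then show "ptime X \<mu> \<Gamma> (\<lambda>x. ListV (map (\<lambda>vs. ListV (map (pair_val e e') vs))
     (map (\<lambda>a. map (Pair a) (g x)) (f x))))"
    by (simp add: o_def)
qed

lemma ptime_ball:
  assumes l: "ptime X \<mu> \<Gamma> (\<lambda>x. ListV (map e (l x)))"
    and P: "ptime {y. fst y \<in> X \<and> snd y \<in> set (l (fst y))} (\<lambda>y. \<mu> (fst y))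
       ((\<lambda>y. e (snd y)) # lift \<Gamma>) (\<lambda>y. of_truth (P (fst y) (snd y)))"
  shows "ptime X \<mu> \<Gamma> (\<lambda>x. of_truth (\<forall>z\<in>set (l x). P x z))"
proof -
  have *: "fold (\<lambda>z b. b \<and> p z) zs b \<longleftrightarrow> b \<and> (\<forall>z\<in>set zs. p z)" for p :: "'b \<Rightarrow> bool" and zs b
    by (induction zs arbitrary: b) auto
  have "ptime X \<mu> \<Gamma> (\<lambda>x. of_truth (fold (\<lambda>z b. b \<and> P x z) (l x) True))"
  proof (rule ptime_fold[OF l, where e' = of_truth])
    show "pbounded X (csize \<mu> \<Gamma>) (\<lambda>x. 2)" by (rule pbounded_const)
    let ?D = "{y. fst y \<in> X \<and> (\<exists>pre suf. l (fst y) = pre @ fst (snd y) # suf \<and>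
          snd (snd y) = fold (\<lambda>z b. b \<and> P (fst y) z) pre True)}"
    let ?G = "(\<lambda>y. e (fst (snd y))) # (\<lambda>y. of_truth (snd (snd y))) # lift \<Gamma>"
    have "ptime ?D (\<lambda>y. \<mu> (fst y)) ?G (\<lambda>y. of_truth (P (fst y) (fst (snd y))))"
      by (rule ptime_weaken[OF ptime_reindex[OF P, where h = "\<lambda>y. (fst y, fst (snd y))", simplified]])
        auto
    then have "ptime {y \<in> ?D. snd (snd y)} (\<lambda>y. \<mu> (fst y)) ?G (\<lambda>y. of_truth (P (fst y) (fst (snd y))))"
      by (rule ptime_mono) blast
    then show "ptime ?D (\<lambda>y. \<mu> (fst y)) ?G (\<lambda>y. of_truth (snd (snd y) \<and> P (fst y) (fst (snd y))))"
      by (rule ptime_conj[OF ptime_second])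
  qed (auto intro: ptime_const simp: of_truth_def floorlog_le_iff)
  then show ?thesis by (simp add: *)
qed

text \<open>The list serves as its own counter, since its length is the next number. The value of
  \<open>n x\<close>, not only its bit length, has to be polynomial.\<close>

lemma ptime_upt:
  assumes n: "ptime X \<mu> \<Gamma> (\<lambda>x. IntV (int (n x)))" "pbounded X (csize \<mu> \<Gamma>) n"
  shows "ptime X \<mu> \<Gamma> (\<lambda>x. ListV (map (\<lambda>i. IntV (int i)) [0..<n x]))"
proof -
  let ?e = "\<lambda>m::nat. ListV (map (\<lambda>i. IntV (int i)) [0..<m])"
  show ?thesis
  proof (rule ptime_while[where e = ?e and start = "\<lambda>_. 0" and Inv = "\<lambda>x m. m \<le> n x" and
        P = "\<lambda>x m. m < n x" and nx = "\<lambda>_. Suc" and V = "\<lambda>x m. n x - m" and B = "\<lambda>x. 1 + n x * (1 + n x)"])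
    have len: "ptime Y \<mu>' ((\<lambda>y. ?e (snd y)) # \<Delta>) (\<lambda>y. IntV (int (snd y)))" for Y :: "('a \<times> nat) set" and \<mu>' \<Delta>
      using ptime_length[OF ptime_head[of Y \<mu>' "\<lambda>y. ?e (snd y)" \<Delta>]] by simp
    show "ptime {y. fst y \<in> X \<and> snd y \<le> n (fst y)} (\<lambda>y. \<mu> (fst y)) ((\<lambda>y. ?e (snd y)) # lift \<Gamma>)
        (\<lambda>y. of_truth (snd y < n (fst y)))"
      by (intro ptime_nat_less len ptime_lift[OF n(1)]) simp
    have "ptime {y. fst y \<in> X \<and> snd y \<le> n (fst y) \<and> snd y < n (fst y)} (\<lambda>y. \<mu> (fst y))
        ((\<lambda>y. ?e (snd y)) # lift \<Gamma>)
        (\<lambda>y. ListV (map (\<lambda>i. IntV (int i)) [0..<snd y] @ [IntV (int (snd y))]))"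
      by (intro ptime_list_append ptime_Cons ptime_Nil ptime_head len)
    then show "ptime {y. fst y \<in> X \<and> snd y \<le> n (fst y) \<and> snd y < n (fst y)} (\<lambda>y. \<mu> (fst y))
        ((\<lambda>y. ?e (snd y)) # lift \<Gamma>) (\<lambda>y. ?e (Suc (snd y)))"
      by simp
    show "pbounded X (csize \<mu> \<Gamma>) (\<lambda>x. 1 + n x * (1 + n x))"
      by (intro pbounded_add pbounded_mult pbounded_const n)
    fix x m assume "m \<le> n x"
    have "vsize (?e m) \<le> 1 + length (map (\<lambda>i. IntV (int i)) [0..<m]) * (1 + n x)"
    proof (rule vsize_ListV_le)
      fix v assume "v \<in> set (map (\<lambda>i. IntV (int i)) [0..<m])"
      then obtain i where i: "v = IntV (int i)" "i < m" by auto
      then show "vsize v \<le> 1 + n x" using vsize_IntV_le[of "int i"] \<open>m \<le> n x\<close> by simp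
    qed
    also have "\<dots> \<le> 1 + n x * (1 + n x)" using \<open>m \<le> n x\<close> by (intro add_mono mult_mono) simp_all
    finally show "vsize (?e m) \<le> 1 + n x * (1 + n x)" .
  qed (use n(2) in \<open>auto intro: ptime_const[of _ _ _ "ListV []"]\<close>)
qed

lemma upto_conv_upt: "[a..b] = map (\<lambda>i. a + int i) [0..<nat (b - a + 1)]"
  by (rule nth_equalityI) (auto simp: nth_upto)

text \<open>Costs may have either sign, so the tables use a symmetric interval, which is a shifted
  initial segment of the naturals.\<close>

lemma ptime_upto_symmetric:
  assumes R: "ptime X \<mu> \<Gamma> (\<lambda>x. IntV (int (R x)))" "pbounded X (csize \<mu> \<Gamma>) R"
  shows "ptime X \<mu> \<Gamma> (\<lambda>x. ListV (map IntV [- int (R x)..int (R x)]))"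
proof -
  have "ptime X \<mu> \<Gamma> (\<lambda>x. IntV (int (R x + R x + 1)))"
    by (intro ptime_nat_add R ptime_const)
  moreover have "pbounded X (csize \<mu> \<Gamma>) (\<lambda>x. R x + R x + 1)"
    by (intro pbounded_add R pbounded_const)
  ultimately have *: "ptime X \<mu> \<Gamma> (\<lambda>x. ListV (map (\<lambda>i. IntV (int i)) [0..<R x + R x + 1]))"
    by (rule ptime_upt)
  have "ptime X \<mu> \<Gamma> (\<lambda>x. ListV (map (\<lambda>i. IntV (int i - int (R x))) [0..<R x + R x + 1]))"
    by (rule ptime_map[OF *]) (intro ptime_sub ptime_head ptime_lift[OF R(1)], simp)
  moreover have "map IntV [- int r..int r] = map (\<lambda>i. IntV (int i - int r)) [0..<r + r + 1]" for r
  proof -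
    have "nat (int r - - int r + 1) = r + r + 1" by simp
    then show ?thesis unfolding upto_conv_upt by (simp del: upt_Suc)
  qed
  ultimately show ?thesis by simp
qed

lemma ptime_sum_list_map:
  assumes "ptime X \<mu> \<Gamma> (\<lambda>x. ListV (map e (l x)))"
    and "ptime {y. fst y \<in> X \<and> snd y \<in> set (l (fst y))} (\<lambda>y. \<mu> (fst y))
       ((\<lambda>y. e (snd y)) # lift \<Gamma>) (\<lambda>y. IntV (F (fst y) (snd y)))"
  shows "ptime X \<mu> \<Gamma> (\<lambda>x. IntV (sum_list (map (F x) (l x))))"
  by (rule ptime_sum_list) (use ptime_map[OF assms] in \<open>simp add: o_def\<close>)

lemma ptime_prod_list_map:
  assumes "ptime X \<mu> \<Gamma> (\<lambda>x. ListV (map e (l x)))"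
    and "ptime {y. fst y \<in> X \<and> snd y \<in> set (l (fst y))} (\<lambda>y. \<mu> (fst y))
       ((\<lambda>y. e (snd y)) # lift \<Gamma>) (\<lambda>y. IntV (F (fst y) (snd y)))"
  shows "ptime X \<mu> \<Gamma> (\<lambda>x. IntV (prod_list (map (F x) (l x))))"
  by (rule ptime_prod_list) (use ptime_map[OF assms] in \<open>simp add: o_def\<close>)

lemma int_sum_list: "int (sum_list xs) = sum_list (map int xs)"
  by (induction xs) auto

lemma int_prod_list: "int (prod_list xs) = prod_list (map int xs)"
  by (induction xs) auto

lemma ptime_nat_sum_list_map:
  assumes "ptime X \<mu> \<Gamma> (\<lambda>x. ListV (map e (l x)))"
    and "ptime {y. fst y \<in> X \<and> snd y \<in> set (l (fst y))} (\<lambda>y. \<mu> (fst y))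
       ((\<lambda>y. e (snd y)) # lift \<Gamma>) (\<lambda>y. IntV (int (F (fst y) (snd y))))"
  shows "ptime X \<mu> \<Gamma> (\<lambda>x. IntV (int (sum_list (map (F x) (l x)))))"
  using ptime_sum_list_map[OF assms] by (simp add: int_sum_list o_def)

lemma ptime_nat_prod_list_map:
  assumes "ptime X \<mu> \<Gamma> (\<lambda>x. ListV (map e (l x)))"
    and "ptime {y. fst y \<in> X \<and> snd y \<in> set (l (fst y))} (\<lambda>y. \<mu> (fst y))
       ((\<lambda>y. e (snd y)) # lift \<Gamma>) (\<lambda>y. IntV (int (F (fst y) (snd y))))"
  shows "ptime X \<mu> \<Gamma> (\<lambda>x. IntV (int (prod_list (map (F x) (l x)))))"
  using ptime_prod_list_map[OF assms] by (simp add: int_prod_list o_def)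

section \<open>Counting and unranking words\<close>

text \<open>The joint state of the three automata, together with the cost accumulated so far.\<close>

type_synonym conf = "nat \<times> nat \<times> nat \<times> int"

definition conf_step :: "dfa_lqci \<Rightarrow> conf \<Rightarrow> nat \<Rightarrow> conf" where
  "conf_step r c a =
     (trans (hard_dfa r) ! fst c ! a, trans (cost_dfa r) ! fst (snd c) ! a,
      trans (label_dfa r) ! fst (snd (snd c)) ! a,
      snd (snd (snd c)) + ann (cost_dfa r) ! (trans (cost_dfa r) ! fst (snd c) ! a))"

text \<open>A run also visits its first state, whose cost is charged here; every step then adds the
  cost of the state it enters.\<close>

definition conf_init :: "dfa_lqci \<Rightarrow> conf" where
  "conf_init r = (init (hard_dfa r), init (cost_dfa r), init (label_dfa r),
     ann (cost_dfa r) ! init (cost_dfa r))"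

text \<open>The weight \<open>G l s\<close> of a word depends on its label \<open>l\<close> and its cost \<open>s\<close>. Below, \<open>j\<close> is the
  number of letters that may still be read.\<close>

definition conf_weight :: "dfa_lqci \<Rightarrow> (int \<Rightarrow> int \<Rightarrow> nat) \<Rightarrow> nat \<Rightarrow> conf \<Rightarrow> nat" where
  "conf_weight r G j c =
     (if ann (hard_dfa r) ! fst c \<and> min_len (dfa_params r) + j \<le> max_len (dfa_params r)
      then G (ann (label_dfa r) ! fst (snd (snd c))) (snd (snd (snd c))) else 0)"

primrec total :: "nat \<Rightarrow> dfa_lqci \<Rightarrow> (int \<Rightarrow> int \<Rightarrow> nat) \<Rightarrow> nat \<Rightarrow> conf \<Rightarrow> nat" where
  "total k r G 0 c = conf_weight r G 0 c"
| "total k r G (Suc j) c =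
     conf_weight r G (Suc j) c + (\<Sum>a\<leftarrow>[0..<k]. total k r G j (conf_step r c a))"

text \<open>The specification of \<open>unrank\<close>, never computed because it may be
  exponentially long. Repetition expresses weights, and grouping by the first letter matches the
  recursion of \<open>total\<close>.\<close>

primrec enum_words :: "nat \<Rightarrow> dfa_lqci \<Rightarrow> (int \<Rightarrow> int \<Rightarrow> nat) \<Rightarrow> nat \<Rightarrow> conf \<Rightarrow> word list" where
  "enum_words k r G 0 c = replicate (conf_weight r G 0 c) []"
| "enum_words k r G (Suc j) c = replicate (conf_weight r G (Suc j) c) [] @
     concat (map (\<lambda>a. map (Cons a) (enum_words k r G j (conf_step r c a))) [0..<k])"

text \<open>Finds the block of a concatenation that contains position \<open>x\<close>, from the
  lengths of the blocks, and the offset within that block.\<close>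

fun pick :: "nat list \<Rightarrow> nat \<Rightarrow> nat \<times> nat" where
  "pick [] x = (0, x)"
| "pick (w # ws) x = (if x < w then (0, x) else (Suc (fst (pick ws (x - w))), snd (pick ws (x - w))))"

primrec unrank :: "nat \<Rightarrow> dfa_lqci \<Rightarrow> (int \<Rightarrow> int \<Rightarrow> nat) \<Rightarrow> nat \<Rightarrow> conf \<Rightarrow> nat \<Rightarrow> word" where
  "unrank k r G 0 c x = []"
| "unrank k r G (Suc j) c x =
     (if x < conf_weight r G (Suc j) c then []
      else let z = pick (map (\<lambda>a. total k r G j (conf_step r c a)) [0..<k]) (x - conf_weight r G (Suc j) c)
           in fst z # unrank k r G j (conf_step r c (fst z)) (snd z))"

lemma length_enum_words: "length (enum_words k r G j c) = total k r G j c"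
  by (induction j arbitrary: c) (simp_all add: length_concat o_def)

lemma pick_less:
  "x < sum_list ws \<Longrightarrow> fst (pick ws x) < length ws \<and> snd (pick ws x) < ws ! fst (pick ws x)"
  by (induction ws x rule: pick.induct) auto

lemma nth_concat_pick:
  "x < length (concat xss) \<Longrightarrow>
   concat xss ! x = xss ! fst (pick (map length xss) x) ! snd (pick (map length xss) x)"
  by (induction xss arbitrary: x) (auto simp: nth_append)

text \<open>The blocks have the totals of the successor configurations as lengths, so
  \<open>pick\<close> yields the next letter, and the offset is the rank among the
  continuations.\<close>

lemma enum_words_nth:
  "x < total k r G j c \<Longrightarrow> enum_words k r G j c ! x = unrank k r G j c x"
proof (induction j arbitrary: c x)
  case (Suc j)
  show ?case
  proof (cases "x < conf_weight r G (Suc j) c")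
    case False
    define y where "y = x - conf_weight r G (Suc j) c"
    let ?xss = "map (\<lambda>a. map (Cons a) (enum_words k r G j (conf_step r c a))) [0..<k]"
    define ws where "ws = map (\<lambda>a. total k r G j (conf_step r c a)) [0..<k]"
    have ws: "map length ?xss = ws" by (simp add: ws_def length_enum_words)
    have y: "y < sum_list ws" using False Suc.prems by (auto simp: y_def ws_def)
    have "y < length (concat ?xss)" using y by (simp only: length_concat ws)
    then have "concat ?xss ! y = ?xss ! fst (pick ws y) ! snd (pick ws y)"
      by (subst nth_concat_pick) (simp_all only: ws)
    moreover have *: "fst (pick ws y) < k" "snd (pick ws y) < ws ! fst (pick ws y)"
      using pick_less[OF y] by (auto simp: ws_def)
    ultimately have "concat ?xss ! y = fst (pick ws y) #
        unrank k r G j (conf_step r c (fst (pick ws y))) (snd (pick ws y))"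
      by (simp add: Suc.IH length_enum_words ws_def)
    then show ?thesis using False by (simp add: nth_append y_def ws_def Let_def)
  qed (simp add: nth_append)
qed simp

lemma count_list_replicate: "count_list (replicate n a) b = (if a = b then n else 0)"
  by (induction n) auto

lemma count_list_concat: "count_list (concat xss) w = (\<Sum>xs\<leftarrow>xss. count_list xs w)"
  by (induction xss) auto

lemma count_list_map_Cons:
  "count_list (map (Cons a) xs) w = (if w \<noteq> [] \<and> hd w = a then count_list xs (tl w) else 0)"
  by (induction xs) auto

text \<open>A word occurs only in the block of its first letter, so its multiplicity is the weight
  of the one configuration to which it leads.\<close>

lemma count_enum_words:
  "count_list (enum_words k r G j c) w =
     (if w \<in> words k \<and> length w \<le> j then conf_weight r G (j - length w) (foldl (conf_step r) c w) else 0)"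
proof (induction j arbitrary: c w)
  case 0
  show ?case by (auto simp: count_list_replicate words_def)
next
  case (Suc j)
  show ?case
  proof (cases w)
    case Nil
    then show ?thesis
      by (simp add: count_list_replicate count_list_concat o_def count_list_map_Cons words_def sum_list_0)
  next
    case (Cons a u)
    have "(\<Sum>b\<leftarrow>[0..<k]. count_list (map (Cons b) (enum_words k r G j (conf_step r c b))) w)
        = (\<Sum>b\<in>{..<k}. if b = a then count_list (enum_words k r G j (conf_step r c a)) u else 0)"
      using Cons by (simp add: count_list_map_Cons sum_list_distinct_conv_sum_set lessThan_atLeast0 if_distrib
          cong: if_cong)
    also have "\<dots> = (if a < k then count_list (enum_words k r G j (conf_step r c a)) u else 0)"
      by (simp add: sum.delta)
    finally show ?thesis
      using Cons by (simp add: count_list_replicate count_list_concat o_def Suc.IH words_def)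
  qed
qed

lemma run_from_not_Nil: "run_from M q w \<noteq> []"
  by (cases w) auto

text \<open>The cost of \<open>q2\<close> is already part of \<open>s\<close> and appears again as
  the first entry of the run; hence the subtraction.\<close>

lemma foldl_conf_step:
  "foldl (conf_step r) (q1, q2, q3, s) w =
     (last (run_from (hard_dfa r) q1 w), last (run_from (cost_dfa r) q2 w), last (run_from (label_dfa r) q3 w),
      s - ann (cost_dfa r) ! q2 + (\<Sum>q\<leftarrow>run_from (cost_dfa r) q2 w. ann (cost_dfa r) ! q))"
  by (induction w arbitrary: q1 q2 q3 s) (simp_all add: conf_step_def run_from_not_Nil)

section \<open>Improvisations and their classes by label and cost\<close>

definition dfa_impr :: "nat \<Rightarrow> dfa_lqci \<Rightarrow> word set" where
  "dfa_impr k r = improvisations k (lqci_of k r)"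

abbreviation label_of :: "dfa_lqci \<Rightarrow> word \<Rightarrow> int" where
  "label_of r \<equiv> final_ann (label_dfa r)"

abbreviation cost_of :: "dfa_lqci \<Rightarrow> word \<Rightarrow> int" where
  "cost_of r \<equiv> accumulated_cost (cost_dfa r)"

text \<open>After \<open>w\<close> has been read, \<open>max_len - length w\<close> letters are
  left, so the test in \<open>conf_weight\<close> is the lower length bound; the upper one is built
  into starting with \<open>max_len\<close>.\<close>

lemma conf_weight_foldl:
  assumes "length w \<le> max_len (dfa_params r)" "w \<in> words k"
  shows "conf_weight r G (max_len (dfa_params r) - length w) (foldl (conf_step r) (conf_init r) w)
    = (if w \<in> dfa_impr k r then G (label_of r w) (cost_of r w) else 0)"
  using assms
  by (auto simp: conf_weight_def conf_init_def foldl_conf_step dfa_impr_def improvisations_def lqci_of_def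
      dfa_language_def final_ann_def run_def accumulated_cost_def)

lemma count_enum_words_init:
  "count_list (enum_words k r G (max_len (dfa_params r)) (conf_init r)) w =
     (if w \<in> dfa_impr k r then G (label_of r w) (cost_of r w) else 0)"
  by (auto simp: count_enum_words conf_weight_foldl)
     (auto simp: dfa_impr_def improvisations_def lqci_of_def)

lemma finite_dfa_impr: "finite (dfa_impr k r)"
proof (rule finite_subset)
  show "dfa_impr k r \<subseteq> {w. set w \<subseteq> {..<k} \<and> length w \<le> max_len (dfa_params r)}"
    by (auto simp: dfa_impr_def improvisations_def lqci_of_def words_def)
qed (rule finite_lists_length_le, simp)

text \<open>Both sides count the entries of the enumeration, by its length and word by word.\<close>

lemma total_init:
  "total k r G (max_len (dfa_params r)) (conf_init r) = (\<Sum>w\<in>dfa_impr k r. G (label_of r w) (cost_of r w))"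
proof -
  let ?xs = "enum_words k r G (max_len (dfa_params r)) (conf_init r)"
  have "set ?xs \<subseteq> dfa_impr k r"
  proof
    fix w assume "w \<in> set ?xs"
    then have "count_list ?xs w \<noteq> 0" by (simp add: count_list_0_iff)
    then show "w \<in> dfa_impr k r" by (metis count_enum_words_init)
  qed
  then have "length ?xs = (\<Sum>w\<in>dfa_impr k r. count_list ?xs w)"
    by (simp add: sum_count_set finite_dfa_impr)
  then show ?thesis by (simp add: length_enum_words count_enum_words_init cong: sum.cong)
qed

text \<open>With an indicator as weight the total is a cardinality, so one dynamic program yields
  both the class sizes and, later, the total weight of the sampled distribution.\<close>

definition class_count :: "nat \<Rightarrow> dfa_lqci \<Rightarrow> int \<Rightarrow> int \<Rightarrow> nat" where
  "class_count k r l s =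
     total k r (\<lambda>l' s'. of_bool (l' = l \<and> s' = s)) (max_len (dfa_params r)) (conf_init r)"

lemma class_count_card:
  "class_count k r l s = card {w \<in> dfa_impr k r. label_of r w = l \<and> cost_of r w = s}"
  unfolding class_count_def total_init of_bool_def
  by (simp add: sum.If_cases finite_dfa_impr Int_def conj_commute)

text \<open>A run visits at most \<open>max_len + 1\<close> states, and no state costs more in
  absolute value than all of them together.\<close>

definition cost_range :: "dfa_lqci \<Rightarrow> nat" where
  "cost_range r = (max_len (dfa_params r) + 1) * cost_magnitude r"

lemma cost_le_magnitude:
  assumes "q < length (ann (cost_dfa r))"
  shows "\<bar>ann (cost_dfa r) ! q\<bar> \<le> int (cost_magnitude r)"
proof -
  have "nat \<bar>ann (cost_dfa r) ! q\<bar> \<le> cost_magnitude r"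
    unfolding cost_magnitude_def using assms by (intro member_le_sum_list) auto
  then show ?thesis by linarith
qed

lemma run_from_states:
  assumes "valid_dfa k M" "q < length (trans M)" "w \<in> words k"
  shows "set (run_from M q w) \<subseteq> {..<length (trans M)}"
  using assms(2,3)
proof (induction w arbitrary: q)
  case (Cons a w)
  have "trans M ! q \<in> set (trans M)" using Cons.prems by simp
  then have "length (trans M ! q) = k" "\<forall>p\<in>set (trans M ! q). p < length (trans M)"
    using assms(1) unfolding valid_dfa_def by blast+
  then have "trans M ! q ! a < length (trans M)" using Cons.prems by (simp add: words_def)
  with Cons show ?case by (simp add: words_def)
qed simp

lemma cost_of_bound:
  assumes r: "r \<in> dfa_instances k" and w: "w \<in> dfa_impr k r"
  shows "\<bar>cost_of r w\<bar> \<le> int (cost_range r)"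
proof -
  let ?M = "cost_dfa r" let ?qs = "run ?M w"
  have M: "valid_dfa k ?M" using r by (simp add: dfa_instances_def)
  have w': "w \<in> words k" "length w \<le> max_len (dfa_params r)"
    using w by (auto simp: dfa_impr_def improvisations_def lqci_of_def)
  have states: "set ?qs \<subseteq> {..<length (trans ?M)}"
    unfolding run_def using M w' by (intro run_from_states) (auto simp: valid_dfa_def)
  have "length (run_from ?M q u) = Suc (length u)" for q u
    by (induction u arbitrary: q) auto
  then have len: "length ?qs = Suc (length w)" by (simp add: run_def)
  have "\<bar>\<Sum>q\<leftarrow>qs. ann ?M ! q\<bar> \<le> int (length qs * cost_magnitude r)"
    if "set qs \<subseteq> {..<length (trans ?M)}" for qs
    using that
  proof (induction qs)
    case (Cons q qs)
    then have "\<bar>ann ?M ! q\<bar> \<le> int (cost_magnitude r)"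
      using M by (intro cost_le_magnitude) (auto simp: valid_dfa_def)
    with Cons show ?case by (simp add: algebra_simps)
  qed simp
  from this[OF states] have "\<bar>cost_of r w\<bar> \<le> int (Suc (length w) * cost_magnitude r)"
    unfolding accumulated_cost_def len .
  also have "\<dots> \<le> int (cost_range r)"
    unfolding cost_range_def using w'(2) by (intro iffD2[OF of_nat_le_iff] mult_le_mono1) simp
  finally show ?thesis .
qed

section \<open>The optimal improvising distribution\<close>

subsection \<open>Greedy allocation\<close>

text \<open>The budget that remains after every item has received \<open>lo j\<close> units is spent in the order of
  the keys \<open>\<kappa> j\<close>; hence the differences are meant to be truncated at 0.\<close>

definition greedy :: "('a \<Rightarrow> nat) \<Rightarrow> ('a \<Rightarrow> nat) \<Rightarrow> ('a \<Rightarrow> int) \<Rightarrow> 'a set \<Rightarrow> nat \<Rightarrow> 'a \<Rightarrow> nat" where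
  "greedy lo w \<kappa> J B j =
     lo j + min (w j) ((B - sum lo J) - (\<Sum>i\<in>J. if \<kappa> i < \<kappa> j then w i else 0))"

lemma greedy_bounds: "lo j \<le> greedy lo w \<kappa> J B j" "greedy lo w \<kappa> J B j \<le> lo j + w j"
  by (auto simp: greedy_def)

text \<open>Induction with the item of largest key last: it has all others as predecessors and
  changes nothing for them. Distinct keys are essential, since items with equal keys would ignore
  each other and could spend the same units twice.\<close>

lemma sum_greedy_increments:
  fixes \<kappa> :: "'a \<Rightarrow> int" and w :: "'a \<Rightarrow> nat"
  assumes "finite J" "inj_on \<kappa> J"
  shows "(\<Sum>j\<in>J. min (w j) (b - (\<Sum>i\<in>J. if \<kappa> i < \<kappa> j then w i else 0))) = min b (sum w J)"
  using assms
proof (induction J rule: finite_ranking_induct[where f = \<kappa>])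
  case (insert x S)
  show ?case
  proof (cases "x \<in> S")
    case True
    then have "insert x S = S" by blast
    with insert.IH insert.prems show ?thesis by simp
  next
    case False
    have less: "\<kappa> y < \<kappa> x" if "y \<in> S" for y
    proof -
      have "\<kappa> y \<noteq> \<kappa> x"
        using inj_onD[OF insert.prems(1), of y x] False that by auto
      with insert.hyps(2)[OF that] show ?thesis by linarith
    qed
    have "(\<Sum>i\<in>insert x S. if \<kappa> i < \<kappa> j then w i else 0) = (\<Sum>i\<in>S. if \<kappa> i < \<kappa> j then w i else 0)"
      if "j \<in> S" for j
      using insert.hyps(1) False less[OF that] by simp
    then have "(\<Sum>j\<in>S. min (w j) (b - (\<Sum>i\<in>insert x S. if \<kappa> i < \<kappa> j then w i else 0))) = min b (sum w S)"
      using insert.IH insert.prems by (simp cong: sum.cong)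
    moreover have "(\<Sum>i\<in>insert x S. if \<kappa> i < \<kappa> x then w i else 0) = sum w S"
      using insert.hyps(1) False less by (simp cong: sum.cong)
    ultimately show ?thesis using insert.hyps(1) False by simp
  qed
qed simp

lemma sum_greedy:
  assumes "finite J" "inj_on \<kappa> J" "sum lo J \<le> B" "B \<le> sum lo J + sum w J"
  shows "sum (greedy lo w \<kappa> J B) J = B"
  using sum_greedy_increments[OF assms(1,2), of w "B - sum lo J"] assms(3,4)
  by (simp add: greedy_def sum.distrib)

text \<open>With \<open>\<theta>\<close> the cost of the last item that receives additional units, \<open>c j - \<theta>\<close> and
  \<open>x j - greedy \<dots> j\<close> never have opposite signs.\<close>

lemma greedy_optimal:
  fixes c x :: "'a \<Rightarrow> real"
  assumes J: "finite J" "inj_on \<kappa> J" and B: "sum lo J \<le> B" "B \<le> sum lo J + sum w J"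
    and x: "\<And>j. j \<in> J \<Longrightarrow> real (lo j) \<le> x j" "\<And>j. j \<in> J \<Longrightarrow> x j \<le> real (lo j + w j)"
    and sum_x: "sum x J = real B"
    and c: "\<And>i j. i \<in> J \<Longrightarrow> j \<in> J \<Longrightarrow> \<kappa> i < \<kappa> j \<Longrightarrow> c i \<le> c j"
  shows "(\<Sum>j\<in>J. c j * real (greedy lo w \<kappa> J B j)) \<le> (\<Sum>j\<in>J. c j * x j)"
proof (cases "J = {}")
  case False
  define b where "b = B - sum lo J"
  define pre where "pre = (\<lambda>j. \<Sum>i\<in>J. if \<kappa> i < \<kappa> j then w i else 0)"
  let ?g = "greedy lo w \<kappa> J B"
  have g: "?g j = lo j + min (w j) (b - pre j)" for j by (simp add: greedy_def b_def pre_def)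
  \<comment> \<open>The items by whose end the budget is used up. The first of them in the order,
    \<open>t\<close> below, provides the threshold cost.\<close>
  define S where "S = {j \<in> J. b \<le> pre j + w j}"
  have pre_mono: "pre i + w i \<le> pre j" if "i \<in> J" "\<kappa> i < \<kappa> j" for i j
  proof -
    have "pre i + w i = (\<Sum>l\<in>J. (if \<kappa> l < \<kappa> i then w l else 0) + (if l = i then w l else 0))"
      using that(1) J(1) by (simp add: pre_def sum.distrib sum.delta)
    also have "\<dots> \<le> pre j" unfolding pre_def by (rule sum_mono) (use that in auto)
    finally show ?thesis .
  qed
  have "Max (\<kappa> ` J) \<in> \<kappa> ` J" using J(1) False by (intro Max_in) auto
  then obtain m where m: "m \<in> J" "Max (\<kappa> ` J) = \<kappa> m" by blast
  have le_m: "\<kappa> j \<le> \<kappa> m" if "j \<in> J" for j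
    using Max_ge[of "\<kappa> ` J" "\<kappa> j"] J(1) that unfolding m(2) by blast
  have "sum w J = pre m + w m"
  proof -
    have "sum w J = (\<Sum>l\<in>J. (if \<kappa> l < \<kappa> m then w l else 0) + (if l = m then w l else 0))"
    proof (rule sum.cong)
      fix l assume l: "l \<in> J"
      show "w l = (if \<kappa> l < \<kappa> m then w l else 0) + (if l = m then w l else 0)"
        using le_m[OF l] inj_onD[OF J(2) _ l m(1)] by force
    qed simp
    then show ?thesis using m(1) J(1) by (simp add: pre_def sum.distrib sum.delta)
  qed
  \<comment> \<open>The total capacity covers \<open>B\<close>, so at the latest the last item
    \<open>m\<close> exhausts the budget.\<close>
  then have "m \<in> S" using m(1) B by (simp add: S_def b_def)
  have "finite S" using J(1) by (simp add: S_def)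
  then have "Min (\<kappa> ` S) \<in> \<kappa> ` S" using \<open>m \<in> S\<close> by (intro Min_in) auto
  then obtain t where t: "t \<in> S" "Min (\<kappa> ` S) = \<kappa> t" by blast
  have t_le: "\<kappa> t \<le> \<kappa> j" if "j \<in> S" for j
    using Min_le[of "\<kappa> ` S" "\<kappa> j"] \<open>finite S\<close> that unfolding t(2) by blast
  have tJ: "t \<in> J" and tb: "b \<le> pre t + w t" using t(1) by (auto simp: S_def)
  \<comment> \<open>Items before \<open>t\<close> are full, and items after \<open>t\<close> stay at
    their lower bounds.\<close>
  have nonneg: "0 \<le> (c j - c t) * (x j - real (?g j))" if j: "j \<in> J" for j
  proof -
    consider "\<kappa> j < \<kappa> t" | "\<kappa> t < \<kappa> j" | "j = t" using inj_onD[OF J(2) _ j tJ] by force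
    then show ?thesis
    proof cases
      case 1
      then have "j \<notin> S" using t_le[of j] by linarith
      then have "?g j = lo j + w j" using j by (auto simp: S_def g)
      then show ?thesis using c[OF j tJ 1] x(2)[OF j] by (intro mult_nonpos_nonpos) auto
    next
      case 2
      then have "?g j = lo j" using pre_mono[OF tJ 2] tb by (simp add: g)
      then show ?thesis using c[OF tJ j 2] x(1)[OF j] by (intro mult_nonneg_nonneg) auto
    qed simp
  qed
  \<comment> \<open>Both allocations sum to \<open>B\<close>, so the multiple of \<open>c t\<close>
    cancels.\<close>
  have "0 \<le> (\<Sum>j\<in>J. (c j - c t) * (x j - real (?g j)))" using nonneg by (rule sum_nonneg)
  also have "\<dots> = (\<Sum>j\<in>J. c j * x j) - (\<Sum>j\<in>J. c j * real (?g j)) - c t * (sum x J - (\<Sum>j\<in>J. real (?g j)))"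
    by (simp add: algebra_simps sum.distrib sum_subtractf sum_distrib_left)
  also have "(\<Sum>j\<in>J. real (?g j)) = real B"
    using sum_greedy[OF J B] by (metis of_nat_sum)
  finally show ?thesis using sum_x by simp
qed simp

subsection \<open>The solution for an instance\<close>

abbreviation lcount :: "dfa_lqci \<Rightarrow> nat" where
  "lcount r \<equiv> length (labels (dfa_params r))"

definition iclass_count :: "nat \<Rightarrow> dfa_lqci \<Rightarrow> nat \<Rightarrow> int \<Rightarrow> nat" where
  "iclass_count k r i s = class_count k r (labels (dfa_params r) ! i) s"

definition cost_set :: "dfa_lqci \<Rightarrow> int set" where
  "cost_set r = {- int (cost_range r)..int (cost_range r)}"

definition bound_params :: "dfa_lqci \<Rightarrow> rat list" where
  "bound_params r = label_lo (dfa_params r) # label_hi (dfa_params r) #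
     cond_lo (dfa_params r) @ cond_hi (dfa_params r)"

text \<open>All bounds on probabilities are multiplied by the common denominator \<open>scale r\<close>.\<close>

definition scale :: "dfa_lqci \<Rightarrow> nat" where
  "scale r = (\<Prod>z\<leftarrow>bound_params r. nat (snd (quotient_of z)))"

definition scaled :: "dfa_lqci \<Rightarrow> rat \<Rightarrow> nat" where
  "scaled r z = nat (fst (quotient_of z)) * (scale r div nat (snd (quotient_of z)))"

text \<open>The unit is the fraction \<open>1 / scale r\<close> of the probability of the label. A
  bound on every single word becomes, for a whole class, one proportional to the size of the
  class.\<close>

definition cost_lo :: "nat \<Rightarrow> dfa_lqci \<Rightarrow> nat \<Rightarrow> int \<Rightarrow> nat" where
  "cost_lo k r i s = scaled r (cond_lo (dfa_params r) ! i) * iclass_count k r i s"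

definition cost_hi :: "nat \<Rightarrow> dfa_lqci \<Rightarrow> nat \<Rightarrow> int \<Rightarrow> nat" where
  "cost_hi k r i s = scaled r (cond_hi (dfa_params r) ! i) * iclass_count k r i s"

text \<open>Decides whether some conditional distribution given the label obeys the bounds on its
  words; otherwise the label must have probability 0.\<close>

definition label_ok :: "nat \<Rightarrow> dfa_lqci \<Rightarrow> nat \<Rightarrow> bool" where
  "label_ok k r i \<longleftrightarrow> (\<Sum>s\<in>cost_set r. cost_lo k r i s) \<le> scale r \<and>
     scale r \<le> (\<Sum>s\<in>cost_set r. cost_hi k r i s)"

definition cost_alloc :: "nat \<Rightarrow> dfa_lqci \<Rightarrow> nat \<Rightarrow> int \<Rightarrow> nat" where
  "cost_alloc k r i s =
     greedy (cost_lo k r i) (\<lambda>s. cost_hi k r i s - cost_lo k r i s) (\<lambda>s. s) (cost_set r) (scale r) s"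

text \<open>For an admissible label this is \<open>scale r\<close> times the least expected cost
  given the label.\<close>

definition label_cost :: "nat \<Rightarrow> dfa_lqci \<Rightarrow> nat \<Rightarrow> int" where
  "label_cost k r i = (\<Sum>s\<in>cost_set r. s * int (cost_alloc k r i s))"

definition lab_lo :: "dfa_lqci \<Rightarrow> nat" where
  "lab_lo r = scaled r (label_lo (dfa_params r))"

text \<open>The value 0 excludes inadmissible labels; if \<open>lab_lo r\<close> is positive,
  \<open>solvable\<close> then fails.\<close>

definition lab_hi :: "nat \<Rightarrow> dfa_lqci \<Rightarrow> nat \<Rightarrow> nat" where
  "lab_hi k r i = (if label_ok k r i then scaled r (label_hi (dfa_params r)) else 0)"

text \<open>The key orders the labels by their cost; the second summand breaks ties.\<close>

definition label_key :: "nat \<Rightarrow> dfa_lqci \<Rightarrow> nat \<Rightarrow> int" where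
  "label_key k r i = label_cost k r i * int (lcount r) + int i"

definition label_alloc :: "nat \<Rightarrow> dfa_lqci \<Rightarrow> nat \<Rightarrow> nat" where
  "label_alloc k r i = greedy (\<lambda>_. lab_lo r) (\<lambda>i. lab_hi k r i - lab_lo r) (label_key k r)
     {..<lcount r} (scale r) i"

text \<open>\<open>label_cost\<close> and \<open>label_alloc\<close> each carry a factor
  \<open>scale r\<close>, so expected costs are compared in units of
  \<open>1 / (scale r * scale r)\<close>, with the denominator of the cost bound cleared.\<close>

definition solvable :: "nat \<Rightarrow> dfa_lqci \<Rightarrow> bool" where
  "solvable k r \<longleftrightarrow>
     (\<forall>i\<in>{..<lcount r}. lab_lo r \<le> lab_hi k r i) \<and> (\<Sum>i\<in>{..<lcount r}. lab_lo r) \<le> scale r \<and>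
     scale r \<le> (\<Sum>i\<in>{..<lcount r}. lab_hi k r i) \<and>
     snd (quotient_of (cost_bound (dfa_params r))) * (\<Sum>i\<in>{..<lcount r}. label_cost k r i * int (label_alloc k r i))
       \<le> fst (quotient_of (cost_bound (dfa_params r))) * (int (scale r) * int (scale r))"

text \<open>A common multiple of the sizes of all nonempty classes. The plain product is small
  enough, and \<open>max 1\<close> keeps empty classes from turning it into 0.\<close>

definition class_prod :: "nat \<Rightarrow> dfa_lqci \<Rightarrow> nat" where
  "class_prod k r = (\<Prod>i\<in>{..<lcount r}. \<Prod>s\<in>cost_set r. max 1 (iclass_count k r i s))"

definition class_weight :: "nat \<Rightarrow> dfa_lqci \<Rightarrow> nat \<Rightarrow> int \<Rightarrow> nat" where
  "class_weight k r i s =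
     label_alloc k r i * cost_alloc k r i s * (class_prod k r div iclass_count k r i s)"

text \<open>Labels are distinct, so at most one summand is nonzero; the sum replaces a search for
  the index of \<open>l\<close>.\<close>

definition word_weight :: "nat \<Rightarrow> dfa_lqci \<Rightarrow> int \<Rightarrow> int \<Rightarrow> nat" where
  "word_weight k r l s =
     (\<Sum>i\<in>{..<lcount r}. if labels (dfa_params r) ! i = l then class_weight k r i s else 0)"

lemma prod_list_dvd: "z \<in> set zs \<Longrightarrow> f z dvd (\<Prod>z\<leftarrow>zs. f z :: nat)"
  by (induction zs) auto

lemma scale_pos: "0 < scale r"
proof -
  have "0 < (\<Prod>z\<leftarrow>zs. nat (snd (quotient_of z)))" for zs
    by (induction zs) (auto simp: quotient_of_denom_pos')
  then show ?thesis unfolding scale_def by blast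
qed

lemma of_rat_quotient: "(of_rat z :: real) = of_int (fst (quotient_of z)) / of_int (snd (quotient_of z))"
proof -
  have "z = of_int (fst (quotient_of z)) / of_int (snd (quotient_of z))"
    by (rule quotient_of_div) simp
  then have "(of_rat z :: real) = of_rat (of_int (fst (quotient_of z)) / of_int (snd (quotient_of z)))"
    by (rule arg_cong)
  then show ?thesis by (simp add: of_rat_divide)
qed

text \<open>The denominator of \<open>z\<close> divides \<open>scale r\<close>, so the division in
  \<open>scaled\<close> is exact.\<close>

lemma real_scaled:
  assumes "z \<in> set (bound_params r)" "0 \<le> z"
  shows "real (scaled r z) = of_rat z * real (scale r)"
proof -
  define d where "d = nat (snd (quotient_of z))"
  have d: "0 < d" "snd (quotient_of z) = int d" using quotient_of_denom_pos'[of z] by (auto simp: d_def)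
  have "d dvd scale r" unfolding scale_def d_def by (rule prod_list_dvd[OF assms(1)])
  then have "real (scale r div d) = real (scale r) / real d" by (simp add: real_of_nat_div)
  moreover have "(0::real) \<le> of_rat z" using assms(2) by simp
  then have "0 \<le> fst (quotient_of z)"
    using d by (simp add: of_rat_quotient zero_le_divide_iff)
  ultimately show ?thesis using d by (simp add: scaled_def of_rat_quotient d_def[symmetric])
qed

subsection \<open>Optimality of the solution\<close>

locale dfa_instance =
  fixes k :: nat and r :: dfa_lqci
  assumes inst: "r \<in> dfa_instances k"
begin

abbreviation "par \<equiv> dfa_params r"
abbreviation "Q \<equiv> scale r"
abbreviation "L \<equiv> lcount r"
abbreviation "I \<equiv> dfa_impr k r"
abbreviation "S \<equiv> cost_set r"

definition label_cell :: "nat \<Rightarrow> word set" where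
  "label_cell i = {w \<in> I. label_of r w = labels par ! i}"

definition cell :: "nat \<Rightarrow> int \<Rightarrow> word set" where
  "cell i s = {w \<in> I. label_of r w = labels par ! i \<and> cost_of r w = s}"

lemma valid: "valid_params par" "\<And>w. w \<in> words k \<Longrightarrow> label_of r w \<in> set (labels par)"
  using inst by (auto simp: dfa_instances_def valid_lqci_def lqci_of_def)

lemma label_class_eq: "label_class k (lqci_of k r) i = label_cell i"
  by (auto simp: label_class_def label_cell_def dfa_impr_def lqci_of_def)

lemma finite_cells: "finite (label_cell i)" "finite (cell i s)"
proof -
  have "label_cell i \<subseteq> I" "cell i s \<subseteq> I" by (auto simp: label_cell_def cell_def)
  then show "finite (label_cell i)" "finite (cell i s)"
    using finite_dfa_impr by (blast intro: finite_subset)+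
qed

lemma card_cell: "card (cell i s) = iclass_count k r i s"
  by (simp add: cell_def iclass_count_def class_count_card)

lemma cell_subset: "cell i s \<subseteq> label_cell i"
  by (auto simp: cell_def label_cell_def)

lemma finite_cost_set: "finite S"
  by (simp add: cost_set_def)

lemma cost_in_cost_set: "w \<in> I \<Longrightarrow> cost_of r w \<in> S"
  using cost_of_bound[OF inst] by (force simp: cost_set_def)

lemma sum_label_cell: "(\<Sum>w\<in>label_cell i. f w) = (\<Sum>s\<in>S. \<Sum>w\<in>cell i s. f w)" for f :: "word \<Rightarrow> real"
proof -
  have "(\<Sum>s\<in>S. sum f {w \<in> label_cell i. cost_of r w = s}) = sum f (label_cell i)"
    by (rule sum.group[OF finite_cells(1) finite_cost_set]) (auto simp: label_cell_def intro: cost_in_cost_set)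
  moreover have "{w \<in> label_cell i. cost_of r w = s} = cell i s" for s
    by (auto simp: label_cell_def cell_def)
  ultimately show ?thesis by simp
qed

lemma label_index:
  assumes "w \<in> I"
  obtains i where "i < L" "label_of r w = labels par ! i"
proof -
  have "w \<in> words k" using assms by (simp add: dfa_impr_def improvisations_def)
  then show ?thesis using valid(2) that by (metis in_set_conv_nth)
qed

lemma label_index_unique: "i < L \<Longrightarrow> j < L \<Longrightarrow> labels par ! i = labels par ! j \<longleftrightarrow> i = j"
  using valid(1) by (simp add: valid_params_def nth_eq_iff_index_eq)

lemma sum_I: "(\<Sum>w\<in>I. f w) = (\<Sum>i<L. \<Sum>w\<in>label_cell i. f w)" for f :: "word \<Rightarrow> real"
proof -
  have "I = (\<Union>i<L. label_cell i)" by (auto simp: label_cell_def elim: label_index)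
  moreover have "(\<Sum>w\<in>(\<Union>i<L. label_cell i). f w) = (\<Sum>i<L. \<Sum>w\<in>label_cell i. f w)"
    by (rule sum.UNION_disjoint) (auto simp: finite_cells, auto simp: label_cell_def label_index_unique)
  ultimately show ?thesis by simp
qed

definition mass :: "word pmf \<Rightarrow> nat \<Rightarrow> real" where
  "mass D i = (\<Sum>w\<in>label_cell i. pmf D w)"

text \<open>If a label has mass 0, so does each of its words, and the multiplied bounds hold
  trivially; this matches the restriction to positive probability in
  \<open>improvising\<close>.\<close>

lemma improvising_iff:
  "improvising k (lqci_of k r) D \<longleftrightarrow>
     set_pmf D \<subseteq> I \<and> (\<Sum>w\<in>I. real_of_int (cost_of r w) * pmf D w) \<le> of_rat (cost_bound par) \<and>
     (\<forall>i<L. of_rat (label_lo par) \<le> mass D i \<and> mass D i \<le> of_rat (label_hi par) \<and>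
       (\<forall>w\<in>label_cell i. of_rat (cond_lo par ! i) * mass D i \<le> pmf D w \<and>
          pmf D w \<le> of_rat (cond_hi par ! i) * mass D i))"
proof -
  have par: "params (lqci_of k r) = par" by (simp add: lqci_of_def)
  have supp: "measure_pmf.prob D (improvisations k (lqci_of k r)) = 1 \<longleftrightarrow> set_pmf D \<subseteq> I"
    by (subst measure_pmf.prob_eq_1) (auto simp: AE_measure_pmf_iff dfa_impr_def)
  have cost: "measure_pmf.expectation D (\<lambda>w. real_of_rat (cost_fun (lqci_of k r) w))
      = (\<Sum>w\<in>I. real_of_int (cost_of r w) * pmf D w)" if "set_pmf D \<subseteq> I"
    by (subst integral_measure_pmf[where A = I])
       (use that in \<open>auto simp: finite_dfa_impr lqci_of_def mult.commute\<close>)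
  have mass: "measure_pmf.prob D (label_cell i) = mass D i" for i
    by (simp add: mass_def measure_measure_pmf_finite finite_cells)
  have cond: "(mass D i > 0 \<longrightarrow> (\<forall>w\<in>label_cell i.
        a \<le> \<P>(v in D. v = w \<bar> v \<in> label_cell i) \<and> \<P>(v in D. v = w \<bar> v \<in> label_cell i) \<le> b))
      \<longleftrightarrow> (\<forall>w\<in>label_cell i. a * mass D i \<le> pmf D w \<and> pmf D w \<le> b * mass D i)" for a b i
  proof (cases "mass D i > 0")
    case True
    have "\<P>(v in D. v = w \<bar> v \<in> label_cell i) = pmf D w / mass D i" if "w \<in> label_cell i" for w
    proof -
      have "{v. v = w \<and> v \<in> label_cell i} = {w}" using that by auto
      then show ?thesis
        using mass[of i] by (simp add: cond_prob_def pmf.rep_eq)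
    qed
    with True show ?thesis by (simp add: pos_le_divide_eq pos_divide_le_eq)
  next
    case False
    have "0 \<le> mass D i" by (simp add: mass_def sum_nonneg)
    with False have 0: "mass D i = 0" by simp
    then have "pmf D w = 0" if "w \<in> label_cell i" for w
      using that sum_nonneg_eq_0_iff[OF finite_cells(1), of i "pmf D"] by (simp add: mass_def)
    with 0 show ?thesis by simp
  qed
  show ?thesis
    unfolding improvising_def par supp label_class_eq mass cond using cost by (cases "set_pmf D \<subseteq> I") auto
qed

lemma scaled_cond_lo: "i < L \<Longrightarrow> real (scaled r (cond_lo par ! i)) = of_rat (cond_lo par ! i) * Q"
  and scaled_cond_hi: "i < L \<Longrightarrow> real (scaled r (cond_hi par ! i)) = of_rat (cond_hi par ! i) * Q"
  using valid(1) by (force intro!: real_scaled simp: valid_params_def bound_params_def)+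

lemma scaled_label_lo: "real (scaled r (label_lo par)) = of_rat (label_lo par) * Q"
  and scaled_label_hi: "real (scaled r (label_hi par)) = of_rat (label_hi par) * Q"
  using valid(1) by (auto intro!: real_scaled simp: valid_params_def bound_params_def)

lemma Q_pos: "0 < real Q"
  using scale_pos by simp

lemma scaled_cond_mono: "i < L \<Longrightarrow> scaled r (cond_lo par ! i) \<le> scaled r (cond_hi par ! i)"
proof -
  assume i: "i < L"
  have "(of_rat (cond_lo par ! i) :: real) \<le> of_rat (cond_hi par ! i)"
    using valid(1) i by (simp add: valid_params_def of_rat_less_eq)
  then have "real (scaled r (cond_lo par ! i)) \<le> real (scaled r (cond_hi par ! i))"
    using i Q_pos by (simp add: scaled_cond_lo scaled_cond_hi)
  then show ?thesis by simp
qed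

lemma cost_lo_le_hi: "i < L \<Longrightarrow> cost_lo k r i s \<le> cost_hi k r i s"
  unfolding cost_lo_def cost_hi_def by (intro mult_le_mono1 scaled_cond_mono)

lemma sum_cost_hi: "i < L \<Longrightarrow>
  (\<Sum>s\<in>S. cost_lo k r i s) + (\<Sum>s\<in>S. cost_hi k r i s - cost_lo k r i s) = (\<Sum>s\<in>S. cost_hi k r i s)"
  by (simp add: sum.distrib[symmetric] cost_lo_le_hi)

lemma cost_alloc_bounds:
  assumes "i < L"
  shows "cost_lo k r i s \<le> cost_alloc k r i s" "cost_alloc k r i s \<le> cost_hi k r i s"
  using greedy_bounds[where lo = "cost_lo k r i" and j = s and w = "\<lambda>s. cost_hi k r i s - cost_lo k r i s"
      and \<kappa> = "\<lambda>s. s" and J = S and B = Q]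
    cost_lo_le_hi[OF assms, of s] unfolding cost_alloc_def by linarith+

lemma sum_cost_alloc:
  assumes "i < L" "label_ok k r i"
  shows "(\<Sum>s\<in>S. cost_alloc k r i s) = Q"
  unfolding cost_alloc_def
  by (rule sum_greedy) (use assms in \<open>auto simp: finite_cost_set label_ok_def sum_cost_hi\<close>)

text \<open>The index is the remainder of the key modulo the number of labels.\<close>

lemma inj_label_key: "inj_on (label_key k r) {..<L}"
proof (rule inj_onI)
  fix i j assume ij: "i \<in> {..<L}" "j \<in> {..<L}" and eq: "label_key k r i = label_key k r j"
  then have "label_key k r i mod int L = label_key k r j mod int L" by simp
  with ij show "i = j" by (simp add: label_key_def)
qed

text \<open>Indices are below \<open>L\<close>, so a difference of 1 in cost outweighs any
  difference of indices.\<close>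

lemma label_key_mono:
  assumes "i < L" "j < L" "label_key k r i < label_key k r j"
  shows "label_cost k r i \<le> label_cost k r j"
proof (rule ccontr)
  assume "\<not> ?thesis"
  then have "(label_cost k r j + 1) * int L \<le> label_cost k r i * int L"
    by (intro mult_right_mono) auto
  with assms show False by (simp add: label_key_def algebra_simps)
qed

text \<open>Only the probabilities \<open>q i s\<close> of the cells enter. Summing the bounds over
  each cell has the effect of averaging, and no averaged distribution has to be constructed. The
  rescaled probabilities of \<open>D\<close> then compete with the greedy allocations, within each
  label and among the labels.\<close>

lemma solvable_if_improvising:
  assumes "improvising k (lqci_of k r) D"
  shows "solvable k r"
proof -
  note D = assms[unfolded improvising_iff]
  define q where "q i s = (\<Sum>w\<in>cell i s. pmf D w)" for i s
  have mass_q: "mass D i = (\<Sum>s\<in>S. q i s)" for i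
    by (simp add: mass_def sum_label_cell q_def)
  have mass_nonneg: "0 \<le> mass D i" for i by (simp add: mass_def sum_nonneg)
  have q_nonneg: "0 \<le> q i s" for i s by (simp add: q_def sum_nonneg)
  have q_lo: "real (cost_lo k r i s) * mass D i \<le> q i s * Q"
    and q_hi: "q i s * Q \<le> real (cost_hi k r i s) * mass D i" if i: "i < L" for i s
  proof -
    have w: "of_rat (cond_lo par ! i) * mass D i \<le> pmf D w" "pmf D w \<le> of_rat (cond_hi par ! i) * mass D i"
      if "w \<in> cell i s" for w
      using D i that cell_subset by blast+
    have "real (iclass_count k r i s) * (of_rat (cond_lo par ! i) * mass D i) \<le> q i s"
      using sum_bounded_below[of "cell i s" _ "pmf D"] w(1) by (simp add: card_cell q_def)
    then have "real (iclass_count k r i s) * (of_rat (cond_lo par ! i) * mass D i) * Q \<le> q i s * Q"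
      using Q_pos by simp
    then show "real (cost_lo k r i s) * mass D i \<le> q i s * Q"
      using i by (simp add: cost_lo_def scaled_cond_lo mult_ac)
    have "q i s \<le> real (iclass_count k r i s) * (of_rat (cond_hi par ! i) * mass D i)"
      using sum_bounded_above[of "cell i s" "pmf D"] w(2) by (simp add: card_cell q_def)
    then have "q i s * Q \<le> real (iclass_count k r i s) * (of_rat (cond_hi par ! i) * mass D i) * Q"
      using Q_pos by simp
    then show "q i s * Q \<le> real (cost_hi k r i s) * mass D i"
      using i by (simp add: cost_hi_def scaled_cond_hi mult_ac)
  qed
  have ok: "label_ok k r i \<and> mass D i * real_of_int (label_cost k r i) \<le> Q * (\<Sum>s\<in>S. real_of_int s * q i s)"
    if i: "i < L" and pos: "mass D i > 0" for i
  proof -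
    \<comment> \<open>The conditional distribution of the cost given the label, in units of
      \<open>1 / Q\<close>: a competitor of \<open>cost_alloc\<close>.\<close>
    define x where "x s = q i s * Q / mass D i" for s
    have x: "real (cost_lo k r i s) \<le> x s" "x s \<le> real (cost_hi k r i s)" for s
      using q_lo[OF i, of s] q_hi[OF i, of s] pos by (simp_all add: x_def pos_le_divide_eq pos_divide_le_eq)
    have "sum x S = (\<Sum>s\<in>S. q i s) * Q / mass D i"
      unfolding x_def by (simp add: sum_distrib_right sum_divide_distrib)
    then have sum_x: "sum x S = Q" using pos mass_q[of i] by simp
    have "real (\<Sum>s\<in>S. cost_lo k r i s) \<le> real Q" "real Q \<le> real (\<Sum>s\<in>S. cost_hi k r i s)"
      unfolding of_nat_sum sum_x[symmetric] by (intro sum_mono x)+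
    then have ok: "label_ok k r i" by (simp only: label_ok_def of_nat_le_iff)
    have "(\<Sum>s\<in>S. real_of_int s * real (cost_alloc k r i s)) \<le> (\<Sum>s\<in>S. real_of_int s * x s)"
      unfolding cost_alloc_def
    proof (rule greedy_optimal)
      show "(\<Sum>s\<in>S. cost_lo k r i s) \<le> Q"
        "Q \<le> (\<Sum>s\<in>S. cost_lo k r i s) + (\<Sum>s\<in>S. cost_hi k r i s - cost_lo k r i s)"
        using ok i by (auto simp: label_ok_def sum_cost_hi)
      show "x s \<le> real (cost_lo k r i s + (cost_hi k r i s - cost_lo k r i s))" for s
        using x(2)[of s] cost_lo_le_hi[OF i, of s] by simp
    qed (auto simp: finite_cost_set sum_x x)
    also have "\<dots> = Q * (\<Sum>s\<in>S. real_of_int s * q i s) / mass D i"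
      unfolding x_def by (simp add: sum_distrib_left sum_divide_distrib mult_ac)
    finally have "real_of_int (label_cost k r i) \<le> Q * (\<Sum>s\<in>S. real_of_int s * q i s) / mass D i"
      by (simp add: label_cost_def)
    with ok pos show ?thesis by (simp add: pos_le_divide_eq mult.commute)
  qed
  \<comment> \<open>A label of mass 0 need not be admissible, but then both sides vanish.\<close>
  have cost: "mass D i * real_of_int (label_cost k r i) \<le> Q * (\<Sum>s\<in>S. real_of_int s * q i s)"
    if i: "i < L" for i
  proof (cases "mass D i > 0")
    case False
    then have 0: "mass D i = 0" using mass_nonneg[of i] by simp
    then have "q i s = 0" if "s \<in> S" for s
      using that mass_q[of i] sum_nonneg_eq_0_iff[OF finite_cost_set, of "q i"] q_nonneg by simp
    with 0 show ?thesis by simp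
  qed (use ok[OF i] in blast)
  \<comment> \<open>The probabilities of the labels in units of \<open>1 / Q\<close>, competing with
    \<open>label_alloc\<close>.\<close>
  define x where "x i = mass D i * Q" for i
  have x_lo: "real (lab_lo r) \<le> x i" and x_hi: "x i \<le> real (lab_hi k r i)" if i: "i < L" for i
  proof -
    show "real (lab_lo r) \<le> x i"
      using D i Q_pos by (simp add: lab_lo_def scaled_label_lo x_def)
    show "x i \<le> real (lab_hi k r i)"
    proof (cases "label_ok k r i")
      case True
      then show ?thesis using D i Q_pos by (simp add: lab_hi_def scaled_label_hi x_def)
    next
      case False
      \<comment> \<open>By \<open>ok\<close>, an inadmissible label cannot have positive
        mass.\<close>
      then have "mass D i = 0" using ok[OF i] mass_nonneg[of i] by fastforce
      then show ?thesis by (simp add: x_def)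
    qed
  qed
  have "(\<Sum>i<L. mass D i) = 1"
  proof -
    have "(\<Sum>w\<in>I. pmf D w) = 1" using D finite_dfa_impr by (intro sum_pmf_eq_1) auto
    then show ?thesis by (simp add: sum_I mass_def)
  qed
  then have sum_x: "(\<Sum>i<L. x i) = Q" unfolding x_def by (simp add: sum_distrib_right[symmetric])
  have lo_hi: "lab_lo r \<le> lab_hi k r i" if "i < L" for i
    using x_lo[OF that] x_hi[OF that] by linarith
  have "real (\<Sum>i<L. lab_lo r) \<le> real Q" "real Q \<le> real (\<Sum>i<L. lab_hi k r i)"
    unfolding of_nat_sum sum_x[symmetric] by (intro sum_mono; use x_lo x_hi in simp)+
  then have B: "(\<Sum>i<L. lab_lo r) \<le> Q" "Q \<le> (\<Sum>i<L. lab_hi k r i)"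
    by (simp_all only: of_nat_le_iff)
  have "(\<Sum>i<L. real_of_int (label_cost k r i) * real (label_alloc k r i)) \<le>
      (\<Sum>i<L. real_of_int (label_cost k r i) * x i)"
    unfolding label_alloc_def
  proof (rule greedy_optimal)
    have "(\<Sum>i<L. lab_lo r) + (\<Sum>i<L. lab_hi k r i - lab_lo r) = (\<Sum>i<L. lab_hi k r i)"
      unfolding sum.distrib[symmetric] by (rule sum.cong) (use lo_hi in auto)
    then show "Q \<le> (\<Sum>i<L. lab_lo r) + (\<Sum>i<L. lab_hi k r i - lab_lo r)"
      using B(2) by simp
  qed (use x_lo x_hi lo_hi sum_x B(1) in \<open>auto simp: inj_label_key intro: label_key_mono\<close>)
  \<comment> \<open>No label is cheaper under \<open>D\<close> than with its own optimal conditional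
    distribution.\<close>
  also have "\<dots> \<le> (\<Sum>i<L. Q * (Q * (\<Sum>s\<in>S. real_of_int s * q i s)))"
  proof (rule sum_mono)
    fix i assume "i \<in> {..<L}"
    then have "mass D i * real_of_int (label_cost k r i) * Q \<le> Q * (\<Sum>s\<in>S. real_of_int s * q i s) * Q"
      using cost[of i] Q_pos by (intro mult_right_mono) auto
    then show "real_of_int (label_cost k r i) * x i \<le> Q * (Q * (\<Sum>s\<in>S. real_of_int s * q i s))"
      by (simp add: x_def mult_ac)
  qed
  also have "\<dots> = Q * Q * (\<Sum>w\<in>I. real_of_int (cost_of r w) * pmf D w)"
  proof -
    have "(\<Sum>w\<in>cell i s. real_of_int (cost_of r w) * pmf D w) = real_of_int s * q i s" for i s
      unfolding q_def sum_distrib_left by (rule sum.cong) (auto simp: cell_def)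
    then show ?thesis by (simp add: sum_I sum_label_cell sum_distrib_left mult_ac)
  qed
  also have "\<dots> \<le> Q * Q * of_rat (cost_bound par)"
    using D by (intro mult_left_mono) auto
  finally have *: "(\<Sum>i<L. real_of_int (label_cost k r i) * real (label_alloc k r i)) \<le> Q * Q * of_rat (cost_bound par)" .
  define a d where "a = fst (quotient_of (cost_bound par))" and "d = snd (quotient_of (cost_bound par))"
  have d: "0 < d" unfolding d_def by (rule quotient_of_denom_pos')
  have "of_int d * (\<Sum>i<L. real_of_int (label_cost k r i) * real (label_alloc k r i)) \<le>
      of_int d * (Q * Q * of_rat (cost_bound par))"
    using * d by (intro mult_left_mono) auto
  also have "\<dots> = of_int a * (Q * Q)"
    using d by (simp add: of_rat_quotient a_def[symmetric] d_def[symmetric])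
  finally have "real_of_int (d * (\<Sum>i<L. label_cost k r i * int (label_alloc k r i))) \<le> real_of_int (a * (int Q * int Q))"
    by simp
  then show ?thesis
    unfolding solvable_def a_def[symmetric] d_def[symmetric] of_int_le_iff using lo_hi B by blast
qed

end

section \<open>The distribution given by the integer weights\<close>

definition sample_count :: "nat \<Rightarrow> dfa_lqci \<Rightarrow> nat" where
  "sample_count k r = total k r (word_weight k r) (max_len (dfa_params r)) (conf_init r)"

definition sample_word :: "nat \<Rightarrow> dfa_lqci \<Rightarrow> nat \<Rightarrow> word" where
  "sample_word k r = unrank k r (word_weight k r) (max_len (dfa_params r)) (conf_init r)"

definition sample_pmf :: "nat \<Rightarrow> dfa_lqci \<Rightarrow> word pmf" where
  "sample_pmf k r = map_pmf (sample_word k r) (pmf_of_set {..<sample_count k r})"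

text \<open>A uniform position in the enumeration hits a word with probability proportional to its
  number of repetitions.\<close>

lemma pmf_sample_pmf:
  assumes "0 < sample_count k r"
  shows "pmf (sample_pmf k r) w =
     (if w \<in> dfa_impr k r then real (word_weight k r (label_of r w) (cost_of r w)) / real (sample_count k r) else 0)"
proof -
  let ?xs = "enum_words k r (word_weight k r) (max_len (dfa_params r)) (conf_init r)"
  have len: "length ?xs = sample_count k r" by (simp add: length_enum_words sample_count_def)
  have "{..<sample_count k r} \<inter> sample_word k r -` {w} = {x. x < length ?xs \<and> w = ?xs ! x}"
    by (auto simp: len) (simp_all add: sample_word_def sample_count_def enum_words_nth)
  then have "pmf (sample_pmf k r) w = real (card {x. x < length ?xs \<and> w = ?xs ! x}) / real (sample_count k r)"
    using assms by (simp add: sample_pmf_def pmf_map measure_pmf_of_set lessThan_empty_iff)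
  also have "card {x. x < length ?xs \<and> w = ?xs ! x} = count_list ?xs w"
    by (simp add: count_list_eq_length_filter length_filter_conv_card)
  finally show ?thesis by (simp add: count_enum_words_init)
qed

context dfa_instance
begin

abbreviation "M \<equiv> class_prod k r"

lemma M_pos: "0 < M"
  unfolding class_prod_def by (intro prod_pos ballI) simp

lemma word_weight_cell:
  assumes "i < L" "w \<in> cell i s"
  shows "word_weight k r (label_of r w) (cost_of r w) = class_weight k r i s"
proof -
  have "word_weight k r (label_of r w) (cost_of r w) = (\<Sum>j<L. if j = i then class_weight k r j s else 0)"
    unfolding word_weight_def using assms by (intro sum.cong) (auto simp: cell_def label_index_unique)
  then show ?thesis using assms(1) by simp
qed

text \<open>For a nonempty class the division in \<open>class_weight\<close> is exact. An empty
  class has upper bound 0, hence no allocation, so dividing by 0 does no harm.\<close>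

lemma class_count_mult_weight:
  assumes "i < L" "s \<in> S"
  shows "iclass_count k r i s * class_weight k r i s = label_alloc k r i * cost_alloc k r i s * M"
proof (cases "iclass_count k r i s = 0")
  case True
  then have "cost_alloc k r i s = 0"
    using cost_alloc_bounds(2)[OF assms(1), of s] by (simp add: cost_hi_def)
  then show ?thesis using True by simp
next
  case False
  have "max 1 (iclass_count k r i s) dvd (\<Prod>s\<in>S. max 1 (iclass_count k r i s))"
    using assms(2) finite_cost_set by (intro dvd_prodI)
  also have "\<dots> dvd M"
    unfolding class_prod_def using assms(1) by (intro dvd_prodI) auto
  finally have "iclass_count k r i s dvd M" using False by (simp add: max_def split: if_splits)
  then show ?thesis by (simp add: class_weight_def)
qed

lemma sum_cell_weight:
  assumes "i < L" "s \<in> S"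
  shows "(\<Sum>w\<in>cell i s. real (word_weight k r (label_of r w) (cost_of r w)))
    = real (label_alloc k r i) * real (cost_alloc k r i s) * real M"
proof -
  have "(\<Sum>w\<in>cell i s. real (word_weight k r (label_of r w) (cost_of r w)))
      = real (iclass_count k r i s * class_weight k r i s)"
    using assms(1) by (simp add: word_weight_cell card_cell)
  then show ?thesis by (simp only: class_count_mult_weight[OF assms] of_nat_mult)
qed

lemma improvising_sample_pmf:
  assumes solvable: "solvable k r"
  shows "0 < sample_count k r" "improvising k (lqci_of k r) (sample_pmf k r)"
proof -
  have lo_hi: "lab_lo r \<le> lab_hi k r i" if "i < L" for i
    using solvable that by (simp add: solvable_def)
  have B: "(\<Sum>i<L. lab_lo r) \<le> Q" "Q \<le> (\<Sum>i<L. lab_hi k r i)"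
    using solvable by (simp_all add: solvable_def)
  have sums: "(\<Sum>i<L. lab_lo r) + (\<Sum>i<L. lab_hi k r i - lab_lo r) = (\<Sum>i<L. lab_hi k r i)"
    unfolding sum.distrib[symmetric] by (rule sum.cong) (use lo_hi in auto)
  have sum_alloc: "(\<Sum>i<L. label_alloc k r i) = Q"
    unfolding label_alloc_def by (rule sum_greedy) (use B sums in \<open>auto simp: inj_label_key\<close>)
  have alloc: "lab_lo r \<le> label_alloc k r i" "label_alloc k r i \<le> lab_hi k r i" if "i < L" for i
    using greedy_bounds[where lo = "\<lambda>_. lab_lo r" and j = i and w = "\<lambda>i. lab_hi k r i - lab_lo r"
      and \<kappa> = "label_key k r" and J = "{..<L}" and B = Q] lo_hi[OF that]
    unfolding label_alloc_def by linarith+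
  let ?G = "\<lambda>w. real (word_weight k r (label_of r w) (cost_of r w))"
  let ?W = "real (sample_count k r)"
  have sum_label: "(\<Sum>w\<in>label_cell i. ?G w) = real (label_alloc k r i) * Q * M" if i: "i < L" for i
  proof -
    have "(\<Sum>w\<in>label_cell i. ?G w) = real (label_alloc k r i) * real (\<Sum>s\<in>S. cost_alloc k r i s) * real M"
      using i by (simp add: sum_label_cell sum_cell_weight sum_distrib_left sum_distrib_right)
    then show ?thesis
      using sum_cost_alloc[OF i] alloc(2)[OF i] by (cases "label_ok k r i") (auto simp: lab_hi_def)
  qed
  \<comment> \<open>The three factors normalise the label probabilities, the conditional
    probabilities of costs and the class sizes.\<close>
  have W: "?W = real Q * real Q * real M"
  proof -
    have "?W = (\<Sum>w\<in>I. ?G w)" by (simp add: sample_count_def total_init)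
    also have "\<dots> = (\<Sum>i<L. real (label_alloc k r i) * Q * M)" by (simp add: sum_I sum_label)
    also have "\<dots> = real (\<Sum>i<L. label_alloc k r i) * Q * M" by (simp add: sum_distrib_right)
    finally show ?thesis by (simp add: sum_alloc)
  qed
  have "0 < ?W" unfolding W using Q_pos M_pos by simp
  then show pos: "0 < sample_count k r" by simp
  let ?D = "sample_pmf k r"
  note pmf = pmf_sample_pmf[OF pos]
  have pmf_I: "pmf ?D w = ?G w / ?W" if "w \<in> I" for w using that by (simp add: pmf)
  have mass: "mass ?D i = real (label_alloc k r i) / Q" if i: "i < L" for i
  proof -
    have "mass ?D i = (\<Sum>w\<in>label_cell i. ?G w / ?W)"
      unfolding mass_def by (rule sum.cong) (auto simp: label_cell_def pmf_I)
    also have "\<dots> = real (label_alloc k r i) * Q * M / ?W"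
      by (simp only: sum_divide_distrib[symmetric] sum_label[OF i])
    finally show ?thesis using Q_pos M_pos by (simp add: W)
  qed
  show "improvising k (lqci_of k r) ?D"
    unfolding improvising_iff
  proof (intro conjI allI impI ballI)
    show "set_pmf ?D \<subseteq> I"
      by (auto simp: set_pmf_iff pmf split: if_splits)
    have "(\<Sum>w\<in>cell i s. real_of_int (cost_of r w) * pmf ?D w)
        = real_of_int s * (real (label_alloc k r i) * real (cost_alloc k r i s) * M) / ?W"
      if "i < L" "s \<in> S" for i s
    proof -
      have "(\<Sum>w\<in>cell i s. real_of_int (cost_of r w) * pmf ?D w) = (\<Sum>w\<in>cell i s. real_of_int s * ?G w / ?W)"
        by (rule sum.cong) (auto simp: cell_def pmf_I)
      also have "\<dots> = real_of_int s * (\<Sum>w\<in>cell i s. ?G w) / ?W"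
        by (simp add: sum_distrib_left sum_divide_distrib)
      finally show ?thesis by (simp only: sum_cell_weight[OF that])
    qed
    then have "(\<Sum>w\<in>I. real_of_int (cost_of r w) * pmf ?D w)
        = (\<Sum>i<L. \<Sum>s\<in>S. real_of_int s * (real (label_alloc k r i) * real (cost_alloc k r i s) * M) / ?W)"
      by (simp add: sum_I sum_label_cell)
    also have "\<dots> = (\<Sum>i<L. real_of_int (label_cost k r i) * real (label_alloc k r i)) * M / ?W"
      by (simp add: label_cost_def sum_distrib_left sum_distrib_right sum_divide_distrib mult_ac)
    also have "\<dots> = (\<Sum>i<L. real_of_int (label_cost k r i) * real (label_alloc k r i)) / (Q * Q)"
      using M_pos by (simp add: W)
    also have "\<dots> \<le> of_rat (cost_bound par)"
    proof -
      define a d where "a = fst (quotient_of (cost_bound par))" and "d = snd (quotient_of (cost_bound par))"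
      have d: "0 < d" unfolding d_def by (rule quotient_of_denom_pos')
      have "d * (\<Sum>i<L. label_cost k r i * int (label_alloc k r i)) \<le> a * (int Q * int Q)"
        using solvable by (simp add: solvable_def a_def d_def)
      then have "real_of_int (d * (\<Sum>i<L. label_cost k r i * int (label_alloc k r i))) \<le> real_of_int (a * (int Q * int Q))"
        by (simp only: of_int_le_iff)
      then show ?thesis
        using d Q_pos by (simp add: of_rat_quotient a_def[symmetric] d_def[symmetric] field_simps)
    qed
    finally show "(\<Sum>w\<in>I. real_of_int (cost_of r w) * pmf ?D w) \<le> of_rat (cost_bound par)" .
  next
    fix i assume i: "i < L"
    have "real (lab_lo r) \<le> real (label_alloc k r i)" using alloc(1)[OF i] by simp
    then show "of_rat (label_lo par) \<le> mass ?D i"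
      using Q_pos by (simp add: mass[OF i] lab_lo_def scaled_label_lo pos_le_divide_eq)
    have "label_alloc k r i \<le> scaled r (label_hi par)"
      using alloc(2)[OF i] by (simp add: lab_hi_def split: if_splits)
    then have "real (label_alloc k r i) \<le> of_rat (label_hi par) * Q"
      unfolding scaled_label_hi[symmetric] by simp
    then show "mass ?D i \<le> of_rat (label_hi par)"
      using Q_pos by (simp add: mass[OF i] pos_divide_le_eq)
    fix w assume w: "w \<in> label_cell i"
    define s where "s = cost_of r w"
    have wI: "w \<in> I" and cell: "w \<in> cell i s" using w by (auto simp: label_cell_def cell_def s_def)
    have s: "s \<in> S" unfolding s_def by (rule cost_in_cost_set[OF wI])
    define N where "N = real (iclass_count k r i s)"
    have "iclass_count k r i s \<noteq> 0"
      using cell finite_cells(2)[of i s] by (auto simp: card_cell[symmetric])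
    then have N: "0 < N" by (simp add: N_def)
    have "real (iclass_count k r i s * class_weight k r i s) = real (label_alloc k r i * cost_alloc k r i s * M)"
      by (simp only: class_count_mult_weight[OF i s])
    then have "?G w = real (label_alloc k r i) * real (cost_alloc k r i s) * M / N"
      using N by (simp add: word_weight_cell[OF i cell] N_def[symmetric] field_simps)
    \<comment> \<open>Given the label, the word has one of \<open>N\<close> equal shares of
      \<open>cost_alloc / Q\<close>. This lies within the bounds because \<open>cost_lo\<close> and
      \<open>cost_hi\<close> contain the factor \<open>N\<close>.\<close>
    then have pmf_w: "pmf ?D w = mass ?D i * (real (cost_alloc k r i s) / (Q * N))"
      using M_pos by (simp add: pmf_I[OF wI] W mass[OF i])
    have mass_nonneg: "0 \<le> mass ?D i" by (simp add: mass[OF i])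
    have "real (cost_lo k r i s) \<le> real (cost_alloc k r i s)" "real (cost_alloc k r i s) \<le> real (cost_hi k r i s)"
      using cost_alloc_bounds[OF i] by simp_all
    then have "of_rat (cond_lo par ! i) \<le> real (cost_alloc k r i s) / (Q * N)"
      "real (cost_alloc k r i s) / (Q * N) \<le> of_rat (cond_hi par ! i)"
      using N Q_pos i by (simp_all add: cost_lo_def cost_hi_def scaled_cond_lo scaled_cond_hi N_def[symmetric]
          pos_le_divide_eq pos_divide_le_eq mult.assoc)
    then show "of_rat (cond_lo par ! i) * mass ?D i \<le> pmf ?D w" "pmf ?D w \<le> of_rat (cond_hi par ! i) * mass ?D i"
      unfolding pmf_w using mass_nonneg by (metis mult.commute mult_left_mono)+
  qed
qed

lemma feasible_iff_solvable: "feasible k (lqci_of k r) \<longleftrightarrow> solvable k r"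
  unfolding feasible_def using solvable_if_improvising improvising_sample_pmf(2) by blast

end

section \<open>Solving instances in polynomial time\<close>

subsection \<open>Access to the instance\<close>

abbreviation nv :: "nat \<Rightarrow> val" where
  "nv n \<equiv> IntV (int n)"

abbreviation conf_val :: "conf \<Rightarrow> val" where
  "conf_val \<equiv> pair_val nv (pair_val nv (pair_val nv IntV))"

text \<open>Bundles what computations on instances rely on: the encoding is available, the instance
  is valid, and \<open>\<mu>\<close> covers the magnitudes of the costs.\<close>

definition given ::
  "nat \<Rightarrow> 'a set \<Rightarrow> ('a \<Rightarrow> nat) \<Rightarrow> ('a \<Rightarrow> val) list \<Rightarrow> ('a \<Rightarrow> dfa_lqci) \<Rightarrow> bool" where
  "given k X \<mu> \<Gamma> r \<longleftrightarrow> ptime X \<mu> \<Gamma> (\<lambda>x. dfa_lqci_val (r x)) \<and>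
     (\<forall>x\<in>X. r x \<in> dfa_instances k \<and> cost_magnitude (r x) \<le> \<mu> x)"

lemma given_instance: "given k X \<mu> \<Gamma> r \<Longrightarrow> x \<in> X \<Longrightarrow> r x \<in> dfa_instances k"
  by (simp add: given_def)

lemma given_lift:
  assumes "given k X \<mu> \<Gamma> r" "\<And>y. y \<in> Y \<Longrightarrow> fst y \<in> X"
  shows "given k Y (\<lambda>y. \<mu> (fst y)) (v # lift \<Gamma>) (\<lambda>y. r (fst y))"
  using assms unfolding given_def by (auto intro: ptime_lift)

lemma given_lift2:
  assumes "given k X \<mu> \<Gamma> r" "\<And>y. y \<in> Y \<Longrightarrow> fst y \<in> X"
  shows "given k Y (\<lambda>y. \<mu> (fst y)) (u # v # lift \<Gamma>) (\<lambda>y. r (fst y))"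
  using assms unfolding given_def by (auto intro: ptime_lift2)

lemma nat_val_eq: "nat_val = nv"
  by (rule ext) (simp add: nat_val_def)

context
  fixes X :: "'a set" and \<mu> :: "'a \<Rightarrow> nat" and \<Gamma> :: "('a \<Rightarrow> val) list" and M :: "'a \<Rightarrow> 'b dfa"
    and f :: "'b \<Rightarrow> val"
  assumes M: "ptime X \<mu> \<Gamma> (\<lambda>x. dfa_val f (M x))"
begin

lemma ptime_init: "ptime X \<mu> \<Gamma> (\<lambda>x. nv (init (M x)))"
  using M unfolding dfa_val_def by (rule ptime_component[where i = 0]) (auto simp: nat_val_def)

lemma ptime_trans_list: "ptime X \<mu> \<Gamma> (\<lambda>x. ListV (map (\<lambda>row. ListV (map nv row)) (trans (M x))))"
  using M unfolding dfa_val_def nat_val_eq by (rule ptime_component[where i = 1]) auto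

lemma ptime_ann_list: "ptime X \<mu> \<Gamma> (\<lambda>x. ListV (map f (ann (M x))))"
  using M unfolding dfa_val_def by (rule ptime_component[where i = 2]) auto

lemma ptime_trans:
  assumes "ptime X \<mu> \<Gamma> (\<lambda>x. nv (q x))" "ptime X \<mu> \<Gamma> (\<lambda>x. nv (a x))"
    "\<And>x. x \<in> X \<Longrightarrow> valid_dfa k (M x)" "\<And>x. x \<in> X \<Longrightarrow> q x < length (trans (M x))"
    "\<And>x. x \<in> X \<Longrightarrow> a x < k"
  shows "ptime X \<mu> \<Gamma> (\<lambda>x. nv (trans (M x) ! q x ! a x))"
proof (rule ptime_nth_map[OF ptime_nth_map[OF ptime_trans_list assms(1)] assms(2)])
  fix x assume x: "x \<in> X"
  then have "trans (M x) ! q x \<in> set (trans (M x))" using assms(4) by simp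
  then show "a x < length (trans (M x) ! q x)"
    using assms(3,5)[OF x] by (auto simp: valid_dfa_def)
qed (rule assms)

lemma ptime_ann:
  assumes "ptime X \<mu> \<Gamma> (\<lambda>x. nv (q x))"
    "\<And>x. x \<in> X \<Longrightarrow> valid_dfa k (M x)" "\<And>x. x \<in> X \<Longrightarrow> q x < length (trans (M x))"
  shows "ptime X \<mu> \<Gamma> (\<lambda>x. f (ann (M x) ! q x))"
  by (rule ptime_nth_map[OF ptime_ann_list assms(1)]) (use assms(2,3) in \<open>auto simp: valid_dfa_def\<close>)

lemma ptime_states: "ptime X \<mu> \<Gamma> (\<lambda>x. ListV (map nv [0..<length (trans (M x))]))"
proof (rule ptime_upt)
  show "ptime X \<mu> \<Gamma> (\<lambda>x. nv (length (trans (M x))))"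
    using ptime_length[OF ptime_trans_list] by simp
  show "pbounded X (csize \<mu> \<Gamma>) (\<lambda>x. length (trans (M x)))"
  proof (rule pbounded_mono[OF ptime_pbounded[OF ptime_trans_list]])
    show "length (trans (M x)) \<le> vsize (ListV (map (\<lambda>row. ListV (map nv row)) (trans (M x))))" for x
      using length_le_vsize[of "map (\<lambda>row. ListV (map nv row)) (trans (M x))"] by simp
  qed
qed

end

context
  fixes k :: nat and X :: "'a set" and \<mu> :: "'a \<Rightarrow> nat" and \<Gamma> :: "('a \<Rightarrow> val) list" and r :: "'a \<Rightarrow> dfa_lqci"
  assumes r: "given k X \<mu> \<Gamma> r"
begin

lemma given_val: "ptime X \<mu> \<Gamma> (\<lambda>x. dfa_lqci_val (r x))"
  using r by (simp add: given_def)

lemma ptime_hard_dfa: "ptime X \<mu> \<Gamma> (\<lambda>x. dfa_val of_truth (hard_dfa (r x)))"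
  using given_val unfolding dfa_lqci_val_def by (rule ptime_component[where i = 0]) auto

lemma ptime_cost_dfa: "ptime X \<mu> \<Gamma> (\<lambda>x. dfa_val IntV (cost_dfa (r x)))"
  using given_val unfolding dfa_lqci_val_def by (rule ptime_component[where i = 1]) auto

lemma ptime_label_dfa: "ptime X \<mu> \<Gamma> (\<lambda>x. dfa_val IntV (label_dfa (r x)))"
  using given_val unfolding dfa_lqci_val_def by (rule ptime_component[where i = 2]) auto

lemma ptime_params: "ptime X \<mu> \<Gamma> (\<lambda>x. params_val (dfa_params (r x)))"
  using given_val unfolding dfa_lqci_val_def by (rule ptime_component[where i = 3]) auto

lemma ptime_min_len: "ptime X \<mu> \<Gamma> (\<lambda>x. nv (min_len (dfa_params (r x))))"
proof -
  have "ptime X \<mu> \<Gamma> (\<lambda>x. ListV (replicate (min_len (dfa_params (r x))) (IntV 0)))"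
    using ptime_params unfolding params_val_def unary_val_def by (rule ptime_component[where i = 0]) auto
  from ptime_length[OF this] show ?thesis by simp
qed

lemma ptime_max_len_list: "ptime X \<mu> \<Gamma> (\<lambda>x. ListV (replicate (max_len (dfa_params (r x))) (IntV 0)))"
  using ptime_params unfolding params_val_def unary_val_def by (rule ptime_component[where i = 1]) auto

lemma ptime_max_len: "ptime X \<mu> \<Gamma> (\<lambda>x. nv (max_len (dfa_params (r x))))"
  using ptime_length[OF ptime_max_len_list] by simp

lemma pbounded_max_len: "pbounded X (csize \<mu> \<Gamma>) (\<lambda>x. max_len (dfa_params (r x)))"
proof (rule pbounded_mono[OF ptime_pbounded[OF ptime_max_len_list]])
  show "max_len (dfa_params (r x)) \<le> vsize (ListV (replicate (max_len (dfa_params (r x))) (IntV 0)))" for x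
    using length_le_vsize[of "replicate (max_len (dfa_params (r x))) (IntV 0)"] by simp
qed

lemma ptime_labels: "ptime X \<mu> \<Gamma> (\<lambda>x. ListV (map IntV (labels (dfa_params (r x)))))"
  using ptime_params unfolding params_val_def by (rule ptime_component[where i = 2]) auto

lemma ptime_cost_bound: "ptime X \<mu> \<Gamma> (\<lambda>x. rat_val (cost_bound (dfa_params (r x))))"
  using ptime_params unfolding params_val_def by (rule ptime_component[where i = 3]) auto

lemma ptime_label_lo: "ptime X \<mu> \<Gamma> (\<lambda>x. rat_val (label_lo (dfa_params (r x))))"
  using ptime_params unfolding params_val_def by (rule ptime_component[where i = 4]) auto

lemma ptime_label_hi: "ptime X \<mu> \<Gamma> (\<lambda>x. rat_val (label_hi (dfa_params (r x))))"
  using ptime_params unfolding params_val_def by (rule ptime_component[where i = 5]) auto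

lemma ptime_cond_lo: "ptime X \<mu> \<Gamma> (\<lambda>x. ListV (map rat_val (cond_lo (dfa_params (r x)))))"
  using ptime_params unfolding params_val_def by (rule ptime_component[where i = 6]) auto

lemma ptime_cond_hi: "ptime X \<mu> \<Gamma> (\<lambda>x. ListV (map rat_val (cond_hi (dfa_params (r x)))))"
  using ptime_params unfolding params_val_def by (rule ptime_component[where i = 7]) auto

lemma ptime_cost_range: "ptime X \<mu> \<Gamma> (\<lambda>x. nv (cost_range (r x)))"
proof -
  have "ptime X \<mu> \<Gamma> (\<lambda>x. nv (\<Sum>z\<leftarrow>ann (cost_dfa (r x)). nat \<bar>z\<bar>))"
  proof (rule ptime_nat_sum_list_map[OF ptime_ann_list[OF ptime_cost_dfa]])
    let ?Y = "{y. fst y \<in> X \<and> snd y \<in> set (ann (cost_dfa (r (fst y))))}"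
    have z: "ptime Z (\<lambda>y. \<mu> (fst y)) ((\<lambda>y. IntV (snd y)) # lift \<Gamma>) (\<lambda>y. IntV (snd y))" for Z
      by (rule ptime_head)
    show "ptime ?Y (\<lambda>y. \<mu> (fst y)) ((\<lambda>y. IntV (snd y)) # lift \<Gamma>) (\<lambda>y. nv (nat \<bar>snd y\<bar>))"
      by (rule ptime_cong[OF ptime_if[OF ptime_less[OF z ptime_const[of _ _ _ "IntV 0"]]
            ptime_sub[OF ptime_const[of _ _ _ "IntV 0"] z] z]]) auto
  qed
  then show ?thesis
    unfolding cost_range_def cost_magnitude_def
    by (intro ptime_nat_mult ptime_nat_add ptime_max_len ptime_const)
qed

text \<open>Here the unary measure \<open>\<mu>\<close> is used: the value of the range, not just
  its bit length, is polynomial. This keeps the tables small and makes the bound a pseudopolynomial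
  one.\<close>

lemma pbounded_cost_range: "pbounded X (csize \<mu> \<Gamma>) (\<lambda>x. cost_range (r x))"
proof -
  have "pbounded X (csize \<mu> \<Gamma>) (\<lambda>x. cost_magnitude (r x))"
    by (rule pbounded_mono[OF pbounded_self]) (use r in \<open>auto simp: given_def csize_def intro: trans_le_add1\<close>)
  then show ?thesis unfolding cost_range_def
    by (intro pbounded_mult pbounded_add pbounded_const pbounded_max_len)
qed

lemma ptime_cost_list: "ptime X \<mu> \<Gamma> (\<lambda>x. ListV (map IntV [- int (cost_range (r x))..int (cost_range (r x))]))"
  by (rule ptime_upto_symmetric[OF ptime_cost_range pbounded_cost_range])

end

subsection \<open>Dynamic programming\<close>

definition conf_list :: "dfa_lqci \<Rightarrow> conf list" where
  "conf_list r = List.product [0..<length (trans (hard_dfa r))]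
     (List.product [0..<length (trans (cost_dfa r))]
       (List.product [0..<length (trans (label_dfa r))] [- int (cost_range r)..int (cost_range r)]))"

definition valid_conf :: "dfa_lqci \<Rightarrow> conf \<Rightarrow> bool" where
  "valid_conf r c \<longleftrightarrow> fst c < length (trans (hard_dfa r)) \<and> fst (snd c) < length (trans (cost_dfa r)) \<and>
     fst (snd (snd c)) < length (trans (label_dfa r))"

lemma set_conf_list: "c \<in> set (conf_list r) \<longleftrightarrow> valid_conf r c \<and> \<bar>snd (snd (snd c))\<bar> \<le> int (cost_range r)"
  by (cases c) (auto simp: conf_list_def valid_conf_def)

lemma distinct_conf_list: "distinct (conf_list r)"
  by (simp add: conf_list_def distinct_product)

text \<open>The language compares encodings, so injectivity is needed to test equality of
  configurations.\<close>

lemma conf_val_inject: "conf_val c = conf_val c' \<longleftrightarrow> c = c'"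
  by (cases c; cases c') (simp add: pair_val_def)

text \<open>A sum in place of a search: with distinct keys at most one summand is nonzero, missing
  keys give 0, and the rule for sums makes it computable.\<close>

definition lookup :: "(conf \<times> nat) list \<Rightarrow> conf \<Rightarrow> nat" where
  "lookup t c = (\<Sum>z\<leftarrow>t. if fst z = c then snd z else 0)"

lemma lookup_map:
  assumes "distinct cs"
  shows "lookup (map (\<lambda>c. (c, f c)) cs) c = (if c \<in> set cs then f c else 0)"
proof -
  have "lookup (map (\<lambda>c. (c, f c)) cs) c = (\<Sum>c'\<in>set cs. if c' = c then f c' else 0)"
    using assms by (simp add: lookup_def o_def sum_list_distinct_conv_sum_set)
  then show ?thesis by (simp add: sum.delta')
qed

text \<open>Costs outside the range covered by the tables count as unreachable.\<close>

definition table_step :: "nat \<Rightarrow> dfa_lqci \<Rightarrow> (int \<Rightarrow> int \<Rightarrow> nat) \<Rightarrow> nat \<Rightarrow> (conf \<times> nat) list \<Rightarrow> (conf \<times> nat) list" where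
  "table_step k r G j t = map (\<lambda>c. (c, conf_weight r G (Suc j) c +
     (\<Sum>a\<leftarrow>[0..<k]. lookup t (conf_step r c a)))) (conf_list r)"

definition table_init :: "dfa_lqci \<Rightarrow> (int \<Rightarrow> int \<Rightarrow> nat) \<Rightarrow> (conf \<times> nat) list" where
  "table_init r G = map (\<lambda>c. (c, conf_weight r G 0 c)) (conf_list r)"

definition table :: "nat \<Rightarrow> dfa_lqci \<Rightarrow> (int \<Rightarrow> int \<Rightarrow> nat) \<Rightarrow> nat \<Rightarrow> (conf \<times> nat) list" where
  "table k r G j = fold (table_step k r G) [0..<j] (table_init r G)"

text \<open>The exact content of the tables; it can differ from \<open>total\<close> only where the
  cost may still leave the range.\<close>

primrec range_total :: "nat \<Rightarrow> dfa_lqci \<Rightarrow> (int \<Rightarrow> int \<Rightarrow> nat) \<Rightarrow> nat \<Rightarrow> conf \<Rightarrow> nat" where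
  "range_total k r G 0 c = conf_weight r G 0 c"
| "range_total k r G (Suc j) c = conf_weight r G (Suc j) c +
     (\<Sum>a\<leftarrow>[0..<k]. if conf_step r c a \<in> set (conf_list r) then range_total k r G j (conf_step r c a) else 0)"

lemma table_eq: "table k r G j = map (\<lambda>c. (c, range_total k r G j c)) (conf_list r)"
proof (induction j)
  case (Suc j)
  then show ?case
    by (simp add: table_def table_step_def lookup_map distinct_conf_list)
qed (simp add: table_def table_init_def)

lemma valid_conf_step:
  assumes "r \<in> dfa_instances k" "valid_conf r c" "a < k"
  shows "valid_conf r (conf_step r c a)"
    and "\<bar>snd (snd (snd (conf_step r c a)))\<bar> \<le> \<bar>snd (snd (snd c))\<bar> + int (cost_magnitude r)"
proof -
  have next_less: "trans M ! q ! a < length (trans M)" if "valid_dfa k M" "q < length (trans M)" for M :: "'b dfa" and q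
  proof -
    have "trans M ! q \<in> set (trans M)" using that by simp
    then have "length (trans M ! q) = k" "\<forall>p\<in>set (trans M ! q). p < length (trans M)"
      using that unfolding valid_dfa_def by blast+
    then show ?thesis using assms(3) by simp
  qed
  have v: "valid_dfa k (hard_dfa r)" "valid_dfa k (cost_dfa r)" "valid_dfa k (label_dfa r)"
    using assms(1) by (auto simp: dfa_instances_def)
  show "valid_conf r (conf_step r c a)"
    using assms(2) v by (auto simp: valid_conf_def conf_step_def next_less)
  have "trans (cost_dfa r) ! fst (snd c) ! a < length (ann (cost_dfa r))"
    using next_less[OF v(2)] assms(2) v(2) by (simp add: valid_conf_def valid_dfa_def)
  from cost_le_magnitude[OF this]
  show "\<bar>snd (snd (snd (conf_step r c a)))\<bar> \<le> \<bar>snd (snd (snd c))\<bar> + int (cost_magnitude r)"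
    by (simp add: conf_step_def)
qed

text \<open>The cost is so far from the ends of the range that \<open>j\<close> more steps cannot
  leave it; there the truncation of the tables has no effect.\<close>

definition conf_inside :: "dfa_lqci \<Rightarrow> nat \<Rightarrow> conf \<Rightarrow> bool" where
  "conf_inside r j c \<longleftrightarrow> valid_conf r c \<and>
     \<bar>snd (snd (snd c))\<bar> + int j * int (cost_magnitude r) \<le> int (cost_range r)"

lemma conf_inside_step:
  assumes "r \<in> dfa_instances k" "conf_inside r (Suc j) c" "a < k"
  shows "conf_inside r j (conf_step r c a)"
  using valid_conf_step[OF assms(1) _ assms(3), of c] assms(2)
  by (auto simp: conf_inside_def algebra_simps)

lemma conf_inside_mem: "conf_inside r j c \<Longrightarrow> c \<in> set (conf_list r)"
  unfolding conf_inside_def set_conf_list by (smt (verit) mult_nonneg_nonneg of_nat_0_le_iff)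

lemma range_total_eq:
  assumes "r \<in> dfa_instances k"
  shows "conf_inside r j c \<Longrightarrow> range_total k r G j c = total k r G j c"
proof (induction j arbitrary: c)
  case (Suc j)
  have inside: "conf_inside r j (conf_step r c a)" if "a < k" for a
    using conf_inside_step[OF assms Suc.prems that] .
  have "(\<Sum>a\<leftarrow>[0..<k]. if conf_step r c a \<in> set (conf_list r) then range_total k r G j (conf_step r c a) else 0)
      = (\<Sum>a\<leftarrow>[0..<k]. total k r G j (conf_step r c a))"
  proof (intro arg_cong[where f = sum_list] map_cong refl)
    fix a assume "a \<in> set [0..<k]"
    then have "conf_inside r j (conf_step r c a)" by (intro inside) simp
    then show "(if conf_step r c a \<in> set (conf_list r) then range_total k r G j (conf_step r c a) else 0)
        = total k r G j (conf_step r c a)"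
      using conf_inside_mem Suc.IH by simp
  qed
  then show ?case by simp
qed simp

text \<open>The factor \<open>max_len + 1\<close> in \<open>cost_range\<close> is what is needed:
  one magnitude for the initial state and \<open>max_len\<close> for the steps.\<close>

lemma conf_inside_init:
  assumes "r \<in> dfa_instances k"
  shows "conf_inside r (max_len (dfa_params r)) (conf_init r)"
proof -
  have v: "valid_dfa k (hard_dfa r)" "valid_dfa k (cost_dfa r)" "valid_dfa k (label_dfa r)"
    using assms by (auto simp: dfa_instances_def)
  then have "\<bar>ann (cost_dfa r) ! init (cost_dfa r)\<bar> \<le> int (cost_magnitude r)"
    by (intro cost_le_magnitude) (simp add: valid_dfa_def)
  with v show ?thesis
    by (simp add: conf_inside_def valid_conf_def conf_init_def valid_dfa_def cost_range_def algebra_simps)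
qed

text \<open>At each level a word may end or continue with one of \<open>k\<close> letters, so the
  bit length grows only linearly in \<open>j\<close>.\<close>

lemma range_total_bound:
  assumes "\<And>j' c. j' \<le> j \<Longrightarrow> c \<in> set (conf_list r) \<Longrightarrow> conf_weight r G j' c \<le> b"
  shows "c \<in> set (conf_list r) \<Longrightarrow> range_total k r G j c \<le> b * (k + 1) ^ j"
  using assms
proof (induction j arbitrary: c)
  case (Suc j)
  let ?f = "\<lambda>a. if conf_step r c a \<in> set (conf_list r) then range_total k r G j (conf_step r c a) else 0"
  have "?f a \<le> b * (k + 1) ^ j" for a
    using Suc.IH[of "conf_step r c a"] Suc.prems(2) by simp
  then have "(\<Sum>a\<leftarrow>[0..<k]. ?f a) \<le> (\<Sum>a\<leftarrow>[0..<k]. b * (k + 1) ^ j)"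
    by (intro sum_list_mono)
  also have "\<dots> = k * (b * (k + 1) ^ j)" by (simp add: sum_list_triv)
  finally have "range_total k r G (Suc j) c \<le> b * 1 + k * (b * (k + 1) ^ j)"
    using Suc.prems(2)[of "Suc j" c] Suc.prems(1) by simp
  also have "\<dots> \<le> b * (k + 1) ^ j + k * (b * (k + 1) ^ j)"
    by (intro add_mono mult_left_mono) auto
  finally show ?case by (simp add: algebra_simps)
qed simp

text \<open>Weight functions are parameters, represented by a program for their value on a pair;
  here such a program is applied to computed arguments.\<close>

lemma ptime_apply_int2:
  assumes G: "ptime {y. fst y \<in> X} (\<lambda>y. \<mu> (fst y)) ((\<lambda>y. pair_val IntV IntV (snd y)) # lift \<Gamma>)
      (\<lambda>y. nv (G (fst y) (fst (snd y)) (snd (snd y))))"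
    and l: "ptime X \<mu> \<Gamma> (\<lambda>x. IntV (l x))" and s: "ptime X \<mu> \<Gamma> (\<lambda>x. IntV (s x))"
  shows "ptime X \<mu> \<Gamma> (\<lambda>x. nv (G x (l x) (s x)))"
proof -
  let ?h = "\<lambda>x. (x, (l x, s x))"
  have "ptime X \<mu> (map (\<lambda>g y. g (?h y)) ((\<lambda>y. pair_val IntV IntV (snd y)) # lift \<Gamma>))
      (\<lambda>x. nv (G (fst (?h x)) (fst (snd (?h x))) (snd (snd (?h x)))))"
    by (rule ptime_reindex[OF G]) auto
  then show ?thesis unfolding fst_conv snd_conv
  proof (rule ptime_subst)
    fix g assume "g \<in> set (map (\<lambda>g y. g (?h y)) ((\<lambda>y. pair_val IntV IntV (snd y)) # lift \<Gamma>))"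
    then have "g = (\<lambda>x. pair_val IntV IntV (l x, s x)) \<or> g \<in> set \<Gamma>" by auto
    then show "ptime X \<mu> \<Gamma> g"
      by (auto intro: ptime_var ptime_pair l s)
  qed
qed

lemma ptime_lookup:
  assumes t: "ptime X \<mu> \<Gamma> (\<lambda>x. ListV (map (pair_val conf_val nv) (t x)))"
    and c: "ptime X \<mu> \<Gamma> (\<lambda>x. conf_val (c x))"
  shows "ptime X \<mu> \<Gamma> (\<lambda>x. nv (lookup (t x) (c x)))"
  unfolding lookup_def
proof (rule ptime_nat_sum_list_map[OF t], rule ptime_nat_if)
  let ?Y = "{y. fst y \<in> X \<and> snd y \<in> set (t (fst y))}" and ?G = "(\<lambda>y. pair_val conf_val nv (snd y)) # lift \<Gamma>"
  have "ptime ?Y (\<lambda>y. \<mu> (fst y)) ?G (\<lambda>y. of_truth (conf_val (fst (snd y)) = conf_val (c (fst y))))"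
    by (intro ptime_eq ptime_fst[OF ptime_head] ptime_lift[OF c]) simp
  then show "ptime ?Y (\<lambda>y. \<mu> (fst y)) ?G (\<lambda>y. of_truth (fst (snd y) = c (fst y)))"
    by (simp only: conf_val_inject)
qed (rule ptime_snd[OF ptime_head] ptime_const)+

lemma ptime_conf_list:
  assumes r: "given k X \<mu> \<Gamma> r"
  shows "ptime X \<mu> \<Gamma> (\<lambda>x. ListV (map conf_val (conf_list (r x))))"
  unfolding conf_list_def
  by (intro ptime_product ptime_states ptime_cost_list[OF r])
     (rule ptime_hard_dfa[OF r] ptime_cost_dfa[OF r] ptime_label_dfa[OF r])+

lemma ptime_conf_init:
  assumes r: "given k X \<mu> \<Gamma> r"
  shows "ptime X \<mu> \<Gamma> (\<lambda>x. conf_val (conf_init (r x)))"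
  unfolding conf_init_def
  by (intro ptime_pair ptime_init[OF ptime_hard_dfa[OF r]] ptime_init[OF ptime_cost_dfa[OF r]]
      ptime_init[OF ptime_label_dfa[OF r]] ptime_ann[OF ptime_cost_dfa[OF r], of _ k])
     (use given_instance[OF r] in \<open>auto simp: dfa_instances_def valid_dfa_def\<close>)

lemma ptime_conf_step:
  assumes r: "given k X \<mu> \<Gamma> r" and c: "ptime X \<mu> \<Gamma> (\<lambda>x. conf_val (c x))" and a: "ptime X \<mu> \<Gamma> (\<lambda>x. nv (a x))"
    and valid: "\<And>x. x \<in> X \<Longrightarrow> valid_conf (r x) (c x)" "\<And>x. x \<in> X \<Longrightarrow> a x < k"
  shows "ptime X \<mu> \<Gamma> (\<lambda>x. conf_val (conf_step (r x) (c x) (a x)))"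
proof -
  have v: "valid_dfa k (hard_dfa (r x))" "valid_dfa k (cost_dfa (r x))" "valid_dfa k (label_dfa (r x))" if "x \<in> X" for x
    using given_instance[OF r that] by (auto simp: dfa_instances_def)
  have q: "fst (c x) < length (trans (hard_dfa (r x)))" "fst (snd (c x)) < length (trans (cost_dfa (r x)))"
    "fst (snd (snd (c x))) < length (trans (label_dfa (r x)))" if "x \<in> X" for x
    using valid(1)[OF that] by (auto simp: valid_conf_def)
  have q2: "trans (cost_dfa (r x)) ! fst (snd (c x)) ! a x < length (trans (cost_dfa (r x)))" if "x \<in> X" for x
    using valid_conf_step(1)[OF given_instance[OF r that] valid(1)[OF that] valid(2)[OF that]]
    by (simp add: valid_conf_def conf_step_def)
  have p: "ptime X \<mu> \<Gamma> (\<lambda>x. nv (trans (cost_dfa (r x)) ! fst (snd (c x)) ! a x))"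
    by (rule ptime_trans[OF ptime_cost_dfa[OF r] ptime_fst[OF ptime_snd[OF c]] a v(2) q(2) valid(2)])
  show ?thesis
    unfolding conf_step_def
    by (intro ptime_pair p ptime_add ptime_snd[OF ptime_snd[OF ptime_snd[OF c]]]
        ptime_trans[OF ptime_hard_dfa[OF r] ptime_fst[OF c] a v(1) q(1) valid(2)]
        ptime_trans[OF ptime_label_dfa[OF r] ptime_fst[OF ptime_snd[OF ptime_snd[OF c]]] a v(3) q(3) valid(2)]
        ptime_ann[OF ptime_cost_dfa[OF r] p v(2) q2])
qed

lemma ptime_conf_weight:
  assumes r: "given k X \<mu> \<Gamma> r"
    and G: "ptime {y. fst y \<in> X} (\<lambda>y. \<mu> (fst y)) ((\<lambda>y. pair_val IntV IntV (snd y)) # lift \<Gamma>)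
      (\<lambda>y. nv (G (fst y) (fst (snd y)) (snd (snd y))))"
    and j: "ptime X \<mu> \<Gamma> (\<lambda>x. nv (j x))" and c: "ptime X \<mu> \<Gamma> (\<lambda>x. conf_val (c x))"
    and valid: "\<And>x. x \<in> X \<Longrightarrow> valid_conf (r x) (c x)"
  shows "ptime X \<mu> \<Gamma> (\<lambda>x. nv (conf_weight (r x) (G x) (j x) (c x)))"
  unfolding conf_weight_def
proof (rule ptime_nat_if)
  have v: "valid_dfa k (hard_dfa (r x))" "valid_dfa k (label_dfa (r x))" if "x \<in> X" for x
    using given_instance[OF r that] by (auto simp: dfa_instances_def)
  have q: "fst (c x) < length (trans (hard_dfa (r x)))"
    "fst (snd (snd (c x))) < length (trans (label_dfa (r x)))" if "x \<in> X" for x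
    using valid(1)[OF that] by (auto simp: valid_conf_def)
  show "ptime X \<mu> \<Gamma> (\<lambda>x. of_truth (ann (hard_dfa (r x)) ! fst (c x) \<and>
      min_len (dfa_params (r x)) + j x \<le> max_len (dfa_params (r x))))"
    by (intro ptime_conj ptime_ann[OF ptime_hard_dfa[OF r] ptime_fst[OF c] v(1) q(1)]
        ptime_mono[OF ptime_nat_le[OF ptime_nat_add[OF ptime_min_len[OF r] j] ptime_max_len[OF r]]]) auto
  have "ptime X \<mu> \<Gamma> (\<lambda>x. nv (G x (ann (label_dfa (r x)) ! fst (snd (snd (c x)))) (snd (snd (snd (c x))))))"
    by (rule ptime_apply_int2[OF G ptime_ann[OF ptime_label_dfa[OF r] ptime_fst[OF ptime_snd[OF ptime_snd[OF c]]] v(2) q(2)]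
          ptime_snd[OF ptime_snd[OF ptime_snd[OF c]]]])
  then show "ptime {x \<in> X. ann (hard_dfa (r x)) ! fst (c x) \<and>
      min_len (dfa_params (r x)) + j x \<le> max_len (dfa_params (r x))} \<mu> \<Gamma>
      (\<lambda>x. nv (G x (ann (label_dfa (r x)) ! fst (snd (snd (c x)))) (snd (snd (snd (c x))))))"
    by (rule ptime_mono) simp
qed (rule ptime_const)

text \<open>Carries the program of a parameter function into the body of a loop, where the index has
  a further component and the context further entries.\<close>

lemma ptime_fun_lift:
  assumes G: "ptime {y. fst y \<in> X} (\<lambda>y. \<mu> (fst y)) ((\<lambda>y. e (snd y)) # lift \<Gamma>) (\<lambda>y. F (fst y) (snd y))"
    and Y: "\<And>y. y \<in> Y \<Longrightarrow> fst y \<in> X"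
    and \<Delta>: "set (lift \<Gamma>) \<subseteq> set \<Delta>"
  shows "ptime {z. fst z \<in> Y} (\<lambda>z. \<mu> (fst (fst z))) ((\<lambda>z. e (snd z)) # lift \<Delta>)
    (\<lambda>z. F (fst (fst z)) (snd z))"
proof -
  let ?h = "\<lambda>z. (fst (fst z), snd z)"
  have "ptime {z. fst z \<in> Y} (\<lambda>z. \<mu> (fst (fst z)))
      (map (\<lambda>g y. g (?h y)) ((\<lambda>y. e (snd y)) # lift \<Gamma>)) (\<lambda>z. F (fst (?h z)) (snd (?h z)))"
    by (rule ptime_reindex[OF G]) (use Y in auto)
  then show ?thesis unfolding fst_conv snd_conv
    by (rule ptime_weaken) (use \<Delta> in auto)
qed

lemma nat_less_vsize: "n < 2 ^ vsize (nv n)"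
proof -
  have "n < 2 ^ (vsize (nv n) - 1)" using abs_less_vsize[of "int n"] by simp
  also have "\<dots> \<le> (2::nat) ^ vsize (nv n)" by (rule power_increasing) auto
  finally show ?thesis .
qed

text \<open>That a single step takes polynomial time does not bound the iterated tables. Their
  entries are bounded by \<open>range_total\<close> instead, which adds at most about
  \<open>k * max_len\<close> bits to those of a weight.\<close>

lemma ptime_table:
  assumes r: "given k X \<mu> \<Gamma> r"
    and G: "ptime {y. fst y \<in> X} (\<lambda>y. \<mu> (fst y)) ((\<lambda>y. pair_val IntV IntV (snd y)) # lift \<Gamma>)
      (\<lambda>y. nv (G (fst y) (fst (snd y)) (snd (snd y))))"
    and j: "ptime X \<mu> \<Gamma> (\<lambda>x. nv (j x))" "\<And>x. x \<in> X \<Longrightarrow> j x \<le> max_len (dfa_params (r x))"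
  shows "ptime X \<mu> \<Gamma> (\<lambda>x. ListV (map (pair_val conf_val nv) (table k (r x) (G x) (j x))))"
proof -
  let ?e = "\<lambda>t. ListV (map (pair_val conf_val nv) t)"
  have G': "ptime {z. fst z \<in> Y} (\<lambda>z. \<mu> (fst (fst z))) ((\<lambda>z. pair_val IntV IntV (snd z)) # lift \<Delta>)
    (\<lambda>z. nv (G (fst (fst z)) (fst (snd z)) (snd (snd z))))"
    if "\<And>y. y \<in> Y \<Longrightarrow> fst y \<in> X" "set (lift \<Gamma>) \<subseteq> set \<Delta>" for Y :: "('a \<times> 'c) set" and \<Delta>
    using ptime_fun_lift[where F = "\<lambda>x z. nv (G x (fst z) (snd z))", OF G that] .
  define U where "U = (\<lambda>x. vsize (ListV (map conf_val (conf_list (r x)))))"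
  have U: "pbounded X (csize \<mu> \<Gamma>) U"
    unfolding U_def using ptime_conf_list[OF r] by (rule ptime_pbounded)
  have conf_le: "vsize (conf_val c) \<le> U x" if "c \<in> set (conf_list (r x))" for c x
    using vsize_mem[of "conf_val c" "map conf_val (conf_list (r x))"] that by (simp add: U_def del: vsize.simps)
  let ?n = "\<lambda>x. max_len (dfa_params (r x))"
  \<comment> \<open>The weights are computable in polynomial time, hence of polynomial bit length;
    \<open>d\<close> is one exponent for all levels and configurations.\<close>
  obtain d where d: "vsize (nv (conf_weight (r x) (G x) i c)) \<le> (5 + ?n x + U x + csize \<mu> \<Gamma> x) ^ d"
    if "x \<in> X" "i \<le> ?n x" "c \<in> set (conf_list (r x))" for x i c
  proof -
    let ?Y = "{y. fst y \<in> X \<and> fst (snd y) \<le> ?n (fst y) \<and> snd (snd y) \<in> set (conf_list (r (fst y)))}"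
    let ?G = "(\<lambda>y. pair_val nv conf_val (snd y)) # lift \<Gamma>"
    have "ptime ?Y (\<lambda>y. \<mu> (fst y)) ?G (\<lambda>y. nv (conf_weight (r (fst y)) (G (fst y)) (fst (snd y)) (snd (snd y))))"
      by (rule ptime_conf_weight[OF given_lift[OF r] G' ptime_fst[OF ptime_head] ptime_snd[OF ptime_head]])
        (auto simp: set_conf_list)
    from ptime_pbounded[OF this] obtain d where d: "\<forall>y\<in>?Y.
        vsize (nv (conf_weight (r (fst y)) (G (fst y)) (fst (snd y)) (snd (snd y)))) \<le>
        (vsize (pair_val nv conf_val (snd y)) + csize \<mu> \<Gamma> (fst y) + 2) ^ d"
      unfolding pbounded_def csize_Cons csize_lift by blast
    have "vsize (nv (conf_weight (r x) (G x) i c)) \<le> (5 + ?n x + U x + csize \<mu> \<Gamma> x) ^ d"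
      if "x \<in> X" "i \<le> ?n x" "c \<in> set (conf_list (r x))" for x i c
    proof -
      have "vsize (nv (conf_weight (r x) (G x) i c)) \<le> (vsize (pair_val nv conf_val (i, c)) + csize \<mu> \<Gamma> x + 2) ^ d"
        using bspec[OF d, of "(x, (i, c))"] that by (simp del: vsize.simps)
      also have "vsize (pair_val nv conf_val (i, c)) = 1 + vsize (nv i) + vsize (conf_val c)"
        by (simp add: pair_val_def)
      also have "(1 + vsize (nv i) + vsize (conf_val c) + csize \<mu> \<Gamma> x + 2) ^ d \<le> (5 + ?n x + U x + csize \<mu> \<Gamma> x) ^ d"
        using vsize_IntV_le[of "int i"] that(2) conf_le[OF that(3)] by (intro power_mono) auto
      finally show ?thesis .
    qed
    then show ?thesis by (rule that)
  qed
  define b where "b = (\<lambda>x. (5 + ?n x + U x + csize \<mu> \<Gamma> x) ^ d)"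
  define B where "B = (\<lambda>x. 1 + U x * (1 + U x + (2 + b x + k * ?n x)))"
  have b: "pbounded X (csize \<mu> \<Gamma>) b"
    unfolding b_def by (intro pbounded_power pbounded_add pbounded_const pbounded_self U pbounded_max_len[OF r])
  have total_le: "vsize (nv (range_total k (r x) (G x) i c)) \<le> 2 + b x + k * ?n x"
    if "x \<in> X" "i \<le> ?n x" "c \<in> set (conf_list (r x))" for x i c
  proof -
    have "range_total k (r x) (G x) i c \<le> 2 ^ b x * (k + 1) ^ i"
    proof (rule range_total_bound)
      fix i' c assume "i' \<le> i" "c \<in> set (conf_list (r x))"
      then have le: "vsize (nv (conf_weight (r x) (G x) i' c)) \<le> b x"
        unfolding b_def by (intro d that(1) order.trans[OF _ that(2)])
      have "conf_weight (r x) (G x) i' c \<le> 2 ^ vsize (nv (conf_weight (r x) (G x) i' c))"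
        using nat_less_vsize by (rule less_imp_le)
      also have "\<dots> \<le> 2 ^ b x" using le by (intro power_increasing) auto
      finally show "conf_weight (r x) (G x) i' c \<le> 2 ^ b x" .
    qed (rule that)
    \<comment> \<open>\<open>k + 1 \<le> 2 ^ k\<close> turns the bound into a power of 2, whose
      exponent bounds the bit length.\<close>
    also have "\<dots> \<le> 2 ^ b x * (2 ^ k) ^ i"
      by (intro mult_left_mono power_mono) (use Suc_leI[OF less_exp[of k]] in auto)
    also have "\<dots> \<le> 2 ^ b x * 2 ^ (k * ?n x)"
      unfolding power_mult[symmetric] using that(2) by (intro mult_left_mono power_increasing mult_left_mono) auto
    also have "\<dots> < 2 ^ (1 + b x + k * ?n x)" by (simp add: power_add)
    finally have "vsize (nv (range_total k (r x) (G x) i c)) \<le> 1 + (1 + b x + k * ?n x)"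
      by (subst vsize_IntV_le_iff) simp
    then show ?thesis by simp
  qed
  show ?thesis unfolding table_def
  proof (rule ptime_fold[where F = "\<lambda>x. table_step k (r x) (G x)" and e = nv and e' = ?e and l = "\<lambda>x. [0..<j x]"
        and B = B])
    show "ptime X \<mu> \<Gamma> (\<lambda>x. ListV (map nv [0..<j x]))"
      by (rule ptime_upt[OF j(1) pbounded_mono[OF pbounded_max_len[OF r]]]) (use j(2) in auto)
    show "ptime X \<mu> \<Gamma> (\<lambda>x. ?e (table_init (r x) (G x)))"
      unfolding table_init_def map_map o_def
    proof (rule ptime_map[OF ptime_conf_list[OF r]], rule ptime_pair)
      let ?Y = "{y. fst y \<in> X \<and> snd y \<in> set (conf_list (r (fst y)))}"
      let ?G = "(\<lambda>y. conf_val (snd y)) # lift \<Gamma>"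
      show "ptime ?Y (\<lambda>y. \<mu> (fst y)) ?G (\<lambda>y. nv (conf_weight (r (fst y)) (G (fst y)) 0 (snd y)))"
        by (rule ptime_conf_weight[OF given_lift[OF r] G' ptime_const ptime_head]) (auto simp: set_conf_list)
    qed (rule ptime_head)
    \<comment> \<open>One step is computable on arbitrary tables, so the origin of the table from a
      prefix is needed only for its size.\<close>
    let ?D = "{y. fst y \<in> X}"
    let ?\<Gamma> = "(\<lambda>y. nv (fst (snd y))) # (\<lambda>y. ?e (snd (snd y))) # lift \<Gamma>"
    have rD: "given k ?D (\<lambda>y. \<mu> (fst y)) ?\<Gamma> (\<lambda>y. r (fst y))"
      by (rule given_lift2[OF r]) simp
    have "ptime ?D (\<lambda>y. \<mu> (fst y)) ?\<Gamma> (\<lambda>y. ?e (table_step k (r (fst y)) (G (fst y)) (fst (snd y)) (snd (snd y))))"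
      unfolding table_step_def map_map o_def
    proof (rule ptime_map[OF ptime_conf_list[OF rD]], rule ptime_pair, rule ptime_head, rule ptime_nat_add)
      let ?E = "{y. fst y \<in> ?D \<and> snd y \<in> set (conf_list (r (fst (fst y))))}"
      let ?\<Delta> = "(\<lambda>y. conf_val (snd y)) # lift ?\<Gamma>"
      have rE: "given k ?E (\<lambda>y. \<mu> (fst (fst y))) ?\<Delta> (\<lambda>y. r (fst (fst y)))"
        by (rule given_lift[OF rD]) simp
      have GD: "ptime {z. fst z \<in> ?D} (\<lambda>z. \<mu> (fst (fst z))) ((\<lambda>z. pair_val IntV IntV (snd z)) # lift ?\<Gamma>)
          (\<lambda>z. nv (G (fst (fst z)) (fst (snd z)) (snd (snd z))))"
        by (rule G') auto
      have GE: "ptime {z. fst z \<in> ?E} (\<lambda>z. \<mu> (fst (fst (fst z)))) ((\<lambda>z. pair_val IntV IntV (snd z)) # lift ?\<Delta>)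
          (\<lambda>z. nv (G (fst (fst (fst z))) (fst (snd z)) (snd (snd z))))"
        by (rule ptime_fun_lift[where F = "\<lambda>x z. nv (G (fst x) (fst z) (snd z))", OF GD]) auto
      have i: "ptime ?E (\<lambda>y. \<mu> (fst (fst y))) ?\<Delta> (\<lambda>y. nv (fst (snd (fst y))))"
        by (rule ptime_lift[OF ptime_head[where X = ?D]]) simp
      have t: "ptime ?E (\<lambda>y. \<mu> (fst (fst y))) ?\<Delta> (\<lambda>y. ?e (snd (snd (fst y))))"
        by (rule ptime_lift[OF ptime_second[where X = ?D]]) simp
      have "ptime ?E (\<lambda>y. \<mu> (fst (fst y))) ?\<Delta> (\<lambda>y. nv (fst (snd (fst y)) + 1))"
        by (intro ptime_nat_add i ptime_const)
      then have Suc_i: "ptime ?E (\<lambda>y. \<mu> (fst (fst y))) ?\<Delta> (\<lambda>y. nv (Suc (fst (snd (fst y)))))" by simp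
      show "ptime ?E (\<lambda>y. \<mu> (fst (fst y))) ?\<Delta>
          (\<lambda>y. nv (conf_weight (r (fst (fst y))) (G (fst (fst y))) (Suc (fst (snd (fst y)))) (snd y)))"
        by (rule ptime_conf_weight[OF rE GE Suc_i ptime_head]) (auto simp: set_conf_list)
      show "ptime ?E (\<lambda>y. \<mu> (fst (fst y))) ?\<Delta>
          (\<lambda>y. nv (\<Sum>a\<leftarrow>[0..<k]. lookup (snd (snd (fst y))) (conf_step (r (fst (fst y))) (snd y) a)))"
      proof (rule ptime_nat_sum_list_map[where l = "\<lambda>_. [0..<k]" and e = nv, OF ptime_const], rule ptime_lookup)
        let ?F = "{y. fst y \<in> ?E \<and> snd y \<in> set [0..<k]}"
        let ?\<Theta> = "(\<lambda>y. nv (snd y)) # lift ?\<Delta>"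
        show "ptime ?F (\<lambda>y. \<mu> (fst (fst (fst y)))) ?\<Theta> (\<lambda>y. ?e (snd (snd (fst (fst y)))))"
          by (rule ptime_lift[OF t]) simp
        have rF: "given k ?F (\<lambda>y. \<mu> (fst (fst (fst y)))) ?\<Theta> (\<lambda>y. r (fst (fst (fst y))))"
          by (rule given_lift[OF rE]) simp
        show "ptime ?F (\<lambda>y. \<mu> (fst (fst (fst y)))) ?\<Theta>
            (\<lambda>y. conf_val (conf_step (r (fst (fst (fst y)))) (snd (fst y)) (snd y)))"
          by (rule ptime_conf_step[OF rF ptime_lift[OF ptime_head[where X = ?E]] ptime_head]) (auto simp: set_conf_list)
      qed
    qed
    then show "ptime {y. fst y \<in> X \<and> (\<exists>pre suf. [0..<j (fst y)] = pre @ fst (snd y) # suf \<and>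
          snd (snd y) = fold (table_step k (r (fst y)) (G (fst y))) pre (table_init (r (fst y)) (G (fst y))))}
        (\<lambda>y. \<mu> (fst y)) ?\<Gamma>
        (\<lambda>y. ?e (table_step k (r (fst y)) (G (fst y)) (fst (snd y)) (snd (snd y))))"
      by (rule ptime_mono) simp
    show "pbounded X (csize \<mu> \<Gamma>) B"
      unfolding B_def by (intro pbounded_mult pbounded_add pbounded_const U b pbounded_max_len[OF r])
    fix x pre suf assume x: "x \<in> X" and eq: "[0..<j x] = pre @ suf"
    \<comment> \<open>Prefixes of \<open>[0..<j x]\<close> are initial segments, so the intermediate
      tables are those of smaller levels.\<close>
    define i where "i = length pre"
    have "i \<le> j x" using arg_cong[OF eq, of length] by (simp add: i_def)
    then have i: "i \<le> ?n x" using j(2)[OF x] by simp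
    have "pre = take i [0..<j x]" by (simp add: eq i_def)
    then have "pre = [0..<i]" using \<open>i \<le> j x\<close> by (simp add: take_upt)
    then have "fold (table_step k (r x) (G x)) pre (table_init (r x) (G x)) = table k (r x) (G x) i"
      by (simp add: table_def)
    also have "\<dots> = map (\<lambda>c. (c, range_total k (r x) (G x) i c)) (conf_list (r x))" by (rule table_eq)
    finally have "?e (fold (table_step k (r x) (G x)) pre (table_init (r x) (G x))) =
        ListV (map (\<lambda>c. pair_val conf_val nv (c, range_total k (r x) (G x) i c)) (conf_list (r x)))"
      by simp
    also have "vsize \<dots> \<le> 1 + length (map (\<lambda>c. pair_val conf_val nv (c, range_total k (r x) (G x) i c)) (conf_list (r x))) *
        (1 + U x + (2 + b x + k * ?n x))"
    proof (rule vsize_ListV_le)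
      fix v assume "v \<in> set (map (\<lambda>c. pair_val conf_val nv (c, range_total k (r x) (G x) i c)) (conf_list (r x)))"
      then obtain c where c: "c \<in> set (conf_list (r x))" "v = pair_val conf_val nv (c, range_total k (r x) (G x) i c)"
        by auto
      have "vsize v = 1 + vsize (conf_val c) + vsize (nv (range_total k (r x) (G x) i c))"
        by (simp add: c(2) pair_val_def)
      then show "vsize v \<le> 1 + U x + (2 + b x + k * ?n x)"
        using conf_le[OF c(1)] total_le[OF x i c(1)] by linarith
    qed
    also have "\<dots> \<le> B x"
      using length_le_vsize[of "map conf_val (conf_list (r x))"]
      unfolding B_def U_def by (intro add_mono mult_right_mono) auto
    finally show "vsize (?e (fold (table_step k (r x) (G x)) pre (table_init (r x) (G x)))) \<le> B x" .
  qed
qed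

lemma ptime_total:
  assumes r: "given k X \<mu> \<Gamma> r"
    and G: "ptime {y. fst y \<in> X} (\<lambda>y. \<mu> (fst y)) ((\<lambda>y. pair_val IntV IntV (snd y)) # lift \<Gamma>)
      (\<lambda>y. nv (G (fst y) (fst (snd y)) (snd (snd y))))"
    and j: "ptime X \<mu> \<Gamma> (\<lambda>x. nv (j x))" "\<And>x. x \<in> X \<Longrightarrow> j x \<le> max_len (dfa_params (r x))"
    and c: "ptime X \<mu> \<Gamma> (\<lambda>x. conf_val (c x))" "\<And>x. x \<in> X \<Longrightarrow> conf_inside (r x) (j x) (c x)"
  shows "ptime X \<mu> \<Gamma> (\<lambda>x. nv (total k (r x) (G x) (j x) (c x)))"
proof (rule ptime_cong[OF ptime_lookup[OF ptime_table[OF r G j] c(1)]])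
  fix x assume x: "x \<in> X"
  show "nv (lookup (table k (r x) (G x) (j x)) (c x)) = nv (total k (r x) (G x) (j x) (c x))"
    using range_total_eq[OF given_instance[OF r x] c(2)[OF x]] conf_inside_mem[OF c(2)[OF x]]
    by (simp add: table_eq lookup_map distinct_conf_list)
qed

subsection \<open>Computing the solution\<close>

lemma ptime_nat_sum_set:
  assumes "ptime X \<mu> \<Gamma> (\<lambda>x. ListV (map e (l x)))" "\<And>x. x \<in> X \<Longrightarrow> distinct (l x)" "\<And>x. x \<in> X \<Longrightarrow> A x = set (l x)"
    and "ptime {y. fst y \<in> X \<and> snd y \<in> A (fst y)} (\<lambda>y. \<mu> (fst y))
       ((\<lambda>y. e (snd y)) # lift \<Gamma>) (\<lambda>y. nv (F (fst y) (snd y)))"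
  shows "ptime X \<mu> \<Gamma> (\<lambda>x. nv (\<Sum>z\<in>A x. F x z))"
  by (rule ptime_cong[OF ptime_nat_sum_list_map[OF assms(1) ptime_mono[OF assms(4)]]])
     (use assms(2,3) in \<open>simp_all add: sum_list_distinct_conv_sum_set\<close>)

lemma ptime_sum_set:
  assumes "ptime X \<mu> \<Gamma> (\<lambda>x. ListV (map e (l x)))" "\<And>x. x \<in> X \<Longrightarrow> distinct (l x)" "\<And>x. x \<in> X \<Longrightarrow> A x = set (l x)"
    and "ptime {y. fst y \<in> X \<and> snd y \<in> A (fst y)} (\<lambda>y. \<mu> (fst y))
       ((\<lambda>y. e (snd y)) # lift \<Gamma>) (\<lambda>y. IntV (F (fst y) (snd y)))"
  shows "ptime X \<mu> \<Gamma> (\<lambda>x. IntV (\<Sum>z\<in>A x. F x z))"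
  by (rule ptime_cong[OF ptime_sum_list_map[OF assms(1) ptime_mono[OF assms(4)]]])
     (use assms(2,3) in \<open>simp_all add: sum_list_distinct_conv_sum_set\<close>)

lemma ptime_nat_prod_set:
  assumes "ptime X \<mu> \<Gamma> (\<lambda>x. ListV (map e (l x)))" "\<And>x. x \<in> X \<Longrightarrow> distinct (l x)" "\<And>x. x \<in> X \<Longrightarrow> A x = set (l x)"
    and "ptime {y. fst y \<in> X \<and> snd y \<in> A (fst y)} (\<lambda>y. \<mu> (fst y))
       ((\<lambda>y. e (snd y)) # lift \<Gamma>) (\<lambda>y. nv (F (fst y) (snd y)))"
  shows "ptime X \<mu> \<Gamma> (\<lambda>x. nv (\<Prod>z\<in>A x. F x z))"
  by (rule ptime_cong[OF ptime_nat_prod_list_map[OF assms(1) ptime_mono[OF assms(4)]]])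
     (use assms(2,3) in \<open>simp_all add: prod.distinct_set_conv_list\<close>)

lemma ptime_num: "ptime X \<mu> \<Gamma> (\<lambda>x. rat_val (z x)) \<Longrightarrow> ptime X \<mu> \<Gamma> (\<lambda>x. IntV (fst (quotient_of (z x))))"
  unfolding rat_val_def by (erule ptime_component[where i = 0]) auto

lemma ptime_denom: "ptime X \<mu> \<Gamma> (\<lambda>x. rat_val (z x)) \<Longrightarrow> ptime X \<mu> \<Gamma> (\<lambda>x. IntV (snd (quotient_of (z x))))"
  unfolding rat_val_def by (erule ptime_component[where i = 1]) auto

lemma ptime_nat:
  assumes "ptime X \<mu> \<Gamma> (\<lambda>x. IntV (z x))"
  shows "ptime X \<mu> \<Gamma> (\<lambda>x. nv (nat (z x)))"
  by (rule ptime_cong[OF ptime_if[OF ptime_less[OF assms ptime_const[of _ _ _ "IntV 0"]]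
        ptime_const[of _ _ _ "IntV 0"] ptime_mono[OF assms]]]) auto

lemma cost_set_eq: "cost_set r = set [- int (cost_range r)..int (cost_range r)]"
  by (simp add: cost_set_def)

lemma lessThan_eq_set_upt: "{..<n} = set [0..<n]"
  by auto

context
  fixes k :: nat and X :: "'a set" and \<mu> :: "'a \<Rightarrow> nat" and \<Gamma> :: "('a \<Rightarrow> val) list" and r :: "'a \<Rightarrow> dfa_lqci"
  assumes r: "given k X \<mu> \<Gamma> r"
begin

lemma ptime_lcount: "ptime X \<mu> \<Gamma> (\<lambda>x. nv (lcount (r x)))"
  using ptime_length[OF ptime_labels[OF r]] by simp

lemma ptime_label_indices: "ptime X \<mu> \<Gamma> (\<lambda>x. ListV (map nv [0..<lcount (r x)]))"
proof (rule ptime_upt[OF ptime_lcount])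
  show "pbounded X (csize \<mu> \<Gamma>) (\<lambda>x. lcount (r x))"
  proof (rule pbounded_mono[OF ptime_pbounded[OF ptime_labels[OF r]]])
    show "lcount (r x) \<le> vsize (ListV (map IntV (labels (dfa_params (r x)))))" for x
      using length_le_vsize[of "map IntV (labels (dfa_params (r x)))"] by simp
  qed
qed

lemmas ptime_cost_sum = ptime_nat_sum_set[OF ptime_cost_list[OF r] distinct_upto cost_set_eq]
lemmas ptime_cost_int_sum = ptime_sum_set[OF ptime_cost_list[OF r] distinct_upto cost_set_eq]
lemmas ptime_cost_prod = ptime_nat_prod_set[OF ptime_cost_list[OF r] distinct_upto cost_set_eq]
lemmas ptime_label_sum = ptime_nat_sum_set[OF ptime_label_indices distinct_upt lessThan_eq_set_upt]
lemmas ptime_label_int_sum = ptime_sum_set[OF ptime_label_indices distinct_upt lessThan_eq_set_upt]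
lemmas ptime_label_prod = ptime_nat_prod_set[OF ptime_label_indices distinct_upt lessThan_eq_set_upt]

lemma ptime_label_ball:
  assumes "ptime {y. fst y \<in> X \<and> snd y \<in> {..<lcount (r (fst y))}} (\<lambda>y. \<mu> (fst y))
       ((\<lambda>y. nv (snd y)) # lift \<Gamma>) (\<lambda>y. of_truth (P (fst y) (snd y)))"
  shows "ptime X \<mu> \<Gamma> (\<lambda>x. of_truth (\<forall>i\<in>{..<lcount (r x)}. P x i))"
  using ptime_ball[OF ptime_label_indices, of P] assms by (simp add: lessThan_eq_set_upt)

lemma ptime_class_count:
  assumes l: "ptime X \<mu> \<Gamma> (\<lambda>x. IntV (l x))" and s: "ptime X \<mu> \<Gamma> (\<lambda>x. IntV (s x))"
  shows "ptime X \<mu> \<Gamma> (\<lambda>x. nv (class_count k (r x) (l x) (s x)))"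
  unfolding class_count_def
proof (rule ptime_total[where G = "\<lambda>x l' s'. of_bool (l' = l x \<and> s' = s x)", OF r])
  have eq: "nv (of_bool b) = of_truth b" for b by (simp add: of_truth_def)
  show "ptime {y. fst y \<in> X} (\<lambda>y. \<mu> (fst y)) ((\<lambda>y. pair_val IntV IntV (snd y)) # lift \<Gamma>)
      (\<lambda>y. nv (of_bool (fst (snd y) = l (fst y) \<and> snd (snd y) = s (fst y))))"
    unfolding eq
    by (intro ptime_conj ptime_eq_int ptime_fst[OF ptime_head] ptime_snd[OF ptime_head] ptime_lift[OF l] ptime_lift[OF s]) auto
qed (simp_all add: ptime_max_len[OF r] ptime_conf_init[OF r] conf_inside_init[OF given_instance[OF r]])

end

lemma ptime_scale:
  assumes r: "given k X \<mu> \<Gamma> r"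
  shows "ptime X \<mu> \<Gamma> (\<lambda>x. nv (scale (r x)))"
  unfolding scale_def
proof (rule ptime_nat_prod_list_map[where e = rat_val])
  have "ptime X \<mu> \<Gamma> (\<lambda>x. ListV (rat_val (label_lo (dfa_params (r x))) # rat_val (label_hi (dfa_params (r x))) #
      map rat_val (cond_lo (dfa_params (r x))) @ map rat_val (cond_hi (dfa_params (r x)))))"
    by (intro ptime_Cons ptime_list_append ptime_label_lo[OF r] ptime_label_hi[OF r]
        ptime_cond_lo[OF r] ptime_cond_hi[OF r])
  then show "ptime X \<mu> \<Gamma> (\<lambda>x. ListV (map rat_val (bound_params (r x))))"
    by (simp add: bound_params_def)
qed (intro ptime_nat ptime_denom ptime_head)

lemma ptime_scaled:
  assumes r: "given k X \<mu> \<Gamma> r" and z: "ptime X \<mu> \<Gamma> (\<lambda>x. rat_val (z x))"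
  shows "ptime X \<mu> \<Gamma> (\<lambda>x. nv (scaled (r x) (z x)))"
  unfolding scaled_def
  by (intro ptime_nat_mult ptime_nat_div ptime_nat ptime_num ptime_denom z ptime_scale[OF r])

context
  fixes k :: nat and X :: "'a set" and \<mu> :: "'a \<Rightarrow> nat" and \<Gamma> :: "('a \<Rightarrow> val) list" and r :: "'a \<Rightarrow> dfa_lqci"
    and i :: "'a \<Rightarrow> nat"
  assumes r: "given k X \<mu> \<Gamma> r" and i: "ptime X \<mu> \<Gamma> (\<lambda>x. nv (i x))"
    and i_less: "\<And>x. x \<in> X \<Longrightarrow> i x < lcount (r x)"
begin

lemma ptime_label_nth: "ptime X \<mu> \<Gamma> (\<lambda>x. IntV (labels (dfa_params (r x)) ! i x))"
  by (rule ptime_nth_map[OF ptime_labels[OF r] i i_less])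

lemma ptime_iclass_count:
  assumes "ptime X \<mu> \<Gamma> (\<lambda>x. IntV (s x))"
  shows "ptime X \<mu> \<Gamma> (\<lambda>x. nv (iclass_count k (r x) (i x) (s x)))"
  unfolding iclass_count_def by (rule ptime_class_count[OF r ptime_label_nth assms])

lemma cond_length: "x \<in> X \<Longrightarrow> i x < length (cond_lo (dfa_params (r x)))" "x \<in> X \<Longrightarrow> i x < length (cond_hi (dfa_params (r x)))"
  using given_instance[OF r] i_less
  by (auto simp: dfa_instances_def valid_lqci_def valid_params_def lqci_of_def)

lemma ptime_cost_lo:
  assumes "ptime X \<mu> \<Gamma> (\<lambda>x. IntV (s x))"
  shows "ptime X \<mu> \<Gamma> (\<lambda>x. nv (cost_lo k (r x) (i x) (s x)))"
  unfolding cost_lo_def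
  by (intro ptime_nat_mult ptime_scaled[OF r] ptime_nth_map[OF ptime_cond_lo[OF r] i cond_length(1)]
      ptime_iclass_count assms)

lemma ptime_cost_hi:
  assumes "ptime X \<mu> \<Gamma> (\<lambda>x. IntV (s x))"
  shows "ptime X \<mu> \<Gamma> (\<lambda>x. nv (cost_hi k (r x) (i x) (s x)))"
  unfolding cost_hi_def
  by (intro ptime_nat_mult ptime_scaled[OF r] ptime_nth_map[OF ptime_cond_hi[OF r] i cond_length(2)]
      ptime_iclass_count assms)

end

context
  fixes k :: nat and X :: "'a set" and \<mu> :: "'a \<Rightarrow> nat" and \<Gamma> :: "('a \<Rightarrow> val) list" and r :: "'a \<Rightarrow> dfa_lqci"
    and i :: "'a \<Rightarrow> nat"
  assumes r: "given k X \<mu> \<Gamma> r" and i: "ptime X \<mu> \<Gamma> (\<lambda>x. nv (i x))"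
    and i_less: "\<And>x. x \<in> X \<Longrightarrow> i x < lcount (r x)"
begin

lemma ptime_label_ok: "ptime X \<mu> \<Gamma> (\<lambda>x. of_truth (label_ok k (r x) (i x)))"
proof -
  let ?Y = "{y. fst y \<in> X \<and> snd y \<in> cost_set (r (fst y))}" and ?G = "(\<lambda>y. IntV (snd y)) # lift \<Gamma>"
  have *: "given k ?Y (\<lambda>y. \<mu> (fst y)) ?G (\<lambda>y. r (fst y))" "ptime ?Y (\<lambda>y. \<mu> (fst y)) ?G (\<lambda>y. nv (i (fst y)))"
    by (rule given_lift[OF r] ptime_lift[OF i]; simp)+
  have sums: "ptime X \<mu> \<Gamma> (\<lambda>x. nv (\<Sum>s\<in>cost_set (r x). cost_lo k (r x) (i x) s))"
    "ptime X \<mu> \<Gamma> (\<lambda>x. nv (\<Sum>s\<in>cost_set (r x). cost_hi k (r x) (i x) s))"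
    by (intro ptime_cost_sum[OF r] ptime_cost_lo[OF *] ptime_cost_hi[OF *] ptime_head; simp add: i_less)+
  show ?thesis unfolding label_ok_def
    by (intro ptime_conj ptime_nat_le sums ptime_scale[OF r] ptime_mono[OF sums(2)] ptime_mono[OF ptime_scale[OF r]]) auto
qed

text \<open>\<open>greedy\<close> is a closed formula with sums over all items of smaller key, so no
  sorting has to be programmed.\<close>

lemma ptime_cost_alloc:
  assumes s: "ptime X \<mu> \<Gamma> (\<lambda>x. IntV (s x))"
  shows "ptime X \<mu> \<Gamma> (\<lambda>x. nv (cost_alloc k (r x) (i x) (s x)))"
proof -
  let ?Y = "{y. fst y \<in> X \<and> snd y \<in> cost_set (r (fst y))}" and ?G = "(\<lambda>y. IntV (snd y)) # lift \<Gamma>"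
  have *: "given k ?Y (\<lambda>y. \<mu> (fst y)) ?G (\<lambda>y. r (fst y))" "ptime ?Y (\<lambda>y. \<mu> (fst y)) ?G (\<lambda>y. nv (i (fst y)))"
    by (rule given_lift[OF r] ptime_lift[OF i]; simp)+
  have s': "ptime ?Y (\<lambda>y. \<mu> (fst y)) ?G (\<lambda>y. IntV (s (fst y)))"
    by (rule ptime_lift[OF s]) simp
  have lo: "ptime ?Y (\<lambda>y. \<mu> (fst y)) ?G (\<lambda>y. nv (cost_lo k (r (fst y)) (i (fst y)) (snd y)))"
    by (rule ptime_cost_lo[OF * _ ptime_head]) (simp add: i_less)
  have hi: "ptime ?Y (\<lambda>y. \<mu> (fst y)) ?G (\<lambda>y. nv (cost_hi k (r (fst y)) (i (fst y)) (snd y)))"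
    by (rule ptime_cost_hi[OF * _ ptime_head]) (simp add: i_less)
  have lo_s: "ptime X \<mu> \<Gamma> (\<lambda>x. nv (cost_lo k (r x) (i x) (s x)))"
    by (rule ptime_cost_lo[OF r i i_less s])
  have hi_s: "ptime X \<mu> \<Gamma> (\<lambda>x. nv (cost_hi k (r x) (i x) (s x)))"
    by (rule ptime_cost_hi[OF r i i_less s])
  have before: "ptime X \<mu> \<Gamma> (\<lambda>x. nv (\<Sum>s'\<in>cost_set (r x).
      if s' < s x then cost_hi k (r x) (i x) s' - cost_lo k (r x) (i x) s' else 0))"
    by (rule ptime_cost_sum[OF r], rule ptime_nat_if[OF ptime_less[OF ptime_head s'] ptime_mono[OF ptime_nat_diff[OF hi lo]] ptime_const])
      simp
  show ?thesis unfolding cost_alloc_def greedy_def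
    by (intro ptime_nat_add ptime_nat_min ptime_nat_diff lo_s hi_s before ptime_cost_sum[OF r] lo ptime_scale[OF r])
qed

end

context
  fixes k :: nat and X :: "'a set" and \<mu> :: "'a \<Rightarrow> nat" and \<Gamma> :: "('a \<Rightarrow> val) list" and r :: "'a \<Rightarrow> dfa_lqci"
    and i :: "'a \<Rightarrow> nat"
  assumes r: "given k X \<mu> \<Gamma> r" and i: "ptime X \<mu> \<Gamma> (\<lambda>x. nv (i x))"
    and i_less: "\<And>x. x \<in> X \<Longrightarrow> i x < lcount (r x)"
begin

lemma ptime_label_cost: "ptime X \<mu> \<Gamma> (\<lambda>x. IntV (label_cost k (r x) (i x)))"
  unfolding label_cost_def
  by (intro ptime_cost_int_sum[OF r] ptime_mult ptime_head ptime_cost_alloc[OF given_lift[OF r] ptime_lift[OF i]])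
     (simp_all add: i_less)

lemma ptime_lab_lo: "ptime X \<mu> \<Gamma> (\<lambda>x. nv (lab_lo (r x)))"
  unfolding lab_lo_def by (intro ptime_scaled[OF r] ptime_label_lo[OF r])

lemma ptime_lab_hi: "ptime X \<mu> \<Gamma> (\<lambda>x. nv (lab_hi k (r x) (i x)))"
  unfolding lab_hi_def
  by (intro ptime_nat_if ptime_label_ok[OF r i i_less] ptime_const ptime_mono[OF ptime_scaled[OF r ptime_label_hi[OF r]]]) simp_all

lemma ptime_label_key: "ptime X \<mu> \<Gamma> (\<lambda>x. IntV (label_key k (r x) (i x)))"
  unfolding label_key_def by (intro ptime_add ptime_mult ptime_label_cost ptime_lcount[OF r] i)

end

context
  fixes k :: nat and X :: "'a set" and \<mu> :: "'a \<Rightarrow> nat" and \<Gamma> :: "('a \<Rightarrow> val) list" and r :: "'a \<Rightarrow> dfa_lqci"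
  assumes r: "given k X \<mu> \<Gamma> r"
begin

abbreviation "label_domain \<equiv> {y. fst y \<in> X \<and> snd y \<in> {..<lcount (r (fst y))}}"
abbreviation "label_context \<equiv> (\<lambda>y. nv (snd y)) # lift \<Gamma>"

lemma label_loop:
  "given k label_domain (\<lambda>y. \<mu> (fst y)) label_context (\<lambda>y. r (fst y))"
  "ptime label_domain (\<lambda>y. \<mu> (fst y)) label_context (\<lambda>y. nv (snd y))"
  "\<And>y. y \<in> label_domain \<Longrightarrow> snd y < lcount (r (fst y))"
  by (rule given_lift[OF r], simp) (simp_all add: ptime_head)

lemma ptime_label_alloc:
  assumes i: "ptime X \<mu> \<Gamma> (\<lambda>x. nv (i x))" and i_less: "\<And>x. x \<in> X \<Longrightarrow> i x < lcount (r x)"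
  shows "ptime X \<mu> \<Gamma> (\<lambda>x. nv (label_alloc k (r x) (i x)))"
proof -
  have before: "ptime X \<mu> \<Gamma> (\<lambda>x. nv (\<Sum>j\<in>{..<lcount (r x)}.
      if label_key k (r x) j < label_key k (r x) (i x) then lab_hi k (r x) j - lab_lo (r x) else 0))"
    by (rule ptime_label_sum[OF r], rule ptime_nat_if[OF ptime_less[OF ptime_label_key[OF label_loop]
          ptime_lift[OF ptime_label_key[OF r i i_less]]]
          ptime_mono[OF ptime_nat_diff[OF ptime_lab_hi[OF label_loop] ptime_lab_lo[OF label_loop]]] ptime_const]) simp_all
  show ?thesis unfolding label_alloc_def greedy_def
    by (intro ptime_nat_add ptime_nat_min ptime_nat_diff before ptime_label_sum[OF r] ptime_lab_lo[OF label_loop]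
        ptime_lab_lo[OF r i i_less] ptime_lab_hi[OF r i i_less] ptime_scale[OF r])
qed

end

context
  fixes k :: nat and X :: "'a set" and \<mu> :: "'a \<Rightarrow> nat" and \<Gamma> :: "('a \<Rightarrow> val) list" and r :: "'a \<Rightarrow> dfa_lqci"
  assumes r: "given k X \<mu> \<Gamma> r"
begin

lemma ptime_solvable: "ptime X \<mu> \<Gamma> (\<lambda>x. of_truth (solvable k (r x)))"
proof -
  note loop = label_loop[OF r]
  have sums: "ptime X \<mu> \<Gamma> (\<lambda>x. nv (\<Sum>i\<in>{..<lcount (r x)}. lab_lo (r x)))"
    "ptime X \<mu> \<Gamma> (\<lambda>x. nv (\<Sum>i\<in>{..<lcount (r x)}. lab_hi k (r x) i))"
    "ptime X \<mu> \<Gamma> (\<lambda>x. IntV (\<Sum>i\<in>{..<lcount (r x)}. label_cost k (r x) i * int (label_alloc k (r x) i)))"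
    by (intro ptime_label_sum[OF r] ptime_label_int_sum[OF r] ptime_mult ptime_lab_lo[OF loop] ptime_lab_hi[OF loop]
        ptime_label_cost[OF loop] ptime_label_alloc[OF loop(1,2)], auto)+
  have ball: "ptime X \<mu> \<Gamma> (\<lambda>x. of_truth (\<forall>i\<in>{..<lcount (r x)}. lab_lo (r x) \<le> lab_hi k (r x) i))"
    by (intro ptime_label_ball[OF r] ptime_nat_le ptime_lab_lo[OF loop] ptime_lab_hi[OF loop])
  show ?thesis unfolding solvable_def
    by (intro ptime_conj ball ptime_mono[OF ptime_nat_le[OF sums(1) ptime_scale[OF r]]]
        ptime_mono[OF ptime_nat_le[OF ptime_scale[OF r] sums(2)]]
        ptime_mono[OF ptime_le[OF ptime_mult[OF ptime_denom[OF ptime_cost_bound[OF r]] sums(3)]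
          ptime_mult[OF ptime_num[OF ptime_cost_bound[OF r]] ptime_mult[OF ptime_scale[OF r] ptime_scale[OF r]]]]]) auto
qed

lemma ptime_class_prod: "ptime X \<mu> \<Gamma> (\<lambda>x. nv (class_prod k (r x)))"
  unfolding class_prod_def
proof (intro ptime_label_prod[OF r] ptime_cost_prod[OF label_loop(1)[OF r]] ptime_nat_max)
  let ?Y = "{y. fst y \<in> {y. fst y \<in> X \<and> snd y \<in> {..<lcount (r (fst y))}} \<and> snd y \<in> cost_set (r (fst (fst y)))}"
  show "ptime ?Y (\<lambda>y. \<mu> (fst (fst y))) ((\<lambda>y. IntV (snd y)) # lift ((\<lambda>y. nv (snd y)) # lift \<Gamma>))
     (\<lambda>y. nv (iclass_count k (r (fst (fst y))) (snd (fst y)) (snd y)))"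
    by (rule ptime_iclass_count[OF given_lift[OF label_loop(1)[OF r]] ptime_lift[OF label_loop(2)[OF r]] _ ptime_head]) auto
qed (rule ptime_const)

text \<open>All allocations are recomputed for every requested weight. This is wasteful but
  polynomial, and saves storing them.\<close>

lemma ptime_word_weight:
  assumes l: "ptime X \<mu> \<Gamma> (\<lambda>x. IntV (l x))" and s: "ptime X \<mu> \<Gamma> (\<lambda>x. IntV (s x))"
  shows "ptime X \<mu> \<Gamma> (\<lambda>x. nv (word_weight k (r x) (l x) (s x)))"
  unfolding word_weight_def class_weight_def
proof (rule ptime_label_sum[OF r], rule ptime_nat_if)
  note loop = label_loop[OF r]
  let ?Y = "{y. fst y \<in> X \<and> snd y \<in> {..<lcount (r (fst y))}}" and ?G = "(\<lambda>y. nv (snd y)) # lift \<Gamma>"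
  show "ptime ?Y (\<lambda>y. \<mu> (fst y)) ?G (\<lambda>y. of_truth (labels (dfa_params (r (fst y))) ! snd y = l (fst y)))"
    by (intro ptime_eq_int ptime_label_nth[OF loop] ptime_lift[OF l]) auto
  have s': "ptime ?Y (\<lambda>y. \<mu> (fst y)) ?G (\<lambda>y. IntV (s (fst y)))"
    by (rule ptime_lift[OF s]) simp
  have m: "ptime ?Y (\<lambda>y. \<mu> (fst y)) ?G (\<lambda>y. nv (class_prod k (r (fst y))))"
    by (rule ptime_lift[OF ptime_class_prod]) simp
  have "ptime ?Y (\<lambda>y. \<mu> (fst y)) ?G (\<lambda>y. nv (label_alloc k (r (fst y)) (snd y) *
        cost_alloc k (r (fst y)) (snd y) (s (fst y)) *
        (class_prod k (r (fst y)) div iclass_count k (r (fst y)) (snd y) (s (fst y)))))"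
    by (intro ptime_nat_mult ptime_nat_div m ptime_label_alloc[OF loop] ptime_cost_alloc[OF loop s']
        ptime_iclass_count[OF loop s'])
  then show "ptime {y \<in> ?Y. labels (dfa_params (r (fst y))) ! snd y = l (fst y)} (\<lambda>y. \<mu> (fst y)) ?G
      (\<lambda>y. nv (label_alloc k (r (fst y)) (snd y) * cost_alloc k (r (fst y)) (snd y) (s (fst y)) *
        (class_prod k (r (fst y)) div iclass_count k (r (fst y)) (snd y) (s (fst y)))))"
    by (rule ptime_mono) simp
qed (rule ptime_const)

end

lemma ptime_word_weight_fun:
  assumes r: "given k X \<mu> \<Gamma> r"
  shows "ptime {y. fst y \<in> X} (\<lambda>y. \<mu> (fst y)) ((\<lambda>y. pair_val IntV IntV (snd y)) # lift \<Gamma>)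
      (\<lambda>y. nv (word_weight k (r (fst y)) (fst (snd y)) (snd (snd y))))"
  by (rule ptime_word_weight[OF given_lift[OF r] ptime_fst[OF ptime_head] ptime_snd[OF ptime_head]]) simp

lemma ptime_sample_count:
  assumes r: "given k X \<mu> \<Gamma> r"
  shows "ptime X \<mu> \<Gamma> (\<lambda>x. nv (sample_count k (r x)))"
  unfolding sample_count_def
  by (rule ptime_total[OF r ptime_word_weight_fun[OF r] ptime_max_len[OF r] _ ptime_conf_init[OF r]])
     (simp_all add: conf_inside_init[OF given_instance[OF r]])

section \<open>Unranking in polynomial time\<close>

fun pick_state :: "nat list \<Rightarrow> nat \<Rightarrow> nat \<Rightarrow> nat list \<times> nat \<times> nat" where
  "pick_state [] i x = ([], i, x)"
| "pick_state (w # ws) i x = (if x < w then (w # ws, i, x) else pick_state ws (i + 1) (x - w))"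

text \<open>\<open>pick_state\<close> is the tail-recursive form of \<open>pick\<close>, which
  counts the blocks passed; its value is the final state of a loop.\<close>

lemma pick_state_eq: "snd (pick_state ws i x) = (i + fst (pick ws x), snd (pick ws x))"
  by (induction ws arbitrary: i x) auto

lemma pick_le: "snd (pick ws x) \<le> x"
  by (induction ws x rule: pick.induct) auto

lemma vsize_nat_mono: "m \<le> n \<Longrightarrow> vsize (nv m) \<le> vsize (nv n)"
  by (rule vsize_IntV_mono) simp

lemma ptime_pick:
  assumes ws: "ptime X \<mu> \<Gamma> (\<lambda>x. ListV (map nv (ws x)))" and a: "ptime X \<mu> \<Gamma> (\<lambda>x. nv (a x))"
  shows "ptime X \<mu> \<Gamma> (\<lambda>x. pair_val nv nv (pick (ws x) (a x)))"
proof -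
  let ?el = "\<lambda>ws. ListV (map nv ws)"
  define e where "e = pair_val ?el (pair_val nv nv)"
  \<comment> \<open>The last conjunct says that the final state is the one reached from the start;
    the others bound the size of the current state.\<close>
  define Inv where "Inv = (\<lambda>x s. (\<exists>pre. ws x = pre @ fst s) \<and> fst (snd s) \<le> length (ws x) - length (fst s) \<and>
     snd (snd s) \<le> a x \<and> pick_state (fst s) (fst (snd s)) (snd (snd s)) = pick_state (ws x) 0 (a x))"
  define P where "P = (\<lambda>(x::'a) (s :: nat list \<times> nat \<times> nat). fst s \<noteq> [] \<and> \<not> snd (snd s) < (hd (fst s) :: nat))"
  define nx where "nx = (\<lambda>(x::'a) (s :: nat list \<times> nat \<times> nat). (tl (fst s), fst (snd s) + 1, snd (snd s) - (hd (fst s) :: nat)))"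
  let ?m = "\<lambda>y. \<mu> (fst y)" and ?G = "(\<lambda>y. e (snd y)) # lift \<Gamma>"
  have s1: "ptime Z ?m ?G (\<lambda>y. ?el (fst (snd y)))" for Z
    by (rule ptime_fst[where e' = "pair_val nv nv"]) (simp add: e_def ptime_head)
  have s23: "ptime Z ?m ?G (\<lambda>y. pair_val nv nv (snd (snd y)))" for Z
    by (rule ptime_snd[where e = ?el]) (simp add: e_def ptime_head)
  have hd: "ptime {y \<in> Z. fst (snd y) \<noteq> []} ?m ?G (\<lambda>y. nv (hd (fst (snd y))))" for Z
    by (rule ptime_hd[OF s1]) simp
  have "ptime X \<mu> \<Gamma> (\<lambda>x. e (ws x, 0, a x))"
    unfolding e_def by (intro ptime_pair ws a ptime_const)
  then have "ptime X \<mu> \<Gamma> (\<lambda>x. e (pick_state (ws x) 0 (a x)))"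
  proof (rule ptime_while[where Inv = Inv and P = P and V = "\<lambda>x s. length (fst s)"
        and nx = nx and start = "\<lambda>x. (ws x, 0, a x)"])
    let ?Y = "{y. fst y \<in> X \<and> Inv (fst y) (snd y)}"
    have "ptime ?Y ?m ?G (\<lambda>y. of_truth (?el (fst (snd y)) \<noteq> ListV []))"
      by (intro ptime_not ptime_eq s1 ptime_const)
    then have nonempty: "ptime ?Y ?m ?G (\<lambda>y. of_truth (fst (snd y) \<noteq> []))" by simp
    show "ptime ?Y ?m ?G (\<lambda>y. of_truth (P (fst y) (snd y)))"
      unfolding P_def by (rule ptime_conj[OF nonempty], intro ptime_not ptime_nat_less ptime_snd[OF s23] hd)
    let ?Z = "{y. fst y \<in> X \<and> Inv (fst y) (snd y) \<and> P (fst y) (snd y)}"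
    have "ptime ?Z ?m ?G (\<lambda>y. nv (hd (fst (snd y))))"
      by (rule ptime_mono[OF hd[of UNIV]]) (simp add: P_def)
    moreover have "ptime ?Z ?m ?G (\<lambda>y. ?el (tl (fst (snd y))))"
      using ptime_tl[OF s1] by (simp add: map_tl)
    ultimately have "ptime ?Z ?m ?G (\<lambda>y. pair_val ?el (pair_val nv nv) (nx (fst y) (snd y)))"
      unfolding nx_def by (intro ptime_pair ptime_nat_add ptime_nat_diff ptime_const ptime_fst[OF s23] ptime_snd[OF s23])
    then show "ptime ?Z ?m ?G (\<lambda>y. e (nx (fst y) (snd y)))" by (simp add: e_def)
    have len: "length (ws x) \<le> vsize (?el (ws x))" for x
      using length_le_vsize[of "map nv (ws x)"] by simp
    show "pbounded X (csize \<mu> \<Gamma>) (\<lambda>x. length (fst (ws x, 0, a x)))"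
      by (rule pbounded_mono[OF ptime_pbounded[OF ws]]) (use len in auto)
    show "pbounded X (csize \<mu> \<Gamma>) (\<lambda>x. 1 + vsize (?el (ws x)) + (1 + (1 + vsize (?el (ws x))) + vsize (nv (a x))))"
      by (intro pbounded_add pbounded_const ptime_pbounded ws a)
    fix x s assume x: "x \<in> X" and I: "Inv x s"
    obtain v i b where s: "s = (v, i, b)" by (cases s) auto
    obtain pre where pre: "ws x = pre @ v" using I by (auto simp: Inv_def s)
    have "i \<le> length (ws x)" using I by (auto simp: Inv_def s)
    then have "vsize (nv i) \<le> 1 + vsize (?el (ws x))"
      using vsize_IntV_le[of "int i"] len[of x] by (simp del: vsize.simps)
    moreover have "vsize (nv b) \<le> vsize (nv (a x))" using I by (intro vsize_nat_mono) (simp add: Inv_def s)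
    moreover have "vsize (?el v) \<le> vsize (?el (ws x))" by (simp add: pre)
    ultimately show "vsize (e s) \<le> 1 + vsize (?el (ws x)) + (1 + (1 + vsize (?el (ws x))) + vsize (nv (a x)))"
      by (simp add: e_def pair_val_def s)
    show "e s = e (pick_state (ws x) 0 (a x))" if "\<not> P x s"
    proof -
      have "pick_state v i b = (v, i, b)" using that by (cases v) (auto simp: P_def s)
      then show ?thesis using I by (simp add: Inv_def s)
    qed
    assume P: "P x s"
    then obtain u us where u: "v = u # us" "\<not> b < u" by (cases v) (auto simp: P_def s)
    then show "length (fst (nx x s)) < length (fst s)" by (simp add: nx_def s)
    have "ws x = (pre @ [u]) @ us" using pre u by simp
    then show "Inv x (nx x s)" using I u(2) unfolding Inv_def nx_def s u(1) by auto
  qed (simp_all add: Inv_def)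
  then have "ptime X \<mu> \<Gamma> (\<lambda>x. pair_val nv nv (snd (pick_state (ws x) 0 (a x))))"
    unfolding e_def by (rule ptime_snd)
  then show ?thesis by (simp add: pick_state_eq)
qed

text \<open>The final value of the loop that computes \<^const>\<open>unrank\<close>; \<open>w\<close> is the part of the word
  found so far.\<close>

primrec unrank_state ::
  "nat \<Rightarrow> dfa_lqci \<Rightarrow> (int \<Rightarrow> int \<Rightarrow> nat) \<Rightarrow> nat \<Rightarrow> conf \<Rightarrow> nat \<Rightarrow> word \<Rightarrow> nat \<times> conf \<times> nat \<times> word" where
  "unrank_state k r G 0 c x w = (0, c, x, w)"
| "unrank_state k r G (Suc j) c x w =
     (if x < conf_weight r G (Suc j) c then (Suc j, c, x, w)
      else let z = pick (map (\<lambda>a. total k r G j (conf_step r c a)) [0..<k]) (x - conf_weight r G (Suc j) c)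
           in unrank_state k r G j (conf_step r c (fst z)) (snd z) (w @ [fst z]))"

lemma unrank_state_eq: "snd (snd (snd (unrank_state k r G j c x w))) = w @ unrank k r G j c x"
  by (induction j arbitrary: c x w) (auto simp: Let_def)

lemma word_val_eq: "word_val w = ListV (map nv w)"
  by (simp add: word_val_def)

text \<open>At most \<open>max_len\<close> rounds: in each, the totals of the \<open>k\<close>
  successors are computed afresh, and \<open>pick\<close> determines the next letter.\<close>

lemma ptime_sample_word:
  assumes r: "given k X \<mu> \<Gamma> r" and a: "ptime X \<mu> \<Gamma> (\<lambda>x. nv (a x))"
    and less: "\<And>x. x \<in> X \<Longrightarrow> a x < sample_count k (r x)"
  shows "ptime X \<mu> \<Gamma> (\<lambda>x. word_val (sample_word k (r x) (a x)))"
proof -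
  define G where "G x = word_weight k (r x)" for x
  have G: "ptime {y. fst y \<in> X} (\<lambda>y. \<mu> (fst y)) ((\<lambda>y. pair_val IntV IntV (snd y)) # lift \<Gamma>)
      (\<lambda>y. nv (G (fst y) (fst (snd y)) (snd (snd y))))"
    unfolding G_def by (rule ptime_word_weight_fun[OF r])
  let ?n = "\<lambda>x. max_len (dfa_params (r x))"
  define U where "U = (\<lambda>x. vsize (ListV (map conf_val (conf_list (r x)))))"
  have U: "pbounded X (csize \<mu> \<Gamma>) U"
    unfolding U_def using ptime_conf_list[OF r] by (rule ptime_pbounded)
  let ?ew = "\<lambda>w. ListV (map nv w)"
  let ?e = "pair_val nv (pair_val conf_val (pair_val nv ?ew))"
  define e where "e = ?e"
  define fin where "fin x = (\<lambda>(j, c, b, w). unrank_state k (r x) (G x) j c b w)" for x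
  define start where "start x = (?n x, conf_init (r x), a x, [] :: word)" for x
  \<comment> \<open>\<open>conf_inside\<close> makes the tables exact, \<open>b < total\<close>
    keeps the rank valid, lengths and letters bound the size, and the last conjunct fixes the
    result.\<close>
  define Inv where "Inv x = (\<lambda>(j, c, b, w). conf_inside (r x) j c \<and> j \<le> ?n x \<and> b < total k (r x) (G x) j c \<and>
     b \<le> a x \<and> length w + j = ?n x \<and> set w \<subseteq> {..<k} \<and> fin x (j, c, b, w) = fin x (start x))" for x
  define P where "P x s \<longleftrightarrow> \<not> fst (snd (snd s)) < conf_weight (r x) (G x) (fst s) (fst (snd s))"
    for x and s :: "nat \<times> conf \<times> nat \<times> word"
  define wts where "wts x s = map (\<lambda>a. total k (r x) (G x) (fst s - 1) (conf_step (r x) (fst (snd s)) a)) [0..<k]"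
    for x and s :: "nat \<times> conf \<times> nat \<times> word"
  define z where "z x s = pick (wts x s) (fst (snd (snd s)) - conf_weight (r x) (G x) (fst s) (fst (snd s)))"
    for x and s :: "nat \<times> conf \<times> nat \<times> word"
  define nx where "nx x s = (fst s - 1, conf_step (r x) (fst (snd s)) (fst (z x s)), snd (z x s),
      snd (snd (snd s)) @ [fst (z x s)])" for x and s :: "nat \<times> conf \<times> nat \<times> word"
  let ?m = "\<lambda>y. \<mu> (fst y)" and ?\<Gamma> = "(\<lambda>y. e (snd y)) # lift \<Gamma>"
  have s0: "ptime Z ?m ?\<Gamma> (\<lambda>y. ?e (snd y))" for Z
    using ptime_head[of Z ?m "\<lambda>y. e (snd y)" "lift \<Gamma>"] by (simp add: e_def)
  have step: "j > 0 \<and> fst (z x (j, c, b, w)) < k \<and> snd (z x (j, c, b, w)) \<le> b \<and>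
      snd (z x (j, c, b, w)) < total k (r x) (G x) (j - 1) (conf_step (r x) c (fst (z x (j, c, b, w)))) \<and>
      conf_inside (r x) (j - 1) (conf_step (r x) c (fst (z x (j, c, b, w))))"
    if x: "x \<in> X" and I: "Inv x (j, c, b, w)" and P: "P x (j, c, b, w)" for x j c b w
  proof (cases j)
    \<comment> \<open>With no letters left the total is just the weight of the configuration, so a
      valid rank violates the loop condition.\<close>
    case 0
    then show ?thesis using I P by (simp add: Inv_def P_def)
  next
    case (Suc j')
    let ?s = "(j, c, b, w)" and ?y = "b - conf_weight (r x) (G x) j c"
    have "?y < sum_list (wts x ?s)"
      using I P Suc by (auto simp: Inv_def P_def wts_def)
    from pick_less[OF this] have *: "fst (z x ?s) < k" "snd (z x ?s) < wts x ?s ! fst (z x ?s)"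
      by (auto simp: z_def wts_def)
    moreover have "snd (z x ?s) \<le> b"
      using pick_le[of "wts x ?s" ?y] by (simp add: z_def)
    moreover have "conf_inside (r x) j' (conf_step (r x) c (fst (z x ?s)))"
      using I Suc *(1) by (intro conf_inside_step[OF given_instance[OF r x]]) (auto simp: Inv_def)
    ultimately show ?thesis using Suc by (simp add: wts_def)
  qed
  have "ptime X \<mu> \<Gamma> (\<lambda>x. e (start x))"
    unfolding e_def start_def
    by (intro ptime_pair ptime_max_len[OF r] ptime_conf_init[OF r] a) (simp add: ptime_const)
  then have "ptime X \<mu> \<Gamma> (\<lambda>x. e (fin x (start x)))"
  proof (rule ptime_while[where Inv = Inv and P = P and V = "\<lambda>x s. fst s" and nx = nx])
    define Y where "Y = {y. fst y \<in> X \<and> Inv (fst y) (snd y)}"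
    define Z where "Z = {y. fst y \<in> X \<and> Inv (fst y) (snd y) \<and> P (fst y) (snd y)}"
    have ZY: "Z \<subseteq> Y" by (auto simp: Z_def Y_def)
    have YX: "fst y \<in> X" if "y \<in> Y" for y using that by (simp add: Y_def)
    have rY: "given k A ?m ?\<Gamma> (\<lambda>y. r (fst y))" if "A \<subseteq> Y" for A
      by (rule given_lift[OF r]) (use that YX in blast)
    have GY: "ptime {z. fst z \<in> A} (\<lambda>z. \<mu> (fst (fst z))) ((\<lambda>z. pair_val IntV IntV (snd z)) # lift ?\<Gamma>)
        (\<lambda>z. nv (G (fst (fst z)) (fst (snd z)) (snd (snd z))))" if "A \<subseteq> Y" for A
      by (rule ptime_fun_lift[where F = "\<lambda>x z. nv (G x (fst z) (snd z))", OF G]) (use that YX in auto)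
    have tuple: "Inv (fst y) (fst (snd y), fst (snd (snd y)), fst (snd (snd (snd y))), snd (snd (snd (snd y))))"
      if "y \<in> Y" for y using that by (simp add: Y_def)
    have valid: "valid_conf (r (fst y)) (fst (snd (snd y)))" if "y \<in> Y" for y
      using tuple[OF that] unfolding Inv_def prod.case conf_inside_def by blast
    have weight: "ptime A ?m ?\<Gamma> (\<lambda>y. nv (conf_weight (r (fst y)) (G (fst y)) (fst (snd y)) (fst (snd (snd y)))))"
      if A: "A \<subseteq> Y" for A
      by (rule ptime_conf_weight[OF rY[OF A] GY[OF A] ptime_fst[OF s0] ptime_fst[OF ptime_snd[OF s0]] valid[OF subsetD[OF A]]])
    show "ptime {y. fst y \<in> X \<and> Inv (fst y) (snd y)} ?m ?\<Gamma> (\<lambda>y. of_truth (P (fst y) (snd y)))"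
      unfolding P_def Y_def[symmetric]
      by (intro ptime_not ptime_nat_less weight ptime_fst[OF ptime_snd[OF ptime_snd[OF s0]]]) simp
    have stepZ: "fst (snd y) > 0" "fst (z (fst y) (snd y)) < k" "valid_conf (r (fst y)) (fst (snd (snd y)))"
      "conf_inside (r (fst y)) (fst (snd y)) (fst (snd (snd y)))" "fst (snd y) \<le> ?n (fst y)"
      if y: "y \<in> Z" for y
    proof -
      have yY: "y \<in> Y" using y ZY by blast
      have "P (fst y) (fst (snd y), fst (snd (snd y)), fst (snd (snd (snd y))), snd (snd (snd (snd y))))"
        using y by (simp add: Z_def)
      from step[OF YX[OF yY] tuple[OF yY] this]
      show "fst (snd y) > 0" "fst (z (fst y) (snd y)) < k" by simp_all
      show "valid_conf (r (fst y)) (fst (snd (snd y)))" by (rule valid[OF yY])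
      show "conf_inside (r (fst y)) (fst (snd y)) (fst (snd (snd y)))" "fst (snd y) \<le> ?n (fst y)"
        using tuple[OF yY] unfolding Inv_def prod.case by blast+
    qed
    have "ptime Z ?m ?\<Gamma> (\<lambda>y. ListV (map nv (wts (fst y) (snd y))))"
      unfolding wts_def map_map o_def
    proof (rule ptime_map[where l = "\<lambda>_. [0..<k]" and e = nv, OF ptime_const])
      let ?W = "{y. fst y \<in> Z \<and> snd y \<in> set [0..<k]}" and ?\<Delta> = "(\<lambda>y. nv (snd y)) # lift ?\<Gamma>"
      have rW: "given k ?W (\<lambda>y. \<mu> (fst (fst y))) ?\<Delta> (\<lambda>y. r (fst (fst y)))"
        by (rule given_lift[OF rY[OF ZY]]) simp
      have j: "ptime Z ?m ?\<Gamma> (\<lambda>y. nv (fst (snd y) - 1))"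
        by (intro ptime_nat_diff ptime_fst[OF s0] ptime_const)
      have c: "ptime Z ?m ?\<Gamma> (\<lambda>y. conf_val (fst (snd (snd y))))"
        by (rule ptime_fst[OF ptime_snd[OF s0]])
      have GW: "ptime {z. fst z \<in> ?W} (\<lambda>z. \<mu> (fst (fst (fst z)))) ((\<lambda>z. pair_val IntV IntV (snd z)) # lift ?\<Delta>)
        (\<lambda>z. nv (G (fst (fst (fst z))) (fst (snd z)) (snd (snd z))))"
        by (rule ptime_fun_lift[where F = "\<lambda>x z. nv (G (fst x) (fst z) (snd z))", OF GY[OF ZY]]) auto
      show "ptime ?W (\<lambda>y. \<mu> (fst (fst y))) ?\<Delta>
          (\<lambda>y. nv (total k (r (fst (fst y))) (G (fst (fst y))) (fst (snd (fst y)) - 1)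
             (conf_step (r (fst (fst y))) (fst (snd (snd (fst y)))) (snd y))))"
      proof (rule ptime_total[OF rW GW ptime_lift[OF j] _ ptime_conf_step[OF rW ptime_lift[OF c] ptime_head]])
        fix y assume y: "y \<in> ?W"
        then have yZ: "fst y \<in> Z" and a: "snd y < k" by auto
        note st = stepZ[OF yZ]
        show "fst (snd (fst y)) - 1 \<le> ?n (fst (fst y))" using st(5) by simp
        have "conf_inside (r (fst (fst y))) (Suc (fst (snd (fst y)) - 1)) (fst (snd (snd (fst y))))"
          using st(1,4) by simp
        then show "conf_inside (r (fst (fst y))) (fst (snd (fst y)) - 1)
            (conf_step (r (fst (fst y))) (fst (snd (snd (fst y)))) (snd y))"
          by (rule conf_inside_step[OF given_instance[OF r YX[OF subsetD[OF ZY yZ]]] _ a])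
        show "valid_conf (r (fst (fst y))) (fst (snd (snd (fst y))))" by (rule st(3))
        show "snd y < k" by (rule a)
      qed auto
    qed
    then have z: "ptime Z ?m ?\<Gamma> (\<lambda>y. pair_val nv nv (z (fst y) (snd y)))"
      unfolding z_def
      by (intro ptime_pick ptime_nat_diff ptime_fst[OF ptime_snd[OF ptime_snd[OF s0]]] weight ZY)
    have "ptime Z ?m ?\<Gamma> (\<lambda>y. ?ew (snd (snd (snd (snd y))) @ [fst (z (fst y) (snd y))]))"
      unfolding map_append list.map
      by (intro ptime_list_append ptime_Cons ptime_Nil ptime_fst[OF z] ptime_snd[OF ptime_snd[OF ptime_snd[OF s0]]])
    then have "ptime Z ?m ?\<Gamma> (\<lambda>y. ?e (nx (fst y) (snd y)))"
      unfolding nx_def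
      by (intro ptime_pair ptime_nat_diff ptime_const ptime_fst[OF s0] ptime_snd[OF z]
          ptime_conf_step[OF rY[OF ZY] ptime_fst[OF ptime_snd[OF s0]] ptime_fst[OF z]] stepZ)
    then show "ptime {y. fst y \<in> X \<and> Inv (fst y) (snd y) \<and> P (fst y) (snd y)} ?m ?\<Gamma>
        (\<lambda>y. e (nx (fst y) (snd y)))"
      unfolding Z_def[symmetric] e_def .
    show "pbounded X (csize \<mu> \<Gamma>) (\<lambda>x. fst (start x))"
      unfolding start_def fst_conv by (rule pbounded_max_len[OF r])
    show "pbounded X (csize \<mu> \<Gamma>) (\<lambda>x. 1 + (1 + ?n x) + (1 + U x + (1 + vsize (nv (a x)) + (1 + ?n x * (1 + k)))))"
      by (intro pbounded_add pbounded_mult pbounded_const pbounded_max_len[OF r] U ptime_pbounded[OF a])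
    fix x s assume x: "x \<in> X" and I: "Inv x s"
    obtain j c b w where s: "s = (j, c, b, w)" by (cases s) auto
    have "vsize (nv j) \<le> 1 + ?n x" using vsize_IntV_le[of "int j"] I by (simp add: Inv_def s)
    moreover have "c \<in> set (conf_list (r x))" using I by (auto simp: Inv_def s intro: conf_inside_mem)
    then have "vsize (conf_val c) \<le> U x"
      using vsize_mem[of "conf_val c" "map conf_val (conf_list (r x))"] by (simp add: U_def del: vsize.simps)
    moreover have "vsize (nv b) \<le> vsize (nv (a x))" using I by (intro vsize_nat_mono) (simp add: Inv_def s)
    moreover have "vsize (?ew w) \<le> 1 + ?n x * (1 + k)"
    proof -
      have "vsize (?ew w) \<le> 1 + length (map nv w) * (1 + k)"
      proof (rule vsize_ListV_le)
        fix v assume "v \<in> set (map nv w)"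
        then obtain i where "v = nv i" "i < k" using I by (auto simp: Inv_def s)
        then show "vsize v \<le> 1 + k" using vsize_IntV_le[of "int i"] by simp
      qed
      also have "\<dots> \<le> 1 + ?n x * (1 + k)" using I by (intro add_mono mult_right_mono) (auto simp: Inv_def s)
      finally show ?thesis .
    qed
    ultimately show "vsize (e s) \<le> 1 + (1 + ?n x) + (1 + U x + (1 + vsize (nv (a x)) + (1 + ?n x * (1 + k))))"
      unfolding e_def s pair_val_def[of nv "pair_val conf_val (pair_val nv ?ew)"]
        pair_val_def[of conf_val "pair_val nv ?ew"] pair_val_def[of nv ?ew] by simp
    show "e s = e (fin x (start x))" if "\<not> P x s"
    proof -
      have "fin x s = s" using that by (cases j) (auto simp: P_def s fin_def)
      then show ?thesis using I by (simp add: Inv_def s)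
    qed
    assume P: "P x s"
    note st = step[OF x I[unfolded s] P[unfolded s]]
    then show "fst (nx x s) < fst s" by (simp add: nx_def s)
    obtain j' where j': "j = Suc j'" using st by (cases j) auto
    have "fin x (nx x s) = fin x s"
      using P by (simp add: nx_def s fin_def j' P_def z_def wts_def Let_def)
    then show "Inv x (nx x s)"
      using I st j' by (auto simp: Inv_def nx_def s)
  qed (use less in \<open>auto simp: Inv_def start_def G_def sample_count_def conf_inside_init[OF given_instance[OF r]]\<close>)
  then have "ptime X \<mu> \<Gamma> (\<lambda>x. ?ew (snd (snd (snd (fin x (start x))))))"
    unfolding e_def by (intro ptime_snd)
  then show ?thesis
    by (simp add: fin_def start_def unrank_state_eq sample_word_def G_def word_val_eq)
qed

section \<open>Sampling by coin flips\<close>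

lemma nn_integral_measure_spmf_option:
  "nn_integral (measure_spmf p) g = (\<integral>\<^sup>+ x. (case x of None \<Rightarrow> 0 | Some y \<Rightarrow> g y) \<partial>measure_pmf p)"
  by (subst nn_integral_measure_spmf_conv_measure_pmf, simp, subst nn_integral_restrict_space)
     (auto intro!: nn_integral_cong split: option.split split_indicator)

lemma nn_integral_bind_spmf:
  "nn_integral (measure_spmf (bind_spmf p f)) g = (\<integral>\<^sup>+ x. nn_integral (measure_spmf (f x)) g \<partial>measure_spmf p)"
  unfolding nn_integral_measure_spmf_option bind_spmf_def nn_integral_bind_pmf
  by (auto intro!: nn_integral_cong split: option.split)

lemma spmf_bind_spmf_of_set:
  "spmf (bind_spmf (spmf_of_set A) f) x = (\<Sum>a\<in>A. spmf (f a) x) / real (card A)"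
  by (simp add: spmf_bind integral_spmf_of_set)

text \<open>Each element of either set receives half the reciprocal of the common cardinality, which
  is the reciprocal of the cardinality of the union.\<close>

lemma coin_bind_spmf_of_set:
  assumes "finite (A True)" "finite (A False)" "A True \<inter> A False = {}" "card (A True) = card (A False)"
  shows "bind_spmf coin_spmf (\<lambda>b. spmf_of_set (A b)) = spmf_of_set (A False \<union> A True)"
proof (rule spmf_eqI)
  fix x
  have "card (A False \<union> A True) = 2 * card (A True)"
    using assms by (subst card_Un_disjoint) auto
  moreover have "indicator (A False \<union> A True) x = (indicator (A False) x + indicator (A True) x :: real)"
    using assms(3) by (auto split: split_indicator)
  ultimately show "spmf (bind_spmf coin_spmf (\<lambda>b. spmf_of_set (A b))) x = spmf (spmf_of_set (A False \<union> A True)) x"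
    using assms(4) by (simp add: spmf_bind_spmf_of_set UNIV_bool spmf_of_set add_divide_distrib mult.commute)
qed

text \<open>In the state \<open>(2 ^ i, y)\<close> the first \<open>i\<close> bits are known; the
  remaining flips make the result uniform among the numbers with leading bits \<open>y\<close>. The
  time is a function of the result \<open>z\<close>, so that both together are the image of a
  uniform distribution.\<close>

lemma loop_draw:
  assumes c: "\<And>p y. y < p \<Longrightarrow> p < 2 * W \<Longrightarrow> \<exists>t \<le> K. c (e p y) = return_spmf (of_truth (p < W), t)"
    and f: "\<And>p y. y < p \<Longrightarrow> p < W \<Longrightarrow> \<exists>T. f (e p y) =
        bind_spmf coin_spmf (\<lambda>b. return_spmf (e (2 * p) (2 * y + of_bool b), T b)) \<and> (\<forall>b. T b \<le> K)"
    and e: "\<And>p y. y < p \<Longrightarrow> p < 2 * W \<Longrightarrow> vsize (e p y) \<le> K"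
    and n: "W \<le> 2 ^ n" "(2::nat) ^ n < 2 * W" "\<And>i. i < n \<Longrightarrow> 2 ^ i < W"
  shows "i \<le> n \<Longrightarrow> y < 2 ^ i \<Longrightarrow> \<exists>T. loop c f (e (2 ^ i) y) t =
      map_spmf (\<lambda>z. (e (2 ^ n) z, T z)) (spmf_of_set {y * 2 ^ (n - i)..<(y + 1) * 2 ^ (n - i)}) \<and>
      (\<forall>z. T z \<le> t + (n - i + 1) * (2 * K + 1))"
proof (induction "n - i" arbitrary: i y t)
  case 0
  then have i: "i = n" by simp
  have less: "y < 2 ^ n" using 0 i by simp
  obtain t1 where t1: "t1 \<le> K" "c (e (2 ^ n) y) = return_spmf (of_truth False, t1)"
    using c[OF less n(2)] n(1) by (auto simp: not_less)
  have "loop c f (e (2 ^ n) y) t = return_spmf (e (2 ^ n) y, t + t1 + 1 + vsize (e (2 ^ n) y))"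
    by (subst loop.simps) (simp add: t1 charge_def)
  moreover have "{y * 2 ^ (n - i)..<(y + 1) * 2 ^ (n - i)} = {y}" using i by auto
  ultimately show ?case
    using t1(1) e[OF less n(2)] i
    by (intro exI[of _ "\<lambda>_. t + t1 + 1 + vsize (e (2 ^ n) y)"]) (simp add: spmf_of_set_singleton)
next
  case (Suc d)
  then have i: "i < n" by simp
  have W: "(2::nat) ^ i < W" by (rule n(3)[OF i])
  obtain t1 where t1: "t1 \<le> K" "c (e (2 ^ i) y) = return_spmf (of_truth True, t1)"
    using c[of y "2 ^ i"] Suc.prems(2) W by auto
  obtain T where T: "f (e (2 ^ i) y) = bind_spmf coin_spmf (\<lambda>b. return_spmf (e (2 * 2 ^ i) (2 * y + of_bool b), T b))"
    "\<And>b. T b \<le> K" using f[of y "2 ^ i"] Suc.prems(2) W by auto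
  define A where "A b = {(2 * y + of_bool b) * 2 ^ (n - Suc i)..<(2 * y + of_bool b + 1) * 2 ^ (n - Suc i)}" for b
  have "\<forall>b. \<exists>U. loop c f (e (2 ^ Suc i) (2 * y + of_bool b)) (t + t1 + T b + 1) =
      map_spmf (\<lambda>z. (e (2 ^ n) z, U z)) (spmf_of_set (A b)) \<and>
      (\<forall>z. U z \<le> t + t1 + T b + 1 + (n - Suc i + 1) * (2 * K + 1))"
    unfolding A_def by (rule allI, rule Suc.hyps(1)) (use Suc.hyps(2) Suc.prems(2) i in \<open>auto simp: of_bool_def\<close>)
  from choice[OF this] obtain U where U: "\<And>b. loop c f (e (2 ^ Suc i) (2 * y + of_bool b)) (t + t1 + T b + 1) =
      map_spmf (\<lambda>z. (e (2 ^ n) z, U b z)) (spmf_of_set (A b))"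
    "\<And>b z. U b z \<le> t + t1 + T b + 1 + (n - Suc i + 1) * (2 * K + 1)" by blast
  \<comment> \<open>The two intervals are disjoint, so the first flip can be recovered from the
    result, and the time is still a function of it.\<close>
  define V where "V z = U (z \<in> A True) z" for z
  have disj: "A True \<inter> A False = {}" by (auto simp: A_def)
  have union: "A False \<union> A True = {y * 2 ^ (n - i)..<(y + 1) * 2 ^ (n - i)}"
  proof -
    have pow: "(2::nat) ^ (n - i) = 2 * 2 ^ (n - Suc i)" using i by (metis Suc_diff_Suc power_Suc)
    define m where "m = (2::nat) ^ (n - Suc i)"
    have "A False = {y * (2 * m)..<y * (2 * m) + m}" "A True = {y * (2 * m) + m..<y * (2 * m) + 2 * m}"
      by (auto simp: A_def m_def[symmetric] algebra_simps)
    then show ?thesis unfolding pow m_def[symmetric] by (auto simp: algebra_simps)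
  qed
  have "map_spmf (\<lambda>z. (e (2 ^ n) z, U b z)) (spmf_of_set (A b)) = map_spmf (\<lambda>z. (e (2 ^ n) z, V z)) (spmf_of_set (A b))" for b
    by (rule map_spmf_cong) (use disj in \<open>cases b; auto simp: V_def A_def split: if_splits\<close>)+
  then have "loop c f (e (2 ^ i) y) t =
      bind_spmf coin_spmf (\<lambda>b. map_spmf (\<lambda>z. (e (2 ^ n) z, V z)) (spmf_of_set (A b)))"
    using U(1) by (subst loop.simps) (simp add: t1 T(1))
  also have "\<dots> = map_spmf (\<lambda>z. (e (2 ^ n) z, V z)) (bind_spmf coin_spmf (\<lambda>b. spmf_of_set (A b)))"
    by (simp add: map_spmf_bind_spmf o_def)
  also have "bind_spmf coin_spmf (\<lambda>b. spmf_of_set (A b)) = spmf_of_set (A False \<union> A True)"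
    by (rule coin_bind_spmf_of_set[OF _ _ disj]) (auto simp: A_def)
  finally have "loop c f (e (2 ^ i) y) t = map_spmf (\<lambda>z. (e (2 ^ n) z, V z))
      (spmf_of_set {y * 2 ^ (n - i)..<(y + 1) * 2 ^ (n - i)})" by (simp only: union)
  moreover have "V z \<le> t + (n - i + 1) * (2 * K + 1)" for z
  proof -
    have "V z \<le> t + t1 + T (z \<in> A True) + 1 + (n - Suc i + 1) * (2 * K + 1)"
      unfolding V_def by (rule U(2))
    also have "\<dots> \<le> t + (2 * K + 1) + (n - Suc i + 1) * (2 * K + 1)"
      using t1(1) T(2)[of "z \<in> A True"] by simp
    also have "\<dots> = t + (Suc (n - Suc i) + 1) * (2 * K + 1)" by (simp add: algebra_simps)
    also have "Suc (n - Suc i) = n - i" using i by simp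
    finally show ?thesis .
  qed
  ultimately show ?case by (intro exI[of _ V] conjI allI)
qed

text \<open>Each round of the rejection loop fails with probability at most 1/2. Hence the distance of
  the outcome to the uniform distribution, as well as the excess of the expected time, truncated
  at a constant, over its bound, are at most halved by unfolding the loop once.\<close>

context
  fixes W N K :: nat and c f :: "val \<Rightarrow> (val \<times> nat) spmf"
  assumes W: "0 < W" and N: "W \<le> N" "N < 2 * W"
    and c: "\<And>x. x < 2 * W \<Longrightarrow> \<exists>t \<le> K. c (nv x) = return_spmf (of_truth (\<not> x < W), t)"
    and f: "\<And>x. x < 2 * W \<Longrightarrow> \<exists>T. f (nv x) = map_spmf (\<lambda>z. (nv z, T z)) (spmf_of_set {..<N}) \<and> (\<forall>z. T z \<le> K)"
    and size: "\<And>x. x < 2 * W \<Longrightarrow> vsize (nv x) \<le> K"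
begin

lemma reject_accepted:
  assumes "x < W"
  shows "\<exists>t' \<le> t + (2 * K + 1). loop c f (nv x) t = return_spmf (nv x, t')"
proof -
  have x: "x < 2 * W" using assms by simp
  obtain t1 where t1: "t1 \<le> K" "c (nv x) = return_spmf (of_truth False, t1)"
    using c[OF x] assms by auto
  have "loop c f (nv x) t = return_spmf (nv x, t + t1 + 1 + vsize (nv x))"
    by (subst loop.simps) (simp add: t1 charge_def)
  then show ?thesis using t1(1) size[OF x] by (intro exI[of _ "t + t1 + 1 + vsize (nv x)"]) (simp del: vsize.simps)
qed

lemma reject_rejected:
  assumes "W \<le> x" "x < 2 * W"
  shows "\<exists>\<tau>. (\<forall>z. \<tau> z \<le> t + (2 * K + 1)) \<and>
    loop c f (nv x) t = bind_spmf (spmf_of_set {..<N}) (\<lambda>z. loop c f (nv z) (\<tau> z))"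
proof -
  obtain t1 where t1: "t1 \<le> K" "c (nv x) = return_spmf (of_truth True, t1)"
    using c[OF assms(2)] assms by auto
  obtain T where T: "f (nv x) = map_spmf (\<lambda>z. (nv z, T z)) (spmf_of_set {..<N})" "\<forall>z. T z \<le> K"
    using f[OF assms(2)] by blast
  have "loop c f (nv x) t = bind_spmf (spmf_of_set {..<N}) (\<lambda>z. loop c f (nv z) (t + t1 + T z + 1))"
    by (subst loop.simps) (simp add: t1 T map_spmf_conv_bind_spmf)
  moreover have "t + t1 + T z + 1 \<le> t + (2 * K + 1)" for z using t1(1) spec[OF T(2), of z] by linarith
  ultimately show ?thesis
    by (intro exI[of _ "\<lambda>z. t + t1 + T z + 1"]) blast
qed

lemma N_pos: "0 < N"
  using W N by simp

text \<open>Accepted draws contribute exactly \<open>W * ?g\<close>, so any error stems from draws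
  in \<open>{W..<N}\<close>, which restart the same loop.\<close>

lemma reject_outcome_halving:
  "W \<le> x \<Longrightarrow> x < 2 * W \<Longrightarrow>
   \<bar>spmf (map_spmf fst (loop c f (nv x) t)) v - spmf (map_spmf nv (spmf_of_set {..<W})) v\<bar> \<le> (1 / 2) ^ n"
proof (induction n arbitrary: x t)
  case 0
  have "\<bar>a - b\<bar> \<le> 1" if "0 \<le> a" "a \<le> 1" "0 \<le> b" "b \<le> 1" for a b :: real using that by linarith
  then show ?case by (simp add: pmf_le_1)
next
  case (Suc n)
  let ?g = "spmf (map_spmf nv (spmf_of_set {..<W})) v"
  obtain \<tau> where eq: "loop c f (nv x) t = bind_spmf (spmf_of_set {..<N}) (\<lambda>z. loop c f (nv z) (\<tau> z))"
    using reject_rejected[OF Suc.prems] by blast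
  define q where "q z = spmf (map_spmf fst (loop c f (nv z) (\<tau> z))) v" for z
  have "spmf (map_spmf fst (loop c f (nv x) t)) v = (\<Sum>z<N. q z) / N"
    by (simp add: eq map_spmf_bind_spmf o_def spmf_bind_spmf_of_set q_def)
  also have "(\<Sum>z<N. q z) = (\<Sum>z<W. q z) + (\<Sum>z=W..<N. q z)"
    using N(1) by (simp add: lessThan_atLeast0 sum.atLeastLessThan_concat)
  also have "(\<Sum>z<W. q z) = W * ?g"
  proof -
    have "q z = spmf (return_spmf (nv z)) v" if "z < W" for z
      using reject_accepted[OF that, of "\<tau> z"] by (auto simp: q_def)
    then have "(\<Sum>z<W. q z) = (\<Sum>z<W. spmf (return_spmf (nv z)) v)" by (intro sum.cong) auto
    then show ?thesis using W by (simp add: map_spmf_conv_bind_spmf spmf_bind_spmf_of_set)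
  qed
  finally have "spmf (map_spmf fst (loop c f (nv x) t)) v - ?g = (\<Sum>z=W..<N. q z - ?g) / N"
    using N_pos N(1) by (simp add: sum_subtractf field_simps of_nat_diff)
  also have "\<bar>\<dots>\<bar> \<le> (\<Sum>z=W..<N. (1 / 2) ^ n) / N"
  proof -
    have "\<bar>\<Sum>z=W..<N. q z - ?g\<bar> \<le> (\<Sum>z=W..<N. \<bar>q z - ?g\<bar>)" by (rule sum_abs)
    also have "\<dots> \<le> (\<Sum>z=W..<N. (1 / 2) ^ n)"
      unfolding q_def by (intro sum_mono Suc.IH) (use N in auto)
    finally show ?thesis by (simp add: divide_right_mono)
  qed
  also have "\<dots> = (real (N - W) / N) * (1 / 2) ^ n" by simp
  \<comment> \<open>Here \<open>N < 2 * W\<close> enters: fewer than half of the draws are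
    rejected.\<close>
  also have "\<dots> \<le> (1 / 2) * (1 / 2) ^ n"
    using N N_pos by (intro mult_right_mono) (auto simp: field_simps of_nat_diff)
  finally show ?case by simp
qed

text \<open>The start value \<open>W\<close> is itself rejected, which forces a first draw. The
  halved bounds tend to 0, and equality with a full distribution includes termination with
  probability 1.\<close>

lemma reject_outcome: "map_spmf fst (loop c f (nv W) t) = map_spmf nv (spmf_of_set {..<W})"
proof (rule spmf_eqI)
  fix v
  let ?d = "\<bar>spmf (map_spmf fst (loop c f (nv W) t)) v - spmf (map_spmf nv (spmf_of_set {..<W})) v\<bar>"
  have "?d \<le> (1 / 2) ^ n" for n by (rule reject_outcome_halving) (use W in auto)
  moreover have "(\<lambda>n. (1 / 2 :: real) ^ n) \<longlonglongrightarrow> 0" by (rule LIMSEQ_realpow_zero) auto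
  ultimately have "?d \<le> 0" by (intro LIMSEQ_le_const[of "\<lambda>n. (1 / 2 :: real) ^ n"]) auto
  then show "spmf (map_spmf fst (loop c f (nv W) t)) v = spmf (map_spmf nv (spmf_of_set {..<W})) v" by simp
qed

text \<open>Truncation at \<open>M\<close> makes the excess finite before any unfolding; otherwise
  there would be no start for halving it.\<close>

lemma reject_time_halving:
  "W \<le> x \<Longrightarrow> x < 2 * W \<Longrightarrow>
   (\<integral>\<^sup>+ z. of_nat (min (snd z) M) \<partial>measure_spmf (loop c f (nv x) t))
     \<le> ennreal (real t + 4 * real (2 * K + 1) + real M * (1 / 2) ^ n)"
proof (induction n arbitrary: x t)
  case 0
  have "(\<integral>\<^sup>+ z. of_nat (min (snd z) M) \<partial>measure_spmf (loop c f (nv x) t))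
      \<le> (\<integral>\<^sup>+ z. of_nat M \<partial>measure_spmf (loop c f (nv x) t))"
    by (intro nn_integral_mono) simp
  also have "\<dots> \<le> of_nat M * 1"
    by (simp add: mult_left_le measure_spmf.subprob_emeasure_le_1)
  also have "\<dots> = ennreal (real M)" by (simp add: ennreal_of_nat_eq_real_of_nat)
  also have "\<dots> \<le> ennreal (real t + 4 * real (2 * K + 1) + real M * (1 / 2) ^ 0)" by (intro ennreal_leI) simp
  finally show ?case .
next
  case (Suc n)
  define H where "H = real (2 * K + 1)"
  have H: "0 \<le> H" by (simp add: H_def)
  obtain \<tau> where \<tau>: "\<And>z. \<tau> z \<le> t + (2 * K + 1)"
    and eq: "loop c f (nv x) t = bind_spmf (spmf_of_set {..<N}) (\<lambda>z. loop c f (nv z) (\<tau> z))"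
    using reject_rejected[OF Suc.prems] by blast
  have \<tau>': "real (\<tau> z) \<le> real t + H" for z using \<tau>[of z] unfolding H_def by linarith
  \<comment> \<open>A draw is reached after at most \<open>H\<close>. Accepting it takes at most
    another \<open>H\<close>; a rejected one costs \<open>4 * H\<close> and the excess by
    induction.\<close>
  define a where "a z = (if z < W then real t + 2 * H else real t + 5 * H + real M * (1 / 2) ^ n)" for z
  have a_nonneg: "0 \<le> a z" for z using H by (simp add: a_def)
  have "(\<integral>\<^sup>+ z. of_nat (min (snd z) M) \<partial>measure_spmf (loop c f (nv x) t))
      = (\<Sum>z<N. \<integral>\<^sup>+ z. of_nat (min (snd z) M) \<partial>measure_spmf (loop c f (nv z) (\<tau> z))) / of_nat N"
    unfolding eq nn_integral_bind_spmf by (simp add: nn_integral_spmf_of_set ennreal_of_nat_eq_real_of_nat)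
  also have "\<dots> \<le> (\<Sum>z<N. ennreal (a z)) / of_nat N"
  proof (intro divide_right_mono_ennreal sum_mono)
    fix z assume z: "z \<in> {..<N}"
    show "(\<integral>\<^sup>+ z. of_nat (min (snd z) M) \<partial>measure_spmf (loop c f (nv z) (\<tau> z))) \<le> ennreal (a z)"
    proof (cases "z < W")
      case True
      then obtain t' where t': "t' \<le> \<tau> z + (2 * K + 1)" "loop c f (nv z) (\<tau> z) = return_spmf (nv z, t')"
        using reject_accepted by blast
      have "t' \<le> t + 2 * (2 * K + 1)" by (rule order_trans[OF t'(1)]) (use \<tau>[of z] in simp)
      then have "real t' \<le> real (t + 2 * (2 * K + 1))" by (simp only: of_nat_le_iff)
      then have "real t' \<le> real t + 2 * H" by (simp add: H_def)
      then have "ennreal (real (min t' M)) \<le> ennreal (a z)"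
        using True by (intro ennreal_leI) (auto simp: a_def)
      then show ?thesis by (simp add: t'(2) nn_integral_measure_spmf_option ennreal_of_nat_eq_real_of_nat)
    next
      case False
      have "(\<integral>\<^sup>+ z. of_nat (min (snd z) M) \<partial>measure_spmf (loop c f (nv z) (\<tau> z)))
          \<le> ennreal (real (\<tau> z) + 4 * real (2 * K + 1) + real M * (1 / 2) ^ n)"
        by (rule Suc.IH) (use False z N in auto)
      also have "\<dots> \<le> ennreal (a z)"
        using False \<tau>'[of z] unfolding H_def[symmetric] by (intro ennreal_leI) (simp add: a_def)
      finally show ?thesis .
    qed
  qed
  also have "\<dots> = ennreal ((\<Sum>z<N. a z) / real N)"
    using a_nonneg N_pos by (simp add: sum_ennreal divide_ennreal sum_nonneg ennreal_of_nat_eq_real_of_nat)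
  also have "\<dots> \<le> ennreal (real t + 4 * real (2 * K + 1) + real M * (1 / 2) ^ Suc n)"
  proof (rule ennreal_leI)
    have "(\<Sum>z<N. a z) = (\<Sum>z<W. a z) + (\<Sum>z=W..<N. a z)"
      using N(1) by (simp add: lessThan_atLeast0 sum.atLeastLessThan_concat)
    also have "\<dots> = real W * (real t + 2 * H) + real (N - W) * (real t + 5 * H + real M * (1 / 2) ^ n)"
      by (simp add: a_def)
    also have "\<dots> = real N * real t + (5 * real N - 3 * real W) * H + (real N - real W) * (real M * (1 / 2) ^ n)"
      using N(1) by (simp add: of_nat_diff algebra_simps)
    \<comment> \<open>\<open>5 * N - 3 * W \<le> 4 * N\<close> since \<open>N \<le> 3 * W\<close>,
      so the constant 4 reproduces itself; the excess is multiplied by \<open>(N - W) / N\<close>,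
      less than one half.\<close>
    also have "\<dots> \<le> real N * real t + (4 * real N) * H + (real N / 2) * (real M * (1 / 2) ^ n)"
      using N H by (intro add_mono mult_right_mono) auto
    also have "\<dots> = (real t + 4 * H + real M * (1 / 2) ^ Suc n) * real N" by (simp add: algebra_simps)
    finally show "(\<Sum>z<N. a z) / real N \<le> real t + 4 * real (2 * K + 1) + real M * (1 / 2) ^ Suc n"
      using N_pos unfolding H_def by (simp add: pos_divide_le_eq)
  qed
  finally show ?case .
qed

text \<open>The number \<open>n\<close> of unfoldings tends to infinity for fixed \<open>M\<close>,
  and then \<open>M\<close> does, by monotone convergence.\<close>

lemma reject_time:
  "(\<integral>\<^sup>+ z. of_nat (snd z) \<partial>measure_spmf (loop c f (nv W) t)) \<le> of_nat (t + 4 * (2 * K + 1))"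
proof -
  let ?p = "measure_spmf (loop c f (nv W) t)"
  have trunc: "(\<integral>\<^sup>+ z. of_nat (min (snd z) M) \<partial>?p) \<le> of_nat (t + 4 * (2 * K + 1))" for M
  proof (rule LIMSEQ_le_const)
    have "(\<lambda>n. real t + 4 * real (2 * K + 1) + real M * (1 / 2) ^ n) \<longlonglongrightarrow> real t + 4 * real (2 * K + 1) + real M * 0"
      by (intro tendsto_intros LIMSEQ_realpow_zero) auto
    from tendsto_ennrealI[OF this]
    show "(\<lambda>n. ennreal (real t + 4 * real (2 * K + 1) + real M * (1 / 2) ^ n)) \<longlonglongrightarrow> of_nat (t + 4 * (2 * K + 1))"
      by (simp add: ennreal_of_nat_eq_real_of_nat)
    show "\<exists>n0. \<forall>n\<ge>n0. (\<integral>\<^sup>+ z. of_nat (min (snd z) M) \<partial>?p) \<le> ennreal (real t + 4 * real (2 * K + 1) + real M * (1 / 2) ^ n)"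
      using W by (intro exI allI impI reject_time_halving) auto
  qed
  have SUP: "(of_nat s :: ennreal) = (SUP M. of_nat (min s M))" for s
    by (rule antisym) (auto intro!: SUP_upper2[of s] SUP_least)
  have "(\<integral>\<^sup>+ z. of_nat (snd z) \<partial>?p) = (\<integral>\<^sup>+ z. (SUP M. of_nat (min (snd z) M)) \<partial>?p)"
    by (rule nn_integral_cong) (rule SUP)
  also have "\<dots> = (SUP M. \<integral>\<^sup>+ z. of_nat (min (snd z) M) \<partial>?p)"
    by (rule nn_integral_monotone_convergence_SUP) (auto intro!: incseq_SucI le_funI of_nat_mono)
  also have "\<dots> \<le> of_nat (t + 4 * (2 * K + 1))" by (rule SUP_least) (rule trunc)
  finally show ?thesis .
qed

end

lemma vsize_nat_double: "n < 2 * W \<Longrightarrow> vsize (nv n) \<le> vsize (nv W) + 3"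
proof -
  assume "n < 2 * W"
  then have "vsize (nv n) \<le> vsize (IntV (2 * int W))" by (intro vsize_IntV_mono) simp
  also have "\<dots> \<le> vsize (IntV 2) + vsize (nv W)" by (rule vsize_IntV_mult)
  also have "vsize (IntV 2) \<le> 1 + 2" by (subst vsize_IntV_le_iff) simp
  finally show ?thesis by simp
qed

text \<open>By minimality half of the power is still below \<open>W\<close>, which keeps the
  probability of rejection below one half.\<close>

lemma least_power_exists:
  assumes "0 < W"
  obtains n where "W \<le> 2 ^ n" "(2::nat) ^ n < 2 * W" "\<And>i. i < n \<Longrightarrow> 2 ^ i < W" "n \<le> vsize (nv W)"
proof -
  define n where "n = (LEAST n. W \<le> 2 ^ n)"
  have "W \<le> 2 ^ W" by (rule less_imp_le[OF less_exp])
  then have n: "W \<le> 2 ^ n" unfolding n_def by (rule LeastI)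
  have less: "2 ^ i < W" if "i < n" for i
    using not_less_Least[OF that[unfolded n_def]] by simp
  have "(2::nat) ^ n < 2 * W" using less[of "n - 1"] assms by (cases n) auto
  moreover have "n \<le> vsize (nv W)"
  proof (rule ccontr)
    assume "\<not> n \<le> vsize (nv W)"
    then have "2 ^ vsize (nv W) < W" by (intro less) simp
    with nat_less_vsize[of W] show False by simp
  qed
  ultimately show ?thesis using that n less by blast
qed

text \<open>\<open>ptime\<close> covers deterministic programs only. The sampler is therefore
  assembled by hand from deterministic parts, \<open>Flip\<close>, and two nested loops, the inner
  one drawing bits and the outer one rejecting.\<close>

lemma sampler_exists:
  "\<exists>s d. \<forall>W rest. 0 < W \<longrightarrow>
     map_spmf fst (eval s (nv W # rest)) = map_spmf nv (spmf_of_set {..<W}) \<and>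
     (\<integral>\<^sup>+ z. of_nat (snd z) \<partial>measure_spmf (eval s (nv W # rest))) \<le> of_nat ((vsize (nv W) + 2) ^ d)"
proof -
  \<comment> \<open>Indices \<open>((p, y), (x, W))\<close>: the state of the inner loop, the last
    draw of the outer loop, and \<open>W\<close>. All are below \<open>2 * W\<close> or equal to
    \<open>W\<close>, so every size is linear in that of \<open>W\<close>.\<close>
  define X where "X = {i :: (nat \<times> nat) \<times> nat \<times> nat. fst (fst i) < 2 * snd (snd i) \<and>
     snd (fst i) < fst (fst i) \<and> fst (snd i) < 2 * snd (snd i)}"
  define \<Gamma> :: "((nat \<times> nat) \<times> nat \<times> nat \<Rightarrow> val) list"
    where "\<Gamma> = [\<lambda>i. pair_val nv nv (fst i), \<lambda>i. nv (fst (snd i)), \<lambda>i. nv (snd (snd i))]"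
  have st: "ptime A (\<lambda>_. 0) \<Gamma> (\<lambda>i. pair_val nv nv (fst i))"
    and x: "ptime A (\<lambda>_. 0) \<Gamma> (\<lambda>i. nv (fst (snd i)))"
    and W: "ptime A (\<lambda>_. 0) \<Gamma> (\<lambda>i. nv (snd (snd i)))" for A
    by (rule ptime_var; simp add: \<Gamma>_def)+
  have env: "map (\<lambda>g. g i) \<Gamma> @ rest = ListV [nv (fst (fst i)), nv (snd (fst i))] # nv (fst (snd i)) # nv (snd (snd i)) # rest" for i rest
    by (simp add: \<Gamma>_def pair_val_def)
  define \<omega> where "\<omega> = (\<lambda>W. vsize (nv W))"
  have csize: "csize (\<lambda>_. 0) \<Gamma> i + 2 \<le> 4 * \<omega> (snd (snd i)) + 12" if "i \<in> X" for i
    using that vsize_nat_double[of "fst (fst i)" "snd (snd i)"] vsize_nat_double[of "snd (fst i)" "snd (snd i)"]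
      vsize_nat_double[of "fst (snd i)" "snd (snd i)"]
    by (simp add: \<Gamma>_def X_def pair_val_def \<omega>_def del: vsize.simps(1))
  have "ptime X (\<lambda>_. 0) \<Gamma> (\<lambda>i. of_truth (fst (fst i) < snd (snd i)))"
    by (intro ptime_nat_less ptime_fst[OF st] W)
  from this[unfolded ptime_def] obtain pc d1 where pc [rule_format]: "\<forall>i\<in>X. \<forall>rest.
     \<exists>t. t \<le> (csize (\<lambda>_. 0) \<Gamma> i + 2) ^ d1 \<and> vsize (of_truth (fst (fst i) < snd (snd i))) \<le> t \<and>
     eval pc (map (\<lambda>g. g i) \<Gamma> @ rest) = return_spmf (of_truth (fst (fst i) < snd (snd i)), t)"
    by blast
  have "ptime X (\<lambda>_. 0) \<Gamma> (\<lambda>i. nv (2 * fst (fst i)))"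
    by (intro ptime_nat_mult ptime_fst[OF st] ptime_const)
  from this[unfolded ptime_def] obtain q1 d2 where q1 [rule_format]: "\<forall>i\<in>X. \<forall>rest.
     \<exists>t. t \<le> (csize (\<lambda>_. 0) \<Gamma> i + 2) ^ d2 \<and> vsize (nv (2 * fst (fst i))) \<le> t \<and>
     eval q1 (map (\<lambda>g. g i) \<Gamma> @ rest) = return_spmf (nv (2 * fst (fst i)), t)"
    by blast
  have "ptime X (\<lambda>_. 0) \<Gamma> (\<lambda>i. nv (2 * snd (fst i)))"
    by (intro ptime_nat_mult ptime_snd[OF st] ptime_const)
  from this[unfolded ptime_def] obtain q2 d3 where q2 [rule_format]: "\<forall>i\<in>X. \<forall>rest.
     \<exists>t. t \<le> (csize (\<lambda>_. 0) \<Gamma> i + 2) ^ d3 \<and> vsize (nv (2 * snd (fst i))) \<le> t \<and>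
     eval q2 (map (\<lambda>g. g i) \<Gamma> @ rest) = return_spmf (nv (2 * snd (fst i)), t)"
    by blast
  have "ptime X (\<lambda>_. 0) \<Gamma> (\<lambda>i. nv (snd (fst i)))" by (rule ptime_snd[OF st])
  from this[unfolded ptime_def] obtain q3 d4 where q3 [rule_format]: "\<forall>i\<in>X. \<forall>rest.
     \<exists>t. t \<le> (csize (\<lambda>_. 0) \<Gamma> i + 2) ^ d4 \<and> vsize (nv (snd (fst i))) \<le> t \<and>
     eval q3 (map (\<lambda>g. g i) \<Gamma> @ rest) = return_spmf (nv (snd (fst i)), t)"
    by blast
  let ?\<Delta> = "[\<lambda>i. nv (fst (snd i)), \<lambda>i. nv (snd (snd i))] :: ((nat \<times> nat) \<times> nat \<times> nat \<Rightarrow> val) list"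
  have "ptime X (\<lambda>_. 0) ?\<Delta> (\<lambda>i. of_truth (\<not> fst (snd i) < snd (snd i)))"
    by (intro ptime_not ptime_nat_less ptime_head ptime_second)
  from this[unfolded ptime_def] obtain po d5 where po [rule_format]: "\<forall>i\<in>X. \<forall>rest.
     \<exists>t. t \<le> (csize (\<lambda>_. 0) ?\<Delta> i + 2) ^ d5 \<and> vsize (of_truth (\<not> fst (snd i) < snd (snd i))) \<le> t \<and>
     eval po (map (\<lambda>g. g i) ?\<Delta> @ rest) = return_spmf (of_truth (\<not> fst (snd i) < snd (snd i)), t)"
    by blast
  \<comment> \<open>One exponent for all five subprograms; the 1 makes the common bound cover linear
    terms.\<close>
  define D where "D = 1 + d1 + d2 + d3 + d4 + d5"
  define B where "B = (\<lambda>W. (4 * \<omega> W + 12) ^ D)"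
  have le_B: "t \<le> B (snd (snd i))" if "t \<le> (csize (\<lambda>_. 0) \<Gamma> i + 2) ^ d" "i \<in> X" "d \<le> D" for t i d
  proof -
    have "t \<le> (4 * \<omega> (snd (snd i)) + 12) ^ d"
      using that(1) power_mono[OF csize[OF that(2)], of d] by linarith
    also have "\<dots> \<le> B (snd (snd i))" unfolding B_def using that(3) by (intro power_increasing) auto
    finally show ?thesis .
  qed
  have linear_le_B: "4 * \<omega> W + 12 \<le> B W" for W
  proof -
    have "(4 * \<omega> W + 12) ^ 1 \<le> B W" unfolding B_def D_def by (intro power_increasing) auto
    then show ?thesis by simp
  qed
  define K1 where "K1 = (\<lambda>W. 4 * B W)"
  define K2 where "K2 = (\<lambda>W. 5 + (\<omega> W + 1) * (2 * K1 W + 1) + 2 * B W + 1)"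
  define flip where "flip = Binop OpCons q1 (Binop OpCons (Binop OpAdd q2 Flip) (Const (ListV [])))"
  \<comment> \<open>The initial state, \<open>p = 1\<close> and \<open>y = 0\<close>, stands for the
    empty string of bits.\<close>
  define draw where "draw = Bind (While (Const (ListV [IntV 1, IntV 0])) pc flip) q3"
  define s where "s = While (Var 0) po draw"
  let ?e = "\<lambda>p y. ListV [nv p, nv y]"
  have draw: "\<exists>n T. W \<le> 2 ^ n \<and> 2 ^ n < 2 * W \<and>
      (\<forall>x<2 * W. eval draw (nv x # nv W # rest) = map_spmf (\<lambda>z. (nv z, T x z)) (spmf_of_set {..<2 ^ n}) \<and>
        (\<forall>z. T x z \<le> K2 W))" if W: "0 < W" for W :: nat and rest
  proof -
    obtain n where n: "W \<le> 2 ^ n" "(2::nat) ^ n < 2 * W" "\<And>i. i < n \<Longrightarrow> 2 ^ i < W" "n \<le> \<omega> W"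
      using least_power_exists[OF W] unfolding \<omega>_def by blast
    have "\<exists>T. eval draw (nv x # nv W # rest) = map_spmf (\<lambda>z. (nv z, T z)) (spmf_of_set {..<2 ^ n}) \<and>
        (\<forall>z. T z \<le> K2 W)" if x: "x < 2 * W" for x
    proof -
      let ?env = "nv x # nv W # rest"
      have X: "((p, y), (x, W)) \<in> X" if "y < p" "p < 2 * W" for p y using that x by (simp add: X_def)
      \<comment> \<open>The 5 is the time for the initial constant, 1 plus its size 4.\<close>
      have "\<exists>T. loop (\<lambda>v. eval pc (v # ?env)) (\<lambda>v. eval flip (v # ?env)) (?e (2 ^ 0) 0) 5 =
          map_spmf (\<lambda>z. (?e (2 ^ n) z, T z)) (spmf_of_set {0 * 2 ^ (n - 0)..<(0 + 1) * 2 ^ (n - 0)}) \<and>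
          (\<forall>z. T z \<le> 5 + (n - 0 + 1) * (2 * K1 W + 1))"
      proof (rule loop_draw[where e = ?e, OF _ _ _ n(1-3)])
        fix p y :: nat assume y: "y < p" and p: "p < 2 * W"
        note i = X[OF y p]
        obtain t where t: "t \<le> (csize (\<lambda>_. 0) \<Gamma> ((p, y), (x, W)) + 2) ^ d1"
          "eval pc (?e p y # ?env) = return_spmf (of_truth (p < W), t)"
          using pc[OF i, of rest] unfolding env by auto
        have "t \<le> B W" using le_B[OF t(1) i] by (simp add: D_def)
        then have "t \<le> K1 W" unfolding K1_def by linarith
        with t(2) show "\<exists>t\<le>K1 W. eval pc (?e p y # ?env) = return_spmf (of_truth (p < W), t)"
          by (intro exI[of _ t] conjI)
        have "vsize (?e p y) \<le> 4 * \<omega> W + 12"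
          using vsize_nat_double[of p W] vsize_nat_double[of y W] y p by (simp add: \<omega>_def del: vsize.simps(1))
        with linear_le_B[of W] show "vsize (?e p y) \<le> K1 W" unfolding K1_def by linarith
      next
        fix p y :: nat assume y: "y < p" and p: "p < W"
        have p2: "p < 2 * W" using p by simp
        note i = X[OF y p2]
        obtain t1 where t1: "t1 \<le> (csize (\<lambda>_. 0) \<Gamma> ((p, y), (x, W)) + 2) ^ d2"
          "eval q1 (?e p y # ?env) = return_spmf (nv (2 * p), t1)"
          using q1[OF i, of rest] unfolding env by auto
        have t1B: "t1 \<le> B W" using le_B[OF t1(1) i] by (simp add: D_def)
        obtain t2 where t2: "t2 \<le> (csize (\<lambda>_. 0) \<Gamma> ((p, y), (x, W)) + 2) ^ d3"
          "eval q2 (?e p y # ?env) = return_spmf (nv (2 * y), t2)"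
          using q2[OF i, of rest] unfolding env by auto
        have t2B: "t2 \<le> B W" using le_B[OF t2(1) i] by (simp add: D_def)
        have bit: "the_int (of_truth b) = of_bool b" for b
          by (simp add: of_truth_def)
        define T where "T b = t1 + (t2 + (1 + vsize (of_truth b)) + 1 + vsize (nv (2 * y + of_bool b)) + 2 + 1 +
            (1 + vsize (nv (2 * y + of_bool b)))) + 1 + (1 + vsize (nv (2 * p)) + vsize (nv (2 * y + of_bool b)))" for b
        have "eval flip (?e p y # ?env) =
            bind_spmf coin_spmf (\<lambda>b. return_spmf (?e (2 * p) (2 * y + of_bool b), T b))"
          unfolding flip_def T_def by (simp add: t1(2) t2(2) charge_def bit add_ac del: vsize.simps(1))
        moreover have "T b \<le> K1 W" for b
        proof -
          have "vsize (nv (2 * y + of_bool b)) \<le> \<omega> W + 3" "vsize (nv (2 * p)) \<le> \<omega> W + 3"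
            unfolding \<omega>_def by (rule vsize_nat_double, use y p in \<open>simp add: of_bool_def\<close>)+
          moreover have "vsize (of_truth b) \<le> 1 + 1"
            unfolding of_truth_def by (subst vsize_IntV_le_iff) simp
          ultimately show ?thesis using t1B t2B linear_le_B[of W] unfolding T_def K1_def by linarith
        qed
        ultimately show "\<exists>T. eval flip (?e p y # ?env) =
            bind_spmf coin_spmf (\<lambda>b. return_spmf (?e (2 * p) (2 * y + of_bool b), T b)) \<and> (\<forall>b. T b \<le> K1 W)"
          by blast
      qed auto
      then obtain T where T: "loop (\<lambda>v. eval pc (v # ?env)) (\<lambda>v. eval flip (v # ?env)) (?e 1 0) 5 =
          map_spmf (\<lambda>z. (?e (2 ^ n) z, T z)) (spmf_of_set {..<2 ^ n})"
        "\<And>z. T z \<le> 5 + (n + 1) * (2 * K1 W + 1)" by (auto simp: lessThan_atLeast0)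
      have five: "0 + 1 + vsize (ListV [IntV 1, IntV 0]) = 5"
        by (simp add: floorlog_def)
      have "\<exists>t. t \<le> B W \<and> vsize (nv z) \<le> t \<and> eval q3 (?e (2 ^ n) z # ?env) = return_spmf (nv z, t)"
        if z: "z < 2 ^ n" for z
      proof -
        note i = X[OF z n(2)]
        obtain t where t: "t \<le> (csize (\<lambda>_. 0) \<Gamma> ((2 ^ n, z), (x, W)) + 2) ^ d4" "vsize (nv z) \<le> t"
          "eval q3 (?e (2 ^ n) z # ?env) = return_spmf (nv z, t)"
          using q3[OF i, of rest] unfolding env by auto
        have "t \<le> B W" using le_B[OF t(1) i] by (simp add: D_def)
        with t show ?thesis by blast
      qed
      then obtain t3 where t3: "\<And>z. z < 2 ^ n \<Longrightarrow> t3 z \<le> B W \<and> vsize (nv z) \<le> t3 z \<and>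
          eval q3 (?e (2 ^ n) z # ?env) = return_spmf (nv z, t3 z)" by metis
      \<comment> \<open>The value 0 outside the range of the draw is arbitrary and only lets the
        bound hold for all \<open>z\<close>.\<close>
      define V where "V z = (if z < 2 ^ n then T z + t3 z + 1 + vsize (nv z) else 0)" for z
      have "eval draw ?env = bind_spmf (spmf_of_set {..<2 ^ n}) (\<lambda>z.
          bind_spmf (eval q3 (?e (2 ^ n) z # ?env)) (\<lambda>(w, t2). charge (T z + t2) w))"
        using T(1) five unfolding draw_def by (simp add: charge_def map_spmf_conv_bind_spmf del: vsize.simps)
      also have "\<dots> = bind_spmf (spmf_of_set {..<2 ^ n}) (\<lambda>z. return_spmf (nv z, V z))"
        by (rule bind_spmf_cong) (use t3 in \<open>auto simp: V_def charge_def\<close>)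
      finally have "eval draw ?env = map_spmf (\<lambda>z. (nv z, V z)) (spmf_of_set {..<2 ^ n})"
        by (simp add: map_spmf_conv_bind_spmf)
      moreover have "V z \<le> K2 W" for z
      proof (cases "z < 2 ^ n")
        case True
        have "(n + 1) * (2 * K1 W + 1) \<le> (\<omega> W + 1) * (2 * K1 W + 1)" using n(4) by (intro mult_le_mono1) simp
        then show ?thesis using t3[OF True] T(2)[of z] True unfolding V_def K2_def by simp
      qed (simp add: V_def)
      ultimately show ?thesis by blast
    qed
    then have "\<exists>T. \<forall>x<2 * W. eval draw (nv x # nv W # rest) = map_spmf (\<lambda>z. (nv z, T x z)) (spmf_of_set {..<2 ^ n}) \<and>
        (\<forall>z. T x z \<le> K2 W)" by metis
    with n show ?thesis by blast
  qed
  have main: "map_spmf fst (eval s (nv W # rest)) = map_spmf nv (spmf_of_set {..<W}) \<and>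
     (\<integral>\<^sup>+ z. of_nat (snd z) \<partial>measure_spmf (eval s (nv W # rest))) \<le> of_nat (1 + \<omega> W + 4 * (2 * K2 W + 1))"
    if W: "0 < W" for W rest
  proof -
    obtain n T where n: "W \<le> 2 ^ n" "2 ^ n < 2 * W"
      and T: "\<And>x. x < 2 * W \<Longrightarrow> eval draw (nv x # nv W # rest) = map_spmf (\<lambda>z. (nv z, T x z)) (spmf_of_set {..<2 ^ n})"
        "\<And>x z. x < 2 * W \<Longrightarrow> T x z \<le> K2 W"
      using draw[OF W, of rest] by blast
    have eval_s: "eval s (nv W # rest) =
        loop (\<lambda>v. eval po (v # nv W # rest)) (\<lambda>v. eval draw (v # nv W # rest)) (nv W) (1 + \<omega> W)"
      by (simp add: s_def charge_def \<omega>_def)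
    have po': "\<exists>t\<le>K2 W. eval po (nv x # nv W # rest) = return_spmf (of_truth (\<not> x < W), t)" if x: "x < 2 * W" for x
    proof -
      \<comment> \<open>The outer test ignores the inner state, so \<open>(1, 0)\<close> is a
        placeholder that completes the index.\<close>
      have "1 < 2 * W" using W by linarith
      then have i: "((1, 0), (x, W)) \<in> X" using x by (simp add: X_def)
      obtain t where t: "t \<le> (csize (\<lambda>_. 0) ?\<Delta> ((1, 0), (x, W)) + 2) ^ d5"
        "eval po (nv x # nv W # rest) = return_spmf (of_truth (\<not> x < W), t)"
        using po[OF i, of rest] by auto
      have "csize (\<lambda>_. 0) ?\<Delta> ((1, 0), (x, W)) \<le> csize (\<lambda>_. 0) \<Gamma> ((1, 0), (x, W))"
        by (simp add: \<Gamma>_def del: vsize.simps)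
      then have "(csize (\<lambda>_. 0) ?\<Delta> ((1, 0), (x, W)) + 2) ^ d5 \<le> (csize (\<lambda>_. 0) \<Gamma> ((1, 0), (x, W)) + 2) ^ d5"
        by (intro power_mono) auto
      with t(1) have "t \<le> (csize (\<lambda>_. 0) \<Gamma> ((1, 0), (x, W)) + 2) ^ d5" by linarith
      from le_B[OF this i] have "t \<le> B W" by (simp add: D_def)
      then show ?thesis using t(2) unfolding K2_def by (intro exI[of _ t]) simp
    qed
    have draw': "\<exists>T. eval draw (nv x # nv W # rest) = map_spmf (\<lambda>z. (nv z, T z)) (spmf_of_set {..<2 ^ n}) \<and> (\<forall>z. T z \<le> K2 W)"
      if "x < 2 * W" for x using T that by blast
    have size: "vsize (nv x) \<le> K2 W" if "x < 2 * W" for x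
      using vsize_nat_double[OF that] linear_le_B[of W] unfolding K2_def \<omega>_def by simp
    show ?thesis
      unfolding eval_s
      using reject_outcome[OF W n, where c = "\<lambda>v. eval po (v # nv W # rest)" and f = "\<lambda>v. eval draw (v # nv W # rest)", OF po' draw' size]
        reject_time[OF W n, where c = "\<lambda>v. eval po (v # nv W # rest)" and f = "\<lambda>v. eval draw (v # nv W # rest)", OF po' draw' size]
      by blast
  qed
  have "pbounded UNIV \<omega> (\<lambda>W. 1 + \<omega> W + 4 * (2 * K2 W + 1))"
    unfolding K2_def K1_def B_def
    by (intro pbounded_add pbounded_mult pbounded_power pbounded_const pbounded_self)
  then obtain d where d: "\<And>W. 1 + \<omega> W + 4 * (2 * K2 W + 1) \<le> (\<omega> W + 2) ^ d" unfolding pbounded_def by auto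
  show ?thesis
  proof (intro exI[of _ s] exI[of _ d] allI impI conjI)
    fix W :: nat and rest assume W: "0 < W"
    show "map_spmf fst (eval s (nv W # rest)) = map_spmf nv (spmf_of_set {..<W})" using main[OF W] by blast
    have "(\<integral>\<^sup>+ z. of_nat (snd z) \<partial>measure_spmf (eval s (nv W # rest))) \<le> of_nat (1 + \<omega> W + 4 * (2 * K2 W + 1))"
      using main[OF W] by blast
    also have "\<dots> \<le> of_nat ((vsize (nv W) + 2) ^ d)" using d[of W] unfolding \<omega>_def by (intro of_nat_mono)
    finally show "(\<integral>\<^sup>+ z. of_nat (snd z) \<partial>measure_spmf (eval s (nv W # rest))) \<le> of_nat ((vsize (nv W) + 2) ^ d)" .
  qed
qed

section \<open>The improvisation scheme\<close>

text \<open>The improviser for a representation \<open>r\<close> is a fixed program applied to the encoding of \<open>r\<close>: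
  it recomputes the weights, samples a number below the total weight, and unranks it.\<close>

lemma improviser_exists:
  "\<exists>q d. \<forall>r\<in>dfa_instances k. solvable k r \<longrightarrow>
     outcome (Bind (Const (dfa_lqci_val r)) q) [] = spmf_of_pmf (map_pmf word_val (sample_pmf k r)) \<and>
     expected_time (Bind (Const (dfa_lqci_val r)) q) [] \<le> of_nat ((vsize (dfa_lqci_val r) + cost_magnitude r + 2) ^ d)"
proof -
  define X where "X = {r \<in> dfa_instances k. solvable k r}"
  have "given k X cost_magnitude [dfa_lqci_val] (\<lambda>r. r)"
    by (simp add: given_def X_def ptime_head)
  from ptime_sample_count[OF this, unfolded ptime_def] obtain p d1 where p [rule_format]: "\<forall>r\<in>X. \<forall>rest. \<exists>t.
      t \<le> (csize cost_magnitude [dfa_lqci_val] r + 2) ^ d1 \<and> vsize (nv (sample_count k r)) \<le> t \<and>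
      eval p (map (\<lambda>g. g r) [dfa_lqci_val] @ rest) = return_spmf (nv (sample_count k r), t)"
    by blast
  define Y where "Y = {y. fst y \<in> X \<and> snd y < sample_count k (fst y)}"
  \<comment> \<open>Behind the drawn number the environment still holds the total weight and the
    instance.\<close>
  let ?\<Gamma> = "[\<lambda>y. nv (snd y), \<lambda>y. nv (sample_count k (fst y)), \<lambda>y. dfa_lqci_val (fst y)]"
  have "given k Y (\<lambda>y. cost_magnitude (fst y)) ?\<Gamma> fst"
    unfolding given_def by (intro conjI ptime_var) (auto simp: X_def Y_def)
  from ptime_sample_word[OF this ptime_head, unfolded ptime_def] obtain u d2 where u [rule_format]:
     "\<forall>y\<in>Y. \<forall>rest. \<exists>t. t \<le> (csize (\<lambda>y. cost_magnitude (fst y)) ?\<Gamma> y + 2) ^ d2 \<and>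
      vsize (word_val (sample_word k (fst y) (snd y))) \<le> t \<and>
      eval u (map (\<lambda>g. g y) ?\<Gamma> @ rest) = return_spmf (word_val (sample_word k (fst y) (snd y)), t)"
    unfolding Y_def by blast
  obtain s d3 where s: "\<And>W rest. 0 < W \<Longrightarrow> map_spmf fst (eval s (nv W # rest)) = map_spmf nv (spmf_of_set {..<W})"
    "\<And>W rest. 0 < W \<Longrightarrow>
      (\<integral>\<^sup>+ z. of_nat (snd z) \<partial>measure_spmf (eval s (nv W # rest))) \<le> of_nat ((vsize (nv W) + 2) ^ d3)"
    using sampler_exists by blast
  define q where "q = Bind p (Bind s u)"
  define size where "size r = vsize (dfa_lqci_val r) + cost_magnitude r" for r
  define A where "A r = (size r + 2) ^ d1" for r
  define B where "B r = (2 * A r + size r + 2) ^ d2" for r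
  define C where "C r = (A r + 2) ^ d3 + (size r + 4 * B r + A r + 10)" for r
  have "pbounded UNIV size C"
    unfolding C_def B_def A_def by (intro pbounded_add pbounded_mult pbounded_power pbounded_const pbounded_self)
  then obtain d where d: "\<And>r. C r \<le> (size r + 2) ^ d" unfolding pbounded_def by auto
  have main: "outcome (Bind (Const (dfa_lqci_val r)) q) [] = spmf_of_pmf (map_pmf word_val (sample_pmf k r)) \<and>
      expected_time (Bind (Const (dfa_lqci_val r)) q) [] \<le> of_nat (C r)" if r: "r \<in> X" for r
  proof -
    define W where "W = sample_count k r"
    interpret dfa_instance k r by unfold_locales (use r in \<open>simp add: X_def\<close>)
    have W: "0 < W" unfolding W_def by (rule improvising_sample_pmf) (use r in \<open>simp add: X_def\<close>)
    let ?enc = "dfa_lqci_val r"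
    obtain tp where tp: "tp \<le> A r" "vsize (nv W) \<le> tp" "eval p [?enc] = return_spmf (nv W, tp)"
      using p[OF r, of "[]"] by (auto simp: A_def size_def W_def add.commute)
    have "\<exists>t. t \<le> B r \<and> vsize (word_val (sample_word k r x)) \<le> t \<and>
        eval u [nv x, nv W, ?enc] = return_spmf (word_val (sample_word k r x), t)" if x: "x < W" for x
    proof -
      have y: "(r, x) \<in> Y" using r x by (simp add: Y_def W_def)
      obtain t where t: "t \<le> (csize (\<lambda>y. cost_magnitude (fst y)) ?\<Gamma> (r, x) + 2) ^ d2"
        "vsize (word_val (sample_word k r x)) \<le> t"
        "eval u [nv x, nv W, ?enc] = return_spmf (word_val (sample_word k r x), t)"
        using u[OF y, of "[]"] by (auto simp: W_def)
      have "vsize (nv x) \<le> vsize (nv W)" using x by (intro vsize_nat_mono) simp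
      then have "csize (\<lambda>y. cost_magnitude (fst y)) ?\<Gamma> (r, x) + 2 \<le> 2 * A r + size r + 2"
        using tp(1,2) by (simp add: size_def W_def del: vsize.simps)
      then have "(csize (\<lambda>y. cost_magnitude (fst y)) ?\<Gamma> (r, x) + 2) ^ d2 \<le> B r"
        unfolding B_def by (intro power_mono) auto
      with t show ?thesis by (meson le_trans)
    qed
    then obtain tu where tu: "\<And>x. x < W \<Longrightarrow> tu x \<le> B r \<and> vsize (word_val (sample_word k r x)) \<le> tu x \<and>
        eval u [nv x, nv W, ?enc] = return_spmf (word_val (sample_word k r x), tu x)" by metis
    define S where "S = eval s [nv W, ?enc]"
    have S: "map_spmf fst S = map_spmf nv (spmf_of_set {..<W})" unfolding S_def by (rule s(1)[OF W])
    define h where "h v = word_val (sample_word k r (nat (the_int v)))" for v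
    define g where "g v t = 1 + vsize ?enc + (tp + (t + tu (nat (the_int v)) + 1 + vsize (h v)) + 1 + vsize (h v)) + 1 + vsize (h v)" for v t
    have in_S: "\<exists>x<W. v = nv x" if "(v, t) \<in> set_spmf S" for v t
    proof -
      have "v \<in> set_spmf (map_spmf fst S)" using that by force
      then show ?thesis unfolding S by auto
    qed
    have "eval (Bind (Const ?enc) q) [] = bind_spmf S (\<lambda>(v, t). bind_spmf (eval u [v, nv W, ?enc]) (\<lambda>(w, t').
        return_spmf (w, 1 + vsize ?enc + (tp + (t + t' + 1 + vsize w) + 1 + vsize w) + 1 + vsize w)))"
      by (simp add: q_def charge_def tp(3) S_def split_def del: vsize.simps)
    also have "\<dots> = bind_spmf S (\<lambda>(v, t). return_spmf (h v, g v t))"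
    proof (rule bind_spmf_cong[OF refl], clarify)
      fix v t assume "(v, t) \<in> set_spmf S"
      then obtain x where "x < W" "v = nv x" using in_S by blast
      then show "bind_spmf (eval u [v, nv W, ?enc]) (\<lambda>(w, t').
          return_spmf (w, 1 + vsize ?enc + (tp + (t + t' + 1 + vsize w) + 1 + vsize w) + 1 + vsize w))
        = return_spmf (h v, g v t)"
        using tu[of x] by (simp add: h_def g_def del: vsize.simps)
    qed
    also have "\<dots> = map_spmf (\<lambda>(v, t). (h v, g v t)) S"
      by (simp add: map_spmf_conv_bind_spmf split_def)
    finally have eval_eq: "eval (Bind (Const ?enc) q) [] = map_spmf (\<lambda>(v, t). (h v, g v t)) S" .
    have "outcome (Bind (Const ?enc) q) [] = map_spmf h (map_spmf fst S)"
      unfolding outcome_def eval_eq by (simp add: spmf.map_comp o_def split_def)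
    also have "\<dots> = map_spmf (\<lambda>x. word_val (sample_word k r x)) (spmf_of_set {..<W})"
      unfolding S by (simp add: spmf.map_comp o_def h_def)
    also have "\<dots> = spmf_of_pmf (map_pmf word_val (sample_pmf k r))"
      using W unfolding sample_pmf_def W_def[symmetric]
      by (simp add: spmf_of_set_def map_pmf_comp lessThan_empty_iff del: spmf_of_pmf_pmf_of_set)
    finally have outcome: "outcome (Bind (Const ?enc) q) [] = spmf_of_pmf (map_pmf word_val (sample_pmf k r))" .
    \<comment> \<open>Termination with probability 1 follows from the outcome being a full
      distribution.\<close>
    then have lossless: "lossless_spmf (eval (Bind (Const ?enc) q) [])"
      unfolding outcome_def by (metis lossless_map_spmf lossless_spmf_spmf_of_spmf)
    have "expected_time (Bind (Const ?enc) q) [] = (\<integral>\<^sup>+ z. of_nat (g (fst z) (snd z)) \<partial>measure_spmf S)"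
      using lossless unfolding expected_time_def eval_eq
      by (simp add: map_spmf_conv_bind_spmf nn_integral_bind_spmf nn_integral_measure_spmf_option[of "return_spmf _"] split_def)
    \<comment> \<open>Only the time \<open>snd z\<close> of the sampler needs the expectation; the
      deterministic rest is bounded on every run.\<close>
    also have "\<dots> \<le> (\<integral>\<^sup>+ z. of_nat (snd z) + of_nat (size r + 4 * B r + A r + 10) \<partial>measure_spmf S)"
    proof (rule nn_integral_mono_AE)
      show "AE z in measure_spmf S. (of_nat (g (fst z) (snd z)) :: ennreal) \<le> of_nat (snd z) + of_nat (size r + 4 * B r + A r + 10)"
        unfolding AE_measure_spmf_iff
      proof
        fix z assume "z \<in> set_spmf S"
        then obtain x where x: "x < W" "fst z = nv x" using in_S[of "fst z" "snd z"] by auto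
        have "g (fst z) (snd z) \<le> snd z + (size r + 4 * B r + A r + 10)"
          using tu[OF x(1)] tp(1) by (simp add: g_def h_def x(2) size_def del: vsize.simps)
        then show "(of_nat (g (fst z) (snd z)) :: ennreal) \<le> of_nat (snd z) + of_nat (size r + 4 * B r + A r + 10)"
          unfolding of_nat_add[symmetric] by (rule of_nat_mono)
      qed
    qed
    also have "\<dots> = (\<integral>\<^sup>+ z. of_nat (snd z) \<partial>measure_spmf S) +
        of_nat (size r + 4 * B r + A r + 10) * emeasure (measure_spmf S) (space (measure_spmf S))"
      by (simp add: nn_integral_add)
    also have "\<dots> \<le> of_nat ((vsize (nv W) + 2) ^ d3) + of_nat (size r + 4 * B r + A r + 10) * 1"
      unfolding S_def by (intro add_mono mult_left_mono s(2)[OF W] measure_spmf.subprob_emeasure_le_1) auto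
    also have "\<dots> = of_nat ((vsize (nv W) + 2) ^ d3 + (size r + 4 * B r + A r + 10))" by simp
    also have "\<dots> \<le> of_nat (C r)"
      unfolding C_def using tp(1,2) by (intro of_nat_mono add_mono power_mono) auto
    finally show ?thesis using outcome by blast
  qed
  show ?thesis
  proof (intro exI[of _ q] exI[of _ d] ballI impI conjI)
    fix r assume "r \<in> dfa_instances k" "solvable k r"
    then have r: "r \<in> X" by (simp add: X_def)
    show "outcome (Bind (Const (dfa_lqci_val r)) q) [] = spmf_of_pmf (map_pmf word_val (sample_pmf k r))"
      using main[OF r] by blast
    have "expected_time (Bind (Const (dfa_lqci_val r)) q) [] \<le> of_nat (C r)" using main[OF r] by blast
    also have "\<dots> \<le> of_nat ((vsize (dfa_lqci_val r) + cost_magnitude r + 2) ^ d)"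
      using d[of r] unfolding size_def by (intro of_nat_mono)
    finally show "expected_time (Bind (Const (dfa_lqci_val r)) q) []
        \<le> of_nat ((vsize (dfa_lqci_val r) + cost_magnitude r + 2) ^ d)" .
  qed
qed

text \<open>The scheme tests solvability and writes the instance into a fixed program, so its time
  is bounded on its only run.\<close>

theorem theorem4:
  fixes k :: nat
  shows "\<exists>S. improvisation_scheme k (dfa_instances k) (lqci_of k) dfa_lqci_val S \<and>
             pseudopolynomial (dfa_instances k) dfa_lqci_val cost_magnitude S"
proof -
  obtain q d where out: "\<And>r. r \<in> dfa_instances k \<Longrightarrow> solvable k r \<Longrightarrow>
      outcome (Bind (Const (dfa_lqci_val r)) q) [] = spmf_of_pmf (map_pmf word_val (sample_pmf k r))"
    and time: "\<And>r. r \<in> dfa_instances k \<Longrightarrow> solvable k r \<Longrightarrow>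
      expected_time (Bind (Const (dfa_lqci_val r)) q) [] \<le> of_nat ((vsize (dfa_lqci_val r) + cost_magnitude r + 2) ^ d)"
    using improviser_exists[of k] by blast
  define P where "P r = Bind (Const (dfa_lqci_val r)) q" for r
  define res where "res r = (if solvable k r then ListV [code (P r)] else ListV [])" for r
  have given: "given k (dfa_instances k) cost_magnitude [dfa_lqci_val] (\<lambda>r. r)"
    by (simp add: given_def ptime_head)
  \<comment> \<open>The code of a constant contains its value as it stands, so the code of
    \<open>P r\<close> arises from the encoding of \<open>r\<close> by a few list
    operations.\<close>
  have "ptime (dfa_instances k) cost_magnitude [dfa_lqci_val] res"
    unfolding res_def[abs_def] P_def code.simps
    by (intro ptime_if ptime_solvable[OF given] ptime_Cons ptime_Nil ptime_const ptime_head)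
  then obtain S e where S: "\<forall>r\<in>dfa_instances k. \<forall>rest. \<exists>t. t \<le> (csize cost_magnitude [dfa_lqci_val] r + 2) ^ e \<and>
      vsize (res r) \<le> t \<and> eval S (map (\<lambda>g. g r) [dfa_lqci_val] @ rest) = return_spmf (res r, t)"
    unfolding ptime_def by blast
  have eval_S: "\<exists>t. t \<le> (vsize (dfa_lqci_val r) + cost_magnitude r + 2) ^ e \<and>
      eval S [dfa_lqci_val r] = return_spmf (res r, t)" if "r \<in> dfa_instances k" for r
    using S[rule_format, OF that, of "[]"] by (auto simp: add.assoc)
  have "lqci_solution k (lqci_of k r) (res r)" if r: "r \<in> dfa_instances k" for r
  proof -
    interpret dfa_instance k r by unfold_locales (rule r)
    have "improviser k (lqci_of k r) (P r)" if solv: "solvable k r"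
    proof -
      have "expected_time (P r) [] < \<infinity>"
        unfolding infinity_ennreal_def P_def by (rule le_less_trans[OF time[OF r solv] of_nat_less_top])
      then show ?thesis
        unfolding improviser_def using out[OF r solv] improvising_sample_pmf(2)[OF solv] P_def by auto
    qed
    then show ?thesis
      by (auto simp: lqci_solution_def feasible_iff_solvable res_def)
  qed
  then have "improvisation_scheme k (dfa_instances k) (lqci_of k) dfa_lqci_val S"
    unfolding improvisation_scheme_def expected_time_def outcome_def
    using eval_S by (fastforce simp: nn_integral_measure_spmf_option of_nat_less_top)
  moreover have "pseudopolynomial (dfa_instances k) dfa_lqci_val cost_magnitude S"
    unfolding pseudopolynomial_def
  \<comment> \<open>\<open>[:2, 1:]\<close> has the value \<open>n + 2\<close> at \<open>n\<close>;
    one summand serves the scheme, the other the improvisers.\<close>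
  proof (intro exI[of _ "[:2, 1:] ^ e + [:2, 1:] ^ d"] ballI, clarify)
    fix r v t assume r: "r \<in> dfa_instances k" and "(v, t) \<in> set_spmf (eval S [dfa_lqci_val r])"
    with eval_S[OF r] have v: "v = res r" and t: "t \<le> (vsize (dfa_lqci_val r) + cost_magnitude r + 2) ^ e" by auto
    let ?n = "vsize (dfa_lqci_val r) + cost_magnitude r"
    let ?b = "[:2, 1:] ^ e + [:2, 1:] ^ d :: nat poly"
    have b: "poly ?b ?n = (?n + 2) ^ e + (?n + 2) ^ d" by (simp add: add.commute)
    have "expected_time P' [] \<le> of_nat (poly ?b ?n)" if "v = ListV [code P']" for P'
    proof -
      \<comment> \<open>Injectivity of \<open>code\<close> identifies the returned program as
        \<open>P r\<close>.\<close>
      have "solvable k r" "P' = P r"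
        using that v by (auto simp: res_def code_inject split: if_splits)
      then have "expected_time P' [] \<le> of_nat ((?n + 2) ^ d)" using time[OF r] by (simp add: P_def)
      also have "\<dots> \<le> of_nat (poly ?b ?n)" unfolding b by (intro of_nat_mono) simp
      finally show ?thesis .
    qed
    then show "t \<le> poly ?b ?n \<and> (\<forall>P. v = ListV [code P] \<longrightarrow> expected_time P [] \<le> of_nat (poly ?b ?n))"
      using t unfolding b by auto
  qed
  ultimately show ?thesis by blast
qed

end
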